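(* Consider a port-Hamiltonian descriptor system $(E,J,R,Q,B)$ with $A=(J-R)Q$, $C=B^\top Q$, such that $(E,A)$ is regular, $(E,A,B)$ is strongly stabilizable and $(E,A,C)$ is strongly detectable. Then: (i) there exist stabilizing solutions of (GC) and of (GF); (ii) any two stabilizing solutions $\mathcal P_{\mathrm c,1},\mathcal P_{\mathrm c,2}$ of (GC) satisfy $E^\top\mathcal P_{\mathrm c,1}=E^\top\mathcal P_{\mathrm c,2}$, and any two stabilizing solutions $\mathcal P_{\mathrm f,1},\mathcal P_{\mathrm f,2}$ of (GF) satisfy $E\mathcal P_{\mathrm f,1}^\top=E\mathcal P_{\mathrm f,2}^\top$; (iii) if $Q$ is invertible, then $Q^{-\top}$ is a stabilizing solution of (GF); (iv) there exist stabilizing solutions $\mathcal P_{\mathrm c}$ of (GC) and $\mathcal P_{\mathrm f}$ of (GF) such that $I_n+\mathcal P_{\mathrm f}\mathcal P_{\mathrm c}^\top$ is invertible.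
   Context: A pH descriptor system: $E,J,R,Q\in\mathbb{R}^{n\times n}$, $B\in\mathbb{R}^{n\times m}$, $E^\top Q=Q^\top E\succeq0$, $J^\top=-J$, $R=R^\top\succeq0$, $A:=(J-R)Q$, $C:=B^\top Q$. A pencil $(E,A)$ is regular if $\det(sE-A)\ne0$ for some $s\in\mathbb{C}$; finite eigenvalues are $\lambda$ with $\lambda Ev=Av$, $v\ne0$; a regular pencil is impulse-free if in its Weierstraß form $P^{-1}E\widetilde P=\mathrm{diag}(I,N)$, $P^{-1}A\widetilde P=\mathrm{diag}(W,I)$ ($N$ nilpotent, $P,\widetilde P$ invertible) one has $N=0$. For regular $(E,A)$, $(E,A,B)$ is impulse controllable if $\mathrm{rank}[E\ \ AS\ \ B]=n$ with $\mathrm{im}\,S=\ker E$; strongly stabilizable if impulse controllable and $\mathrm{rank}[\lambda E-A\ \ B]=n$ for all $\mathrm{Re}\,\lambda\ge0$; $(E,A,C)$ is strongly detectable if $(E^\top,A^\top,C^\top)$ is strongly stabilizable. Modified GAREs: (GC) $A^\top\mathcal P_{\mathrm c}+\mathcal P_{\mathrm c}^\top A-\mathcal P_{\mathrm c}^\top BB^\top\mathcal P_{\mathrm c}+C^\top C=0$, $E^\top\mathcal P_{\mathrm c}=\mathcal P_{\mathrm c}^\top E$; (GF) $A\mathcal P_{\mathrm f}^\top+\mathcal P_{\mathrm f}A^\top-\mathcal P_{\mathrm f}C^\top C\mathcal P_{\mathrm f}^\top+BB^\top+2R=0$, $E\mathcal P_{\mathrm f}^\top=\mathcal P_{\mathrm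 f}E^\top$. A solution $\mathcal P_{\mathrm c}$ is stabilizing if $(E,A-BB^\top\mathcal P_{\mathrm c})$ is regular, impulse-free with all finite eigenvalues in the open left half-plane; $\mathcal P_{\mathrm f}$ is stabilizing if $(E,A-\mathcal P_{\mathrm f}C^\top C)$ is. *)

theory Defs
  imports Complex_Main "Jordan_Normal_Form.DL_Rank_Submatrix" "Jordan_Normal_Form.Matrix_Kernel"
    "Jordan_Normal_Form.Determinant"
begin

definition cmat :: "real mat \<Rightarrow> complex mat" where
  "cmat M = map_mat complex_of_real M"

definition hcat :: "'a::zero mat \<Rightarrow> 'a mat \<Rightarrow> 'a mat" where
  "hcat M1 M2 = mat (dim_row M1) (dim_col M1 + dim_col M2)
     (\<lambda>(i,j). if j < dim_col M1 then M1 $$ (i,j) else M2 $$ (i, j - dim_col M1))"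

definition psd :: "nat \<Rightarrow> real mat \<Rightarrow> bool" where
  "psd n M \<longleftrightarrow> M \<in> carrier_mat n n \<and> transpose_mat M = M \<and>
     (\<forall>x \<in> carrier_vec n. x \<bullet> (M *\<^sub>v x) \<ge> 0)"

definition pH_system :: "nat \<Rightarrow> nat \<Rightarrow> real mat \<Rightarrow> real mat \<Rightarrow> real mat \<Rightarrow> real mat \<Rightarrow> real mat \<Rightarrow> bool" where
  "pH_system n m E J R Q B \<longleftrightarrow>
     E \<in> carrier_mat n n \<and> J \<in> carrier_mat n n \<and> R \<in> carrier_mat n n \<and> Q \<in> carrier_mat n n \<and>
     B \<in> carrier_mat n m \<and>
     transpose_mat E * Q = transpose_mat Q * E \<and> psd n (transpose_mat E * Q) \<and>
     transpose_mat J = - J \<and> psd n R"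

definition regular_pencil :: "nat \<Rightarrow> real mat \<Rightarrow> real mat \<Rightarrow> bool" where
  "regular_pencil n E A \<longleftrightarrow> (\<exists>s::complex. det (s \<cdot>\<^sub>m cmat E - cmat A) \<noteq> 0)"

definition finite_eigenvalue :: "nat \<Rightarrow> real mat \<Rightarrow> real mat \<Rightarrow> complex \<Rightarrow> bool" where
  "finite_eigenvalue n E A lam \<longleftrightarrow>
     (\<exists>v \<in> carrier_vec n. v \<noteq> 0\<^sub>v n \<and> lam \<cdot>\<^sub>v (cmat E *\<^sub>v v) = cmat A *\<^sub>v v)"

definition weierstrass_form :: "nat \<Rightarrow> real mat \<Rightarrow> real mat \<Rightarrow> real mat \<Rightarrow> real mat \<Rightarrow> nat \<Rightarrow> real mat \<Rightarrow> real mat \<Rightarrow> bool" where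
  "weierstrass_form n E A P Pt k W N \<longleftrightarrow>
     P \<in> carrier_mat n n \<and> Pt \<in> carrier_mat n n \<and> invertible_mat P \<and> invertible_mat Pt \<and>
     k \<le> n \<and> W \<in> carrier_mat k k \<and> N \<in> carrier_mat (n - k) (n - k) \<and>
     (\<exists>j. N ^\<^sub>m j = 0\<^sub>m (n - k) (n - k)) \<and>
     E * Pt = P * four_block_mat (1\<^sub>m k) (0\<^sub>m k (n - k)) (0\<^sub>m (n - k) k) N \<and>
     A * Pt = P * four_block_mat W (0\<^sub>m k (n - k)) (0\<^sub>m (n - k) k) (1\<^sub>m (n - k))"

definition impulse_free :: "nat \<Rightarrow> real mat \<Rightarrow> real mat \<Rightarrow> bool" where
  "impulse_free n E A \<longleftrightarrow> regular_pencil n E A \<and>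
     (\<exists>P Pt k W N. weierstrass_form n E A P Pt k W N \<and> N = 0\<^sub>m (n - k) (n - k))"

definition stable_pencil :: "nat \<Rightarrow> real mat \<Rightarrow> real mat \<Rightarrow> bool" where
  "stable_pencil n E A \<longleftrightarrow> regular_pencil n E A \<and> impulse_free n E A \<and>
     (\<forall>lam. finite_eigenvalue n E A lam \<longrightarrow> Re lam < 0)"

definition impulse_controllable :: "nat \<Rightarrow> real mat \<Rightarrow> real mat \<Rightarrow> real mat \<Rightarrow> bool" where
  "impulse_controllable n E A B \<longleftrightarrow>
     (\<exists>k S. S \<in> carrier_mat n k \<and> {S *\<^sub>v x | x. x \<in> carrier_vec k} = mat_kernel E \<and>
        vec_space.rank n (hcat (hcat E (A * S)) B) = n)"

definition strongly_stabilizable :: "nat \<Rightarrow> real mat \<Rightarrow> real mat \<Rightarrow> real mat \<Rightarrow> bool" where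
  "strongly_stabilizable n E A B \<longleftrightarrow> impulse_controllable n E A B \<and>
     (\<forall>lam::complex. Re lam \<ge> 0 \<longrightarrow>
        vec_space.rank n (hcat (lam \<cdot>\<^sub>m cmat E - cmat A) (cmat B)) = n)"

definition strongly_detectable :: "nat \<Rightarrow> real mat \<Rightarrow> real mat \<Rightarrow> real mat \<Rightarrow> bool" where
  "strongly_detectable n E A C \<longleftrightarrow>
     strongly_stabilizable n (transpose_mat E) (transpose_mat A) (transpose_mat C)"

definition GC_sol :: "nat \<Rightarrow> real mat \<Rightarrow> real mat \<Rightarrow> real mat \<Rightarrow> real mat \<Rightarrow> real mat \<Rightarrow> bool" where
  "GC_sol n E A B C Pc \<longleftrightarrow> Pc \<in> carrier_mat n n \<and>
     transpose_mat A * Pc + transpose_mat Pc * A - transpose_mat Pc * B * transpose_mat B * Pc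
       + transpose_mat C * C = 0\<^sub>m n n \<and>
     transpose_mat E * Pc = transpose_mat Pc * E"

definition GF_sol :: "nat \<Rightarrow> real mat \<Rightarrow> real mat \<Rightarrow> real mat \<Rightarrow> real mat \<Rightarrow> real mat \<Rightarrow> real mat \<Rightarrow> bool" where
  "GF_sol n E A B C R Pf \<longleftrightarrow> Pf \<in> carrier_mat n n \<and>
     A * transpose_mat Pf + Pf * transpose_mat A - Pf * transpose_mat C * C * transpose_mat Pf
       + B * transpose_mat B + 2 \<cdot>\<^sub>m R = 0\<^sub>m n n \<and>
     E * transpose_mat Pf = Pf * transpose_mat E"

definition GC_stabilizing :: "nat \<Rightarrow> real mat \<Rightarrow> real mat \<Rightarrow> real mat \<Rightarrow> real mat \<Rightarrow> real mat \<Rightarrow> bool" where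
  "GC_stabilizing n E A B C Pc \<longleftrightarrow> GC_sol n E A B C Pc \<and>
     stable_pencil n E (A - B * transpose_mat B * Pc)"

definition GF_stabilizing :: "nat \<Rightarrow> real mat \<Rightarrow> real mat \<Rightarrow> real mat \<Rightarrow> real mat \<Rightarrow> real mat \<Rightarrow> real mat \<Rightarrow> bool" where
  "GF_stabilizing n E A B C R Pf \<longleftrightarrow> GF_sol n E A B C R Pf \<and>
     stable_pencil n E (A - Pf * transpose_mat C * C)"

end

theory Submission
  imports Defs "Jordan_Normal_Form.Schur_Decomposition"
begin

text \<open>
  In coordinates with \<open>E = diag(I, 0)\<close> the constraint \<open>E\<^sup>T P = P\<^sup>T E\<close> makes \<open>P\<close> block lower triangular.
  Its lower right block satisfies an algebraic Riccati equation in which \<open>P\<^sub>2\<^sub>2\<close> need not be symmetric,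
  so \<open>A\<^sub>2\<^sub>2\<close> may be multiplied from both sides by invertible matrices and brought to the form
  \<open>diag(-I, 0)\<close>; impulse controllability then becomes ordinary stabilizability and the classical Riccati
  equation supplies a positive semidefinite \<open>P\<^sub>2\<^sub>2\<close>. The off-diagonal block is determined linearly, and the
  upper left block satisfies a second classical Riccati equation, with data inheriting stabilizability
  and detectability from the pencil. The classical equation is solved through the stable invariant
  subspace of the Hamiltonian matrix.

  Conversely every solution with \<open>E\<^sup>T P \<ge> 0\<close> is stabilizing, by the Lyapunov argument; this also covers
  \<open>Q\<^sup>-\<^sup>T\<close>. Uniqueness reduces to a Sylvester equation with two stable coefficients. For
  \<open>I + P\<^sub>f P\<^sub>c\<^sup>T\<close>, both equations are solved in the same coordinates, so that both algebraic blocks are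
  positive semidefinite and a kernel vector can be eliminated block by block.
\<close>

section \<open>Finitely supported complex matrices\<close>

text \<open>A Riccati equation for a symmetric unknown admits only congruences, and these do not
  bring a general algebraic block to a normal form. Here only \<open>star E * P\<close> is
  symmetric, so the rows and columns of the pencil may be transformed independently
  (\<open>gare_transform\<close>). The sign in \<open>diag(-I, 0)\<close> leaves 0 as the only
  eigenvalue in the closed right half-plane. Its eigenvectors form the kernel of the block, and on
  this kernel the Hautus test is precisely the test for impulse controllability. (GF) is (GC) for
  the transposed pencil, with unknown \<open>G\<close>, the transpose of \<open>Pf\<close>, and with
  the constant term enlarged by the semidefinite \<open>2 R\<close>. Everything is therefore proved
  once, for the equation \<open>gare\<close>, and carried over by \<open>stable_f_star\<close>.
  Invariant subspaces come from a Schur form and are complex, even for real data. Reality of the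
  Riccati solution is recovered afterwards: its conjugate solves the same equation, and positive
  semidefinite solutions are unique.\<close>

text \<open>
  Matrices of all formats live in one ring, so that matrix identities need no dimension side conditions.
  The unit matrix of size \<open>n\<close> becomes the idempotent \<open>prj 0 n\<close>, real matrices are the fixed points of
  \<open>cconj\<close>, a vector is an arbitrary \<open>fmat\<close> (read columnwise), and the quadratic form of \<open>Q\<close> is
  \<open>Re (tr (star v * Q * v))\<close>.
\<close>

typedef fmat = "{f :: nat \<Rightarrow> nat \<Rightarrow> complex. \<exists>N. \<forall>i j. N \<le> i \<or> N \<le> j \<longrightarrow> f i j = 0}"
  morphisms ent Abs_fmat
  by (intro exI[of _ "\<lambda>i j. 0"]) simp

setup_lifting type_definition_fmat

definition bnd :: "nat \<Rightarrow> fmat \<Rightarrow> bool" where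
  "bnd N x \<longleftrightarrow> (\<forall>i j. N \<le> i \<or> N \<le> j \<longrightarrow> ent x i j = 0)"

lemma ex_bnd: "\<exists>N. bnd N x"
  unfolding bnd_def by transfer simp

lemma bnd_mono: "bnd N x \<Longrightarrow> N \<le> M \<Longrightarrow> bnd M x"
  unfolding bnd_def by (meson order_trans)

lemma ex_bnd2: "\<exists>N. bnd N x \<and> bnd N y"
  by (metis bnd_mono ex_bnd nle_le)

lemma ex_bnd3: "\<exists>N. bnd N x \<and> bnd N y \<and> bnd N z"
  by (metis bnd_mono ex_bnd nle_le)

lemma fmat_eqI: "(\<And>i j. ent x i j = ent y i j) \<Longrightarrow> x = y"
  by transfer (simp add: fun_eq_iff)

lemma bnd_zero: "bnd N x \<Longrightarrow> N \<le> i \<or> N \<le> j \<Longrightarrow> ent x i j = 0"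
  unfolding bnd_def by blast

instantiation fmat :: ring
begin

lift_definition zero_fmat :: fmat is "\<lambda>i j. 0" by simp

lift_definition plus_fmat :: "fmat \<Rightarrow> fmat \<Rightarrow> fmat" is "\<lambda>f g i j. f i j + g i j"
proof -
  fix f g :: "nat \<Rightarrow> nat \<Rightarrow> complex"
  assume "\<exists>N. \<forall>i j. N \<le> i \<or> N \<le> j \<longrightarrow> f i j = 0" "\<exists>N. \<forall>i j. N \<le> i \<or> N \<le> j \<longrightarrow> g i j = 0"
  then obtain N M where "\<forall>i j. N \<le> i \<or> N \<le> j \<longrightarrow> f i j = 0" "\<forall>i j. M \<le> i \<or> M \<le> j \<longrightarrow> g i j = 0"
    by blast
  then show "\<exists>N. \<forall>i j. N \<le> i \<or> N \<le> j \<longrightarrow> f i j + g i j = 0"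
    by (intro exI[of _ "max N M"]) auto
qed

lift_definition uminus_fmat :: "fmat \<Rightarrow> fmat" is "\<lambda>f i j. - f i j" by simp

definition minus_fmat :: "fmat \<Rightarrow> fmat \<Rightarrow> fmat" where "minus_fmat x y = x + - y"

text \<open>Summing over the support of a row of the left factor avoids choosing a bound inside the
  definition; \<open>ent_times\<close> replaces it by any sufficiently long range
  \<open>k < N\<close>.\<close>

lift_definition times_fmat :: "fmat \<Rightarrow> fmat \<Rightarrow> fmat" is
  "\<lambda>f g i j. \<Sum>k | f i k \<noteq> 0. f i k * g k j"
proof -
  fix f g :: "nat \<Rightarrow> nat \<Rightarrow> complex"
  assume "\<exists>N. \<forall>i j. N \<le> i \<or> N \<le> j \<longrightarrow> f i j = 0" "\<exists>N. \<forall>i j. N \<le> i \<or> N \<le> j \<longrightarrow> g i j = 0"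
  then obtain N M where "\<forall>i j. N \<le> i \<or> N \<le> j \<longrightarrow> f i j = 0" "\<forall>i j. M \<le> i \<or> M \<le> j \<longrightarrow> g i j = 0"
    by blast
  then show "\<exists>N. \<forall>i j. N \<le> i \<or> N \<le> j \<longrightarrow> (\<Sum>k | f i k \<noteq> 0. f i k * g k j) = 0"
    by (intro exI[of _ "max N M"]) auto
qed

lemma ent_zero [simp]: "ent 0 i j = 0" by transfer simp
lemma ent_plus [simp]: "ent (x + y) i j = ent x i j + ent y i j" by transfer simp
lemma ent_uminus [simp]: "ent (- x) i j = - ent x i j" by transfer simp
lemma ent_minus [simp]: "ent (x - y) i j = ent x i j - ent y i j" by (simp add: minus_fmat_def)

lemma ent_times: "bnd N x \<Longrightarrow> ent (x * y) i j = (\<Sum>k<N. ent x i k * ent y k j)"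
proof -
  assume N: "bnd N x"
  have "ent (x * y) i j = (\<Sum>k | ent x i k \<noteq> 0. ent x i k * ent y k j)" by transfer simp
  also have "\<dots> = (\<Sum>k<N. ent x i k * ent y k j)"
    by (rule sum.mono_neutral_left) (use N in \<open>auto simp: bnd_def, meson leI\<close>)
  finally show ?thesis .
qed

lemma bnd_times: "bnd N x \<Longrightarrow> bnd N y \<Longrightarrow> bnd N (x * y)"
  by (simp add: bnd_def ent_times[of N])

instance
proof
  fix a b c :: fmat
  obtain N where N: "bnd N a" "bnd N b" "bnd N c" using ex_bnd3 by blast
  show "a * b * c = a * (b * c)"
  proof (rule fmat_eqI)
    fix i j
    have "ent (a * b * c) i j = (\<Sum>k<N. \<Sum>l<N. ent a i l * ent b l k * ent c k j)"
      by (simp add: ent_times[OF bnd_times[OF N(1,2)]] ent_times[OF N(1)] sum_distrib_right)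
    also have "\<dots> = (\<Sum>l<N. \<Sum>k<N. ent a i l * ent b l k * ent c k j)" by (rule sum.swap)
    also have "\<dots> = ent (a * (b * c)) i j"
      by (simp add: ent_times[OF N(1)] ent_times[OF N(2)] sum_distrib_left mult.assoc)
    finally show "ent (a * b * c) i j = ent (a * (b * c)) i j" .
  qed
  have ab: "bnd N (a + b)" using N by (simp add: bnd_def)
  show "(a + b) * c = a * c + b * c"
    by (rule fmat_eqI) (simp add: ent_times[OF ab] ent_times[OF N(1)] ent_times[OF N(2)] sum.distrib distrib_right)
  show "a * (b + c) = a * b + a * c"
    by (rule fmat_eqI) (simp add: ent_times[OF N(1)] sum.distrib distrib_left)
qed (auto intro!: fmat_eqI)

end

lift_definition star :: "fmat \<Rightarrow> fmat" is "\<lambda>f i j. cnj (f j i)" by auto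
lift_definition cconj :: "fmat \<Rightarrow> fmat" is "\<lambda>f i j. cnj (f i j)" by auto
lift_definition scal :: "complex \<Rightarrow> fmat \<Rightarrow> fmat" is "\<lambda>c f i j. c * f i j" by auto
text \<open>Blocks are cut out by half-open index intervals and keep their place: a lower right
  block is \<open>f * x * f\<close> with \<open>f = prj r n\<close>, never re-indexed to start at 0.
  An empty interval gives 0, the base case of several inductions below.\<close>

lift_definition prj :: "nat \<Rightarrow> nat \<Rightarrow> fmat" is "\<lambda>a b i j. if i = j \<and> a \<le> i \<and> i < b then 1 else 0"
  subgoal for a b by (intro exI[of _ b]) auto done

lemma ent_star [simp]: "ent (star x) i j = cnj (ent x j i)" by transfer simp
lemma ent_cconj [simp]: "ent (cconj x) i j = cnj (ent x i j)" by transfer simp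
lemma ent_scal [simp]: "ent (scal c x) i j = c * ent x i j" by transfer simp
lemma ent_prj: "ent (prj a b) i j = (if i = j \<and> a \<le> i \<and> i < b then 1 else 0)" by transfer simp

lemma bnd_star [simp]: "bnd N (star x) = bnd N x"
  and bnd_cconj [simp]: "bnd N (cconj x) = bnd N x"
  unfolding bnd_def by auto

lemma star_add [simp]: "star (x + y) = star x + star y"
  and star_minus [simp]: "star (x - y) = star x - star y"
  and star_uminus [simp]: "star (- x) = - star x"
  and star_zero [simp]: "star 0 = 0"
  and star_star [simp]: "star (star x) = x"
  and star_scal [simp]: "star (scal c x) = scal (cnj c) (star x)"
  and star_prj [simp]: "star (prj a b) = prj a b"
  by (auto intro!: fmat_eqI simp: ent_prj)

lemma star_times [simp]: "star (x * y) = star y * star x"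
proof -
  obtain N where N: "bnd N x" "bnd N y" using ex_bnd2 by blast
  show ?thesis
    by (rule fmat_eqI) (simp add: ent_times[OF N(1)] ent_times[of N] N mult.commute)
qed

lemma cconj_add [simp]: "cconj (x + y) = cconj x + cconj y"
  and cconj_minus [simp]: "cconj (x - y) = cconj x - cconj y"
  and cconj_uminus [simp]: "cconj (- x) = - cconj x"
  and cconj_zero [simp]: "cconj 0 = 0"
  and cconj_cconj [simp]: "cconj (cconj x) = x"
  and cconj_scal [simp]: "cconj (scal c x) = scal (cnj c) (cconj x)"
  and cconj_prj [simp]: "cconj (prj a b) = prj a b"
  and cconj_star [simp]: "cconj (star x) = star (cconj x)"
  by (auto intro!: fmat_eqI simp: ent_prj)

lemma cconj_times [simp]: "cconj (x * y) = cconj x * cconj y"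
proof -
  obtain N where N: "bnd N x" using ex_bnd by blast
  then show ?thesis
    by (intro fmat_eqI) (simp add: ent_times[OF N] ent_times[of N])
qed

lemma scal_mult_left [simp]: "scal c x * y = scal c (x * y)"
proof -
  obtain N where N: "bnd N x" using ex_bnd by blast
  then have "bnd N (scal c x)" by (simp add: bnd_def)
  then show ?thesis
    by (intro fmat_eqI) (simp add: ent_times[OF N] ent_times[of N] sum_distrib_left mult.assoc)
qed

lemma scal_mult_right [simp]: "x * scal c y = scal c (x * y)"
proof -
  obtain N where N: "bnd N x" using ex_bnd by blast
  then show ?thesis
    by (intro fmat_eqI) (simp add: ent_times[OF N] sum_distrib_left mult.left_commute)
qed

lemma scal_scal [simp]: "scal c (scal d x) = scal (c * d) x"
  and scal_zero [simp]: "scal c 0 = 0"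
  and scal_0 [simp]: "scal 0 x = 0"
  and scal_1 [simp]: "scal 1 x = x"
  by (auto intro!: fmat_eqI)

lemma scal_add: "scal c (x + y) = scal c x + scal c y"
  and scal_minus: "scal c (x - y) = scal c x - scal c y"
  and scal_uminus_left: "scal (- c) x = - scal c x"
  and scal_add_left: "scal (c + d) x = scal c x + scal d x"
  by (auto intro!: fmat_eqI simp: algebra_simps)

lemma scal_eq_0_iff: "scal c x = 0 \<longleftrightarrow> c = 0 \<or> x = 0"
proof
  assume *: "scal c x = 0"
  show "c = 0 \<or> x = 0"
  proof (rule disjCI)
    assume "x \<noteq> 0"
    then obtain i j where "ent x i j \<noteq> 0" by (metis ent_zero fmat_eqI)
    then show "c = 0" using arg_cong[OF *, of "\<lambda>z. ent z i j"] by simp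
  qed
qed auto

lemma ent_prj_times: "ent (prj a b * x) i j = (if a \<le> i \<and> i < b then ent x i j else 0)"
proof -
  have "bnd b (prj a b)" by (auto simp: bnd_def ent_prj)
  then have "ent (prj a b * x) i j = (\<Sum>k<b. (if i = k then (if a \<le> i then ent x i j else 0) else 0))"
    by (subst ent_times, assumption) (rule sum.cong, auto simp: ent_prj)
  also have "\<dots> = (if a \<le> i \<and> i < b then ent x i j else 0)" by (subst sum.delta') auto
  finally show ?thesis .
qed

lemma ent_times_prj: "ent (x * prj a b) i j = (if a \<le> j \<and> j < b then ent x i j else 0)"
proof -
  have "ent (x * prj a b) i j = cnj (ent (prj a b * star x) j i)"
    by (metis ent_star star_times star_star star_prj complex_cnj_cnj)
  then show ?thesis by (simp add: ent_prj_times)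
qed

lemma prj_prj [simp]: "prj a b * prj a b = prj a b"
  by (rule fmat_eqI) (auto simp: ent_prj_times ent_prj)

lemma prj_prj_assoc [simp]: "prj a b * (prj a b * x) = prj a b * x"
  by (metis mult.assoc prj_prj)

lemma prj_split: "a \<le> b \<Longrightarrow> b \<le> c \<Longrightarrow> prj a c = prj a b + prj b c"
  by (rule fmat_eqI) (auto simp: ent_prj)

lemma prj_inter: "prj a b * prj c d = prj (max a c) (min b d)"
  by (rule fmat_eqI) (auto simp: ent_prj_times ent_prj)

lemma prj_empty: "b \<le> a \<Longrightarrow> prj a b = 0"
  by (rule fmat_eqI) (auto simp: ent_prj)

section \<open>Trace and Frobenius norm\<close>

lift_definition tr :: "fmat \<Rightarrow> complex" is "\<lambda>f. \<Sum>i | f i i \<noteq> 0. f i i" .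

lemma tr_bnd: "bnd N x \<Longrightarrow> tr x = (\<Sum>i<N. ent x i i)"
proof -
  assume N: "bnd N x"
  have "tr x = (\<Sum>i | ent x i i \<noteq> 0. ent x i i)" by transfer simp
  also have "\<dots> = (\<Sum>i<N. ent x i i)"
    by (rule sum.mono_neutral_left) (use N in \<open>auto simp: bnd_def, meson leI\<close>)
  finally show ?thesis .
qed

lemma tr_zero [simp]: "tr 0 = 0" by transfer simp

lemma tr_add [simp]: "tr (x + y) = tr x + tr y"
proof -
  obtain N where "bnd N x" "bnd N y" using ex_bnd2 by blast
  then show ?thesis by (subst (1 2 3) tr_bnd[of N]) (auto simp: sum.distrib bnd_def)
qed

lemma tr_scal [simp]: "tr (scal c x) = c * tr x"
proof -
  obtain N where "bnd N x" using ex_bnd by blast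
  then show ?thesis by (subst (1 2) tr_bnd[of N]) (auto simp: sum_distrib_left bnd_def)
qed

lemma tr_uminus [simp]: "tr (- x) = - tr x"
  using tr_add[of x "- x"] by (simp add: eq_neg_iff_add_eq_0 add.commute del: tr_add)

lemma tr_minus [simp]: "tr (x - y) = tr x - tr y"
  using tr_add[of x "- y"] by simp

lemma tr_star [simp]: "tr (star x) = cnj (tr x)"
proof -
  obtain N where "bnd N x" using ex_bnd by blast
  then show ?thesis by (subst (1 2) tr_bnd[of N]) auto
qed

lemma tr_cconj [simp]: "tr (cconj x) = cnj (tr x)"
proof -
  obtain N where "bnd N x" using ex_bnd by blast
  then show ?thesis by (subst (1 2) tr_bnd[of N]) auto
qed

text \<open>This trace is the squared Frobenius norm; it plays the role of the squared length of a
  vector, also when \<open>x\<close> has several columns.\<close>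

lemma tr_star_self_nonneg: "0 \<le> Re (tr (star x * x))"
    and tr_star_self_eq_0: "Re (tr (star x * x)) = 0 \<Longrightarrow> x = 0"
proof -
  obtain N where N: "bnd N x" using ex_bnd by blast
  have *: "Re (tr (star x * x)) = (\<Sum>i<N. \<Sum>k<N. (norm (ent x k i))\<^sup>2)"
    by (simp add: tr_bnd[OF bnd_times[of N]] N ent_times[of N] cmod_power2)
      (simp add: power2_eq_square)
  show "0 \<le> Re (tr (star x * x))" unfolding * by (intro sum_nonneg) auto
  show "x = 0" if "Re (tr (star x * x)) = 0"
  proof (rule fmat_eqI)
    fix i j
    have "\<forall>i\<in>{..<N}. (\<Sum>k<N. (norm (ent x k i))\<^sup>2) = 0"
      using that unfolding * by (subst (asm) sum_nonneg_eq_0_iff) (auto intro: sum_nonneg)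
    then have "i < N \<Longrightarrow> k < N \<Longrightarrow> ent x k i = 0" for i k
      by (subst (asm) sum_nonneg_eq_0_iff) auto
    then show "ent x i j = ent 0 i j" using bnd_zero[OF N, of i j] by (metis ent_zero leI)
  qed
qed

section \<open>Transfer from matrices with carriers\<close>

lift_definition emb :: "complex mat \<Rightarrow> fmat" is
  "\<lambda>M i j. if i < dim_row M \<and> j < dim_col M then M $$ (i,j) else 0"
  subgoal for M by (intro exI[of _ "max (dim_row M) (dim_col M)"]) auto done

lemma ent_emb: "ent (emb M) i j = (if i < dim_row M \<and> j < dim_col M then M $$ (i,j) else 0)"
  by (simp add: emb.rep_eq)

lemma emb_mult: "dim_col A = dim_row B \<Longrightarrow> emb (A * B) = emb A * emb B"
proof (rule fmat_eqI)
  fix i j assume d: "dim_col A = dim_row B"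
  let ?N = "max (dim_row A) (dim_col A)"
  have "bnd ?N (emb A)" by (auto simp: bnd_def ent_emb)
  then have "ent (emb A * emb B) i j = (\<Sum>k<?N. ent (emb A) i k * ent (emb B) k j)" by (rule ent_times)
  also have "\<dots> = (\<Sum>k\<in>{0..<dim_row B}. ent (emb A) i k * ent (emb B) k j)"
    by (rule sum.mono_neutral_right) (auto simp: ent_emb d)
  also have "\<dots> = ent (emb (A * B)) i j"
    using d by (auto simp: ent_emb scalar_prod_def intro!: sum.cong)
  finally show "ent (emb (A * B)) i j = ent (emb A * emb B) i j" ..
qed

lemma emb_minus: "A \<in> carrier_mat n m \<Longrightarrow> B \<in> carrier_mat n m \<Longrightarrow> emb (A - B) = emb A - emb B"
  and emb_smult: "emb (c \<cdot>\<^sub>m A) = scal c (emb A)"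
  and emb_one: "emb (1\<^sub>m n) = prj 0 n"
  by (auto intro!: fmat_eqI simp: ent_emb ent_prj)

lemma emb_transpose_cmat: "emb (cmat (transpose_mat A)) = star (emb (cmat A))"
  by (rule fmat_eqI) (auto simp: ent_emb cmat_def)

lemma prj_emb [simp]: "A \<in> carrier_mat n m \<Longrightarrow> prj 0 n * emb A = emb A"
  and emb_prj [simp]: "A \<in> carrier_mat n m \<Longrightarrow> emb A * prj 0 m = emb A"
  by (auto intro!: fmat_eqI simp: ent_emb ent_prj_times ent_times_prj)

definition mt :: "nat \<Rightarrow> nat \<Rightarrow> fmat \<Rightarrow> complex mat" where
  "mt n m x = mat n m (\<lambda>(i,j). ent x i j)"

lemma mt_carrier [simp]: "mt n m x \<in> carrier_mat n m"
  and dim_mt [simp]: "dim_row (mt n m x) = n" "dim_col (mt n m x) = m"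
  by (simp_all add: mt_def)

lemma emb_mt: "emb (mt n m x) = prj 0 n * x * prj 0 m"
  by (rule fmat_eqI) (auto simp: ent_emb ent_prj_times ent_times_prj mt_def)

lemma emb_mt_corner: "prj 0 n * x = x \<Longrightarrow> x * prj 0 m = x \<Longrightarrow> emb (mt n m x) = x"
  by (simp add: emb_mt)

lemma emb_inj: "A \<in> carrier_mat n m \<Longrightarrow> B \<in> carrier_mat n m \<Longrightarrow> emb A = emb B \<Longrightarrow> A = B"
proof (rule eq_matI)
  fix i j assume a: "A \<in> carrier_mat n m" "B \<in> carrier_mat n m" "emb A = emb B"
    "i < dim_row B" "j < dim_col B"
  have "ent (emb A) i j = ent (emb B) i j" by (simp only: a(3))
  with a(1,2,4,5) show "A $$ (i,j) = B $$ (i,j)" by (simp add: ent_emb)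
qed auto

definition colv :: "nat \<Rightarrow> fmat \<Rightarrow> nat \<Rightarrow> complex vec" where
  "colv n x j = vec n (\<lambda>i. ent x i j)"

lemma colv_carrier [simp]: "colv n x j \<in> carrier_vec n"
  by (simp add: colv_def)

lemma colv_mult: "A \<in> carrier_mat n m \<Longrightarrow> A *\<^sub>v colv m x j = colv n (emb A * x) j"
proof (rule eq_vecI)
  fix i assume A: "A \<in> carrier_mat n m" and i: "i < dim_vec (colv n (emb A * x) j)"
  let ?N = "max n m"
  have "bnd ?N (emb A)" using A by (auto simp: bnd_def ent_emb)
  then have "ent (emb A * x) i j = (\<Sum>k<?N. ent (emb A) i k * ent x k j)" by (rule ent_times)
  also have "\<dots> = (\<Sum>k\<in>{0..<m}. ent (emb A) i k * ent x k j)"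
    by (rule sum.mono_neutral_right) (use A in \<open>auto simp: ent_emb\<close>)
  also have "\<dots> = (A *\<^sub>v colv m x j) $ i"
    using i A by (auto simp: ent_emb scalar_prod_def colv_def intro!: sum.cong)
  finally show "(A *\<^sub>v colv m x j) $ i = colv n (emb A * x) j $ i" using i by (simp add: colv_def)
qed (auto simp: colv_def)

lemma colv_zeroD: "(\<And>j. colv n x j = 0\<^sub>v n) \<Longrightarrow> prj 0 n * x = x \<Longrightarrow> x = 0"
proof (rule fmat_eqI)
  fix i j assume *: "\<And>j. colv n x j = 0\<^sub>v n" "prj 0 n * x = x"
  have "i < n \<Longrightarrow> ent x i j = 0" using arg_cong[OF *(1)[of j], of "\<lambda>v. v $ i"] by (simp add: colv_def)
  moreover have "ent x i j = (if i < n then ent x i j else 0)"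
    using *(2) ent_prj_times[of 0 n x i j] by simp
  ultimately show "ent x i j = ent 0 i j" by (auto split: if_splits)
qed

lemma colv_zero [simp]: "colv n 0 j = 0\<^sub>v n"
  by (auto simp: colv_def)

definition emv :: "complex vec \<Rightarrow> fmat" where
  "emv v = emb (mat (dim_vec v) 1 (\<lambda>(i,j). v $ i))"

lemma emv_carrier: "v \<in> carrier_vec n \<Longrightarrow> prj 0 n * emv v = emv v"
  unfolding emv_def by (rule prj_emb[of _ _ 1]) simp

lemma emv_mult: "A \<in> carrier_mat n m \<Longrightarrow> v \<in> carrier_vec m \<Longrightarrow> emv (A *\<^sub>v v) = emb A * emv v"
proof -
  assume A: "A \<in> carrier_mat n m" and v: "v \<in> carrier_vec m"
  have "mat (dim_vec (A *\<^sub>v v)) 1 (\<lambda>(i,j). (A *\<^sub>v v) $ i) = A * mat (dim_vec v) 1 (\<lambda>(i,j). v $ i)"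
    using A v by (intro eq_matI) (auto simp: scalar_prod_def intro!: sum.cong)
  then show ?thesis unfolding emv_def using A v by (simp add: emb_mult)
qed

lemma emv_smult: "emv (c \<cdot>\<^sub>v v) = scal c (emv v)"
  by (auto intro!: fmat_eqI simp: emv_def ent_emb)

lemma emv_eq_0: "v \<in> carrier_vec n \<Longrightarrow> emv v = 0 \<longleftrightarrow> v = 0\<^sub>v n"
proof
  assume v: "v \<in> carrier_vec n" "emv v = 0"
  have "v $ i = ent (emv v) i 0" if "i < n" for i
    using that v(1) by (simp add: emv_def ent_emb)
  then show "v = 0\<^sub>v n" using v by (intro eq_vecI) auto
qed (auto intro!: fmat_eqI simp: emv_def ent_emb)

text \<open>The usual criterion for vectors, applied to each column of \<open>x\<close>
  separately.\<close>

lemma det_nonzero_iff_inj: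
  assumes A: "A \<in> carrier_mat n n"
  shows "det A \<noteq> 0 \<longleftrightarrow> (\<forall>x. prj 0 n * x = x \<longrightarrow> emb A * x = 0 \<longrightarrow> x = 0)"
proof
  assume d: "det A \<noteq> 0"
  show "\<forall>x. prj 0 n * x = x \<longrightarrow> emb A * x = 0 \<longrightarrow> x = 0"
  proof (intro allI impI)
    fix x assume x: "prj 0 n * x = x" "emb A * x = 0"
    have "colv n x j = 0\<^sub>v n" for j
      using d x(2) colv_mult[OF A, of x j] colv_carrier[of n x j] unfolding det_0_iff_vec_prod_zero[OF A]
      by (metis colv_zero)
    then show "x = 0" using colv_zeroD x(1) by blast
  qed
next
  assume *: "\<forall>x. prj 0 n * x = x \<longrightarrow> emb A * x = 0 \<longrightarrow> x = 0"
  show "det A \<noteq> 0"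
  proof
    assume "det A = 0"
    then obtain v where v: "v \<in> carrier_vec n" "v \<noteq> 0\<^sub>v n" "A *\<^sub>v v = 0\<^sub>v n"
      unfolding det_0_iff_vec_prod_zero[OF A] by blast
    have "emb A * emv v = 0" using emv_mult[OF A v(1)] v(3) emv_eq_0[of "0\<^sub>v n" n] by simp
    with * v emv_carrier[OF v(1)] emv_eq_0[OF v(1)] show False by blast
  qed
qed

text \<open>The inverse is the adjugate divided by the determinant. It inherits reality by
  uniqueness: for real \<open>x\<close> its conjugate is a right inverse too, and evaluating
  \<open>emb B * x * cconj (emb B)\<close> in two ways identifies both.\<close>

lemma inj_imp_inverse:
  assumes x: "prj 0 n * x = x" "x * prj 0 n = x"
    and inj: "\<And>v. prj 0 n * v = v \<Longrightarrow> x * v = 0 \<Longrightarrow> v = 0"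
  obtains y where "prj 0 n * y = y" "y * prj 0 n = y" "x * y = prj 0 n" "y * x = prj 0 n"
    "cconj x = x \<Longrightarrow> cconj y = y"
proof -
  define A where "A = mt n n x"
  have A: "A \<in> carrier_mat n n" and eA: "emb A = x" by (simp_all add: A_def emb_mt_corner x)
  have d: "det A \<noteq> 0" using inj unfolding det_nonzero_iff_inj[OF A] eA by blast
  define B where "B = (1 / det A) \<cdot>\<^sub>m adj_mat A"
  note adj = adj_mat[OF A]
  have B: "B \<in> carrier_mat n n" using adj by (simp add: B_def)
  have one: "(1 / det A) \<cdot>\<^sub>m (det A \<cdot>\<^sub>m 1\<^sub>m n) = 1\<^sub>m n" by (rule eq_matI) (auto simp: d)
  have "A * B = 1\<^sub>m n" "B * A = 1\<^sub>m n"
    using adj A one by (simp_all add: B_def mult_smult_distrib[OF A] mult_smult_assoc_mat[OF adj(1) A])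
  then have xy: "x * emb B = prj 0 n" "emb B * x = prj 0 n"
    using A B eA by (simp_all add: emb_mult[symmetric] emb_one flip: eA)
  have y: "prj 0 n * emb B = emb B" "emb B * prj 0 n = emb B"
    using prj_emb[OF B] emb_prj[OF B] by simp_all
  have "cconj (emb B) = emb B" if r: "cconj x = x"
  proof -
    have "x * cconj (emb B) = prj 0 n" using arg_cong[OF xy(1), of cconj] r by simp
    then have "emb B * x * cconj (emb B) = emb B * prj 0 n" by (simp add: mult.assoc)
    moreover have "prj 0 n * cconj (emb B) = cconj (emb B)" using arg_cong[OF y(1), of cconj] by simp
    ultimately show ?thesis using xy y by simp
  qed
  with xy y show thesis using that by blast
qed

text \<open>A maximal independent set of columns has \<open>n\<close> elements and forms an
  invertible square matrix \<open>A\<close>; a vector annihilated by the transpose of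
  \<open>M\<close> is annihilated by that of \<open>A\<close>.\<close>

lemma (in vec_space) full_rank_left_kernel:
  assumes M: "M \<in> carrier_mat n c" and r: "rank M = n"
    and y: "y \<in> carrier_vec n" and yM: "transpose_mat M *\<^sub>v y = 0\<^sub>v c"
  shows "y = 0\<^sub>v n"
proof -
  let ?P = "\<lambda>T. T \<subseteq> set (cols M) \<and> lin_indpt T"
  have "?P {}" by (simp add: lin_dep_def)
  then obtain U where U: "finite U" "maximal U ?P"
    using maximal_exists_superset[of "set (cols M)" ?P "{}"] by auto
  have cU: "card U = n" using rank_card_indpt[OF M U(2)] r by simp
  from U have U': "U \<subseteq> set (cols M)" "lin_indpt U" by (simp_all add: maximal_def)
  obtain us where us: "set us = U" "distinct us" using finite_distinct_list[OF U(1)] by blast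
  have len: "length us = n" using distinct_card[OF us(2)] us(1) cU by simp
  have dv: "set us \<subseteq> carrier_vec n" using us U' cols_dim[of M] M by auto
  define A where "A = mat_of_cols n us"
  have A: "A \<in> carrier_mat n n" by (simp add: A_def len[symmetric])
  have cA: "cols A = us" using cols_mat_of_cols[OF dv] by (simp add: A_def)
  have "rank A = n" by (rule lin_indpt_full_rank[OF A]) (simp_all add: cA us U')
  then have "det A \<noteq> 0" using det_rank_iff[OF A] by simp
  then have dT: "det (transpose_mat A) \<noteq> 0" using det_transpose[OF A] by simp
  have "transpose_mat A *\<^sub>v y = 0\<^sub>v n"
  proof (rule eq_vecI)
    fix i assume "i < dim_vec (0\<^sub>v n :: 'a vec)"
    then have i: "i < n" by simp
    then have "col A i \<in> set (cols M)" using U' us cA len A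
      by (metis carrier_matD(2) cols_nth nth_mem subsetD)
    then obtain j where j: "j < c" "col A i = col M j"
      using M by (metis carrier_matD(2) cols_length cols_nth in_set_conv_nth)
    have "(transpose_mat M *\<^sub>v y) $ j = col M j \<bullet> y" using j M by simp
    then have "col M j \<bullet> y = 0" using yM j by simp
    then show "(transpose_mat A *\<^sub>v y) $ i = 0\<^sub>v n $ i" using i A j by simp
  qed (use A in auto)
  then show ?thesis using dT det_0_iff_vec_prod_zero_field[of "transpose_mat A" n] A y by auto
qed

text \<open>The list \<open>es\<close> may be any ordering of the eigenvalues and fixes the diagonal
  of \<open>b\<close>. Choosing this order later makes the leading columns of \<open>p\<close> span
  the stable invariant subspace.\<close>

lemma schur_fmat:
  assumes h: "prj 0 m * h = h" "h * prj 0 m = h"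
    and es: "char_poly (mt m m h) = (\<Prod>e \<leftarrow> es. [:- e, 1:])"
  obtains p p' b where "prj 0 m * p = p" "p * prj 0 m = p" "prj 0 m * p' = p'" "p' * prj 0 m = p'"
    "prj 0 m * b = b" "b * prj 0 m = b" "p * p' = prj 0 m" "p' * p = prj 0 m" "h * p = p * b"
    "\<And>i j. j < i \<Longrightarrow> ent b i j = 0" "\<And>i. i < m \<Longrightarrow> ent b i i = es ! i"
    "length es = m"
proof -
  obtain B P Q where s: "schur_decomposition (mt m m h) es = (B,P,Q)" by (cases "schur_decomposition (mt m m h) es")
  from schur_decomposition[OF mt_carrier es s]
  have w: "similar_mat_wit (mt m m h) B P Q" and ut: "upper_triangular B" and dg: "diag_mat B = es" by auto
  from similar_mat_witD2[OF mt_carrier w]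
  have c: "B \<in> carrier_mat m m" "P \<in> carrier_mat m m" "Q \<in> carrier_mat m m"
    and PQ: "P * Q = 1\<^sub>m m" "Q * P = 1\<^sub>m m" and e: "mt m m h = P * B * Q" by auto
  have eh: "emb (mt m m h) = h" by (rule emb_mt_corner[OF h])
  have pq: "emb P * emb Q = prj 0 m" "emb Q * emb P = prj 0 m"
    using PQ c by (simp_all add: emb_mult[symmetric] emb_one)
  have "h = emb P * emb B * emb Q" using arg_cong[OF e, of emb] c unfolding eh by (simp add: emb_mult mult.assoc)
  then have hp: "h * emb P = emb P * emb B" using pq c by (simp add: mult.assoc)
  have len: "length es = m" using dg c by (auto simp: diag_mat_def)
  have "es ! i = B $$ (i,i)" if "i < m" for i
    using that c unfolding dg[symmetric] by (simp add: diag_mat_def)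
  then show thesis
    using c pq hp len ut by (intro that[of "emb P" "emb Q" "emb B"]) (auto simp: ent_emb)
qed

text \<open>Plain similarity invariance: \<open>b\<close> is arbitrary, for instance
  \<open>- star ham\<close> below.\<close>

lemma char_poly_upper_diag:
  assumes w: "prj 0 m * p = p" "p * prj 0 m = p" "prj 0 m * p' = p'" "p' * prj 0 m = p'"
    "prj 0 m * b = b" "b * prj 0 m = b" "p * p' = prj 0 m" "p' * p = prj 0 m" 
    and h: "h * p = p * b" "prj 0 m * h = h" "h * prj 0 m = h"
  shows "char_poly (mt m m h) = char_poly (mt m m b)"
proof (rule char_poly_similar)
  have m1: "mt m m x * mt m m y = 1\<^sub>m m" if "x * y = prj 0 m" "prj 0 m * x = x" "x * prj 0 m = x" "prj 0 m * y = y" "y * prj 0 m = y" for x y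
    by (rule emb_inj[of _ m m]) (simp_all add: emb_mult emb_mt_corner emb_one that mult_carrier_mat[of _ m m])
  have "h = h * (p * p')" using w h by simp
  also have "\<dots> = p * b * p'" using h(1) by (simp add: mult.assoc[symmetric])
  finally have hh: "h = p * b * p'" .
  have "mt m m h = mt m m p * mt m m b * mt m m p'"
    by (rule emb_inj[of _ m m]) (simp_all add: emb_mult emb_mt_corner w h hh[symmetric] mult_carrier_mat[of _ m m])
  then have "similar_mat_wit (mt m m h) (mt m m b) (mt m m p) (mt m m p')"
    using w m1 by (intro similar_mat_witI[of _ _ m]) auto
  then show "similar_mat (mt m m h) (mt m m b)" unfolding similar_mat_def by blast
qed

section \<open>Positive semidefinite and stable matrices\<close>

lemma mult_assocD: "x * y = (z :: 'a :: semigroup_mult) \<Longrightarrow> x * (y * w) = z * w"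
  by (metis mult.assoc)

definition psdf :: "fmat \<Rightarrow> bool" where
  "psdf q \<longleftrightarrow> star q = q \<and> (\<forall>v. 0 \<le> Re (tr (star v * q * v)))"

lemma psdf_star: "psdf q \<Longrightarrow> star q = q"
  by (simp add: psdf_def)

lemma psdf_nonneg: "psdf q \<Longrightarrow> 0 \<le> Re (tr (star v * (q * v)))"
  by (simp add: psdf_def mult.assoc)

lemma psdf_zero [simp]: "psdf 0"
  by (simp add: psdf_def)

lemma psdf_add: "psdf p \<Longrightarrow> psdf q \<Longrightarrow> psdf (p + q)"
  by (simp add: psdf_def distrib_left distrib_right)

lemma psdf_conj: "psdf q \<Longrightarrow> psdf (star x * q * x)"
  unfolding psdf_def
proof (intro conjI allI)
  fix v assume *: "star q = q \<and> (\<forall>v. 0 \<le> Re (tr (star v * q * v)))"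
  have "0 \<le> Re (tr (star (x * v) * q * (x * v)))" using * by blast
  then show "0 \<le> Re (tr (star v * (star x * q * x) * v))" by (simp add: mult.assoc)
qed (simp add: mult.assoc)

lemma psdf_square: "psdf (star x * x)"
  unfolding psdf_def
proof (intro conjI allI)
  fix v
  show "0 \<le> Re (tr (star v * (star x * x) * v))"
    using tr_star_self_nonneg[of "x * v"] by (simp add: mult.assoc)
qed simp

lemma psdf_scal: "0 \<le> c \<Longrightarrow> psdf q \<Longrightarrow> psdf (scal (of_real c) q)"
  by (simp add: psdf_def)

lemma psdf_cconj: "psdf q \<Longrightarrow> psdf (cconj q)"
  unfolding psdf_def
proof (intro conjI allI)
  fix v assume *: "star q = q \<and> (\<forall>v. 0 \<le> Re (tr (star v * q * v)))"
  then have "cconj (star q) = cconj q" by simp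
  then show "star (cconj q) = cconj q" by simp
  have "0 \<le> Re (tr (cconj (star (cconj v) * q * cconj v)))" using * unfolding tr_cconj by simp
  then show "0 \<le> Re (tr (star v * cconj q * v))" by simp
qed

text \<open>With \<open>w = q * v\<close> the form at \<open>v + t w\<close> equals
  \<open>2 t a + t^2 b\<close>, where \<open>a\<close> is the squared norm of \<open>w\<close>;
  nonnegativity for small negative \<open>t\<close> forces \<open>a = 0\<close>.\<close>

lemma psdf_kernel:
  assumes q: "psdf q" and z: "Re (tr (star v * (q * v))) = 0"
  shows "q * v = 0"
proof -
  define w where "w = q * v"
  define a where "a = Re (tr (star w * w))"
  define b where "b = Re (tr (star w * (q * w)))"
  have sw: "star w = star v * q" using q by (simp add: w_def psdf_star)
  have b0: "0 \<le> b" unfolding b_def by (rule psdf_nonneg[OF q])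
  have a0: "0 \<le> a" unfolding a_def by (rule tr_star_self_nonneg)
  have quad: "0 \<le> 2 * t * a + t\<^sup>2 * b" for t :: real
  proof -
    have "0 \<le> Re (tr (star (v + scal t w) * (q * (v + scal t w))))" by (rule psdf_nonneg[OF q])
    also have "star (v + scal t w) * (q * (v + scal t w))
        = star v * (q * v) + scal t (star w * w) + scal t (star w * w) + scal (t * t) (star w * (q * w))"
      by (simp add: distrib_left distrib_right scal_add w_def[symmetric])
        (simp add: sw mult.assoc w_def psdf_star[OF q])
    finally show ?thesis using z by (simp add: a_def b_def power2_eq_square)
  qed
  have "a = 0"
  proof (rule ccontr)
    assume "a \<noteq> 0"
    then have a: "a > 0" using a0 by simp
    \<comment> \<open>The value makes \<open>t * (b + 1) = - a\<close>, so the form collapses to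
      \<open>t a - t^2 < 0\<close>; the summand 1 keeps the denominator positive when
      \<open>b = 0\<close>.\<close>
    define t where "t = - a / (b + 1)"
    have t: "t * (b + 1) = - a" using b0 by (simp add: t_def)
    have "t < 0" using a b0 by (simp add: t_def divide_neg_pos)
    have "2 * t * a + t\<^sup>2 * b = t * a + (t * (b + 1) * t + t * a) - t\<^sup>2"
      by (simp add: power2_eq_square algebra_simps)
    also have "\<dots> = t * a - t\<^sup>2" unfolding t by simp
    also have "\<dots> < 0" using \<open>t < 0\<close> a mult_neg_pos[of t a] zero_le_power2[of t] by linarith
    finally show False using quad[of t] by simp
  qed
  then show ?thesis unfolding a_def w_def[symmetric] by (rule tr_star_self_eq_0)
qed

lemma psdf_kernel': "psdf q \<Longrightarrow> star v * (q * v) = 0 \<Longrightarrow> q * v = 0"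
  by (rule psdf_kernel) simp_all

definition corner :: "nat \<Rightarrow> fmat \<Rightarrow> bool" where
  "corner k x \<longleftrightarrow> prj 0 k * x = x \<and> x * prj 0 k = x"

lemma corner_left: "corner k x \<Longrightarrow> prj 0 k * x = x"
  and corner_right: "corner k x \<Longrightarrow> x * prj 0 k = x"
  and corner_left': "corner k x \<Longrightarrow> prj 0 k * (x * y) = x * y"
  and corner_right': "corner k x \<Longrightarrow> x * (prj 0 k * y) = x * y"
  by (simp_all add: corner_def mult.assoc[symmetric])

lemmas corner_simps = corner_left corner_right corner_left' corner_right'

lemma corner_zero [simp]: "corner k 0"
  and corner_prj: "b \<le> k \<Longrightarrow> corner k (prj a b)"
  and corner_add: "corner k x \<Longrightarrow> corner k y \<Longrightarrow> corner k (x + y)"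
  and corner_minus: "corner k x \<Longrightarrow> corner k y \<Longrightarrow> corner k (x - y)"
  and corner_uminus: "corner k x \<Longrightarrow> corner k (- x)"
  and corner_scal: "corner k x \<Longrightarrow> corner k (scal c x)"
  and corner_cconj: "corner k x \<Longrightarrow> corner k (cconj x)"
  and corner_times: "corner k x \<Longrightarrow> corner k y \<Longrightarrow> corner k (x * y)"
         apply (simp_all add: corner_def distrib_left distrib_right prj_inter left_diff_distrib right_diff_distrib)
   apply (metis cconj_prj cconj_times)
  apply (metis mult.assoc)
  done

lemma corner_star: "corner k x \<Longrightarrow> corner k (star x)"
  unfolding corner_def by (metis star_prj star_times)

lemmas corner_intros = corner_prj corner_add corner_minus corner_uminus corner_scal corner_cconj corner_times corner_star

lemma corner_mono: "corner k x \<Longrightarrow> k \<le> l \<Longrightarrow> corner l x"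
proof -
  assume x: "corner k x" and kl: "k \<le> l"
  have "prj 0 l * (prj 0 k * x) = prj 0 k * x" "(x * prj 0 k) * prj 0 l = x * prj 0 k"
    using kl by (simp_all add: mult.assoc prj_inter prj_inter[THEN mult_assocD] min_def)
  then show ?thesis using x by (simp add: corner_def)
qed

lemma prj_vec_mono: "prj 0 k * v = v \<Longrightarrow> k \<le> l \<Longrightarrow> prj 0 l * v = v"
  by (metis mult.assoc prj_inter max.idem min.absorb2)

text \<open>Eigenvectors are restricted to the corner because a matrix supported there has the
  eigenvalue 0 outside it.\<close>

definition hurwitz :: "nat \<Rightarrow> fmat \<Rightarrow> bool" where
  "hurwitz k x \<longleftrightarrow> (\<forall>lam v. prj 0 k * v = v \<longrightarrow> x * v = scal lam v \<longrightarrow> v \<noteq> 0 \<longrightarrow> Re lam < 0)"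

lemma hurwitzD: "hurwitz k x \<Longrightarrow> prj 0 k * v = v \<Longrightarrow> x * v = scal lam v \<Longrightarrow> 0 \<le> Re lam \<Longrightarrow> v = 0"
  by (metis hurwitz_def leD)

text \<open>If \<open>lam\<close> were an unstable eigenvalue of \<open>star x\<close>, then
  \<open>x - cnj lam\<close> would still be injective on the corner, hence invertible, and the
  adjoint of its inverse would annihilate the eigenvector.\<close>

lemma hurwitz_star:
  assumes x: "corner n x" and h: "hurwitz n x"
  shows "hurwitz n (star x)"
  unfolding hurwitz_def
proof (intro allI impI)
  fix lam v assume v: "prj 0 n * v = v" "star x * v = scal lam v" "v \<noteq> 0"
  define y where "y = x - scal (cnj lam) (prj 0 n)"
  have y: "corner n y" unfolding y_def using x by (intro corner_intros) auto
  show "Re lam < 0"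
  proof (rule ccontr)
    assume "\<not> Re lam < 0"
    then have inj: "w = 0" if "prj 0 n * w = w" "y * w = 0" for w
      using that hurwitzD[OF h, of w "cnj lam"] by (simp add: y_def left_diff_distrib)
    obtain z where z: "y * z = prj 0 n"
      by (rule inj_imp_inverse[of n y, OF corner_left[OF y] corner_right[OF y] inj]) auto
    have "star z * star y = prj 0 n" using arg_cong[OF z, of star] by simp
    then have "v = star z * (star y * v)" using v(1) by (simp add: mult.assoc[symmetric])
    also have "star y * v = 0" using v(1,2) by (simp add: y_def left_diff_distrib)
    finally show False using v(3) by simp
  qed
qed

lemma root_eigenvector:
  assumes h: "corner m h" and es: "char_poly (mt m m h) = (\<Prod>e \<leftarrow> es. [:- e, 1:])" and e: "e \<in> set es"
  obtains v where "prj 0 m * v = v" "v \<noteq> 0" "h * v = scal e v"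
proof -
  have "poly (char_poly (mt m m h)) e = 0"
    unfolding es poly_prod_list prod_list_zero_iff using e by auto
  then have "eigenvalue (mt m m h) e" using eigenvalue_root_char_poly[OF mt_carrier] by blast
  then obtain v where v: "v \<in> carrier_vec m" "v \<noteq> 0\<^sub>v m" "mt m m h *\<^sub>v v = e \<cdot>\<^sub>v v"
    unfolding eigenvalue_def eigenvector_def by auto
  have "h * emv v = scal e (emv v)"
    using emv_mult[OF mt_carrier v(1), of m h] v(3) h by (simp add: emb_mt_corner corner_def emv_smult)
  then show thesis using that v emv_eq_0 emv_carrier by blast
qed

section \<open>Triangular matrices: eigenvectors, Sylvester and Lyapunov equations\<close>

definition utri :: "nat \<Rightarrow> fmat \<Rightarrow> bool" where
  "utri k b \<longleftrightarrow> corner k b \<and> (\<forall>i j. j < i \<longrightarrow> ent b i j = 0)"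

lemma utri_prj: "utri k b \<Longrightarrow> b * prj 0 j = prj 0 j * (b * prj 0 j)"
  by (rule fmat_eqI) (auto simp: ent_prj_times ent_times_prj utri_def)

lemma utri_unit: "utri k b \<Longrightarrow> b * prj j (Suc j) = prj 0 j * (b * prj j (Suc j)) + scal (ent b j j) (prj j (Suc j))"
  by (rule fmat_eqI) (auto simp: ent_prj_times ent_times_prj utri_def ent_prj le_less_Suc_eq)

text \<open>A triangular \<open>b\<close> multiplies the last coordinate of \<open>v\<close> by its
  diagonal entry, so the difference is shorter by one coordinate. Two inductions below run on
  this.\<close>

lemma utri_step:
  assumes b: "utri k b" and v: "prj 0 (Suc j) * v = v"
  shows "prj 0 j * (b * v - scal (ent b j j) v) = b * v - scal (ent b j j) v"
proof -
  have v': "v = prj 0 j * v + prj j (Suc j) * v"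
    using v prj_split[of 0 j "Suc j"] by (simp add: distrib_right[symmetric])
  have "b * v = b * prj 0 j * v + b * prj j (Suc j) * v"
    by (subst v') (simp add: distrib_left mult.assoc)
  also have "\<dots> = prj 0 j * (b * prj 0 j) * v + (prj 0 j * (b * prj j (Suc j)) + scal (ent b j j) (prj j (Suc j))) * v"
    using utri_prj[OF b, of j] utri_unit[OF b, of j] by simp
  finally have "b * v = prj 0 j * (b * prj 0 j * v + b * prj j (Suc j) * v) + scal (ent b j j) (prj j (Suc j) * v)"
    by (simp add: distrib_left distrib_right mult.assoc add.assoc)
  moreover have "scal (ent b j j) v = prj 0 j * scal (ent b j j) v + scal (ent b j j) (prj j (Suc j) * v)"
    by (subst v') (simp add: scal_add)
  ultimately have "b * v - scal (ent b j j) v =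
      prj 0 j * (b * prj 0 j * v + b * prj j (Suc j) * v - scal (ent b j j) v)"
    by (simp add: right_diff_distrib distrib_left scal_add prj_inter[THEN mult_assocD] prj_empty)
  then show ?thesis by (metis prj_prj_assoc)
qed

text \<open>An invariant subspace, given by the predicate \<open>K\<close>, contains an eigenvector:
  as long as \<open>b * v - scal (ent b j j) v\<close> is nonzero, it is a shorter vector of the
  same subspace.\<close>

lemma utri_invariant_eigenvector:
  assumes b: "utri k b" and K: "\<And>v c. K v \<Longrightarrow> K (b * v - scal c v)"
    and v: "K v" "v \<noteq> 0" "prj 0 j * v = v"
  shows "\<exists>u \<mu>. K u \<and> u \<noteq> 0 \<and> prj 0 j * u = u \<and> b * u = scal \<mu> u"
  using v
proof (induction j arbitrary: v)
  case 0
  then show ?case by (simp add: prj_empty)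
next
  case (Suc j)
  define w where "w = b * v - scal (ent b j j) v"
  show ?case
  proof (cases "w = 0")
    case True
    then show ?thesis using Suc.prems by (auto simp: w_def)
  next
    case False
    have "prj 0 j * w = w" unfolding w_def by (rule utri_step[OF b Suc.prems(3)])
    then show ?thesis using Suc.IH[of w] K[OF Suc.prems(1), of "ent b j j"] False
      prj_vec_mono[of j _ "Suc j"] by (auto simp: w_def)
  qed
qed

text \<open>By \<open>utri_step\<close>, an eigenvector supported on the first \<open>j + 1\<close>
  indices either belongs to the diagonal entry at \<open>j\<close> or is supported on the first
  \<open>j\<close> indices.\<close>

lemma utri_hurwitz:
  assumes b: "utri k b" and d: "\<And>i. i < k \<Longrightarrow> Re (ent b i i) < 0"
  shows "hurwitz k b"
proof -
  have "Re lam < 0" if "prj 0 j * v = v" "b * v = scal lam v" "v \<noteq> 0" "j \<le> k" for lam v j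
    using that
  proof (induction j)
    case 0
    then show ?case by (simp add: prj_empty)
  next
    case (Suc j)
    have "prj 0 j * (scal (lam - ent b j j) v) = scal (lam - ent b j j) v"
      using utri_step[OF b Suc.prems(1)] Suc.prems(2)
      by (simp add: scal_add_left[of lam "- ent b j j" v, simplified scal_uminus_left, simplified, symmetric])
    then have "scal (lam - ent b j j) (prj 0 j * v - v) = 0" by (simp add: scal_minus)
    then consider "lam = ent b j j" | "prj 0 j * v = v" by (auto simp: scal_eq_0_iff)
    then show ?case using Suc d[of j] by cases auto
  qed
  then show ?thesis unfolding hurwitz_def by blast
qed

text \<open>After a Schur reduction of \<open>\<beta>\<close> the columns of \<open>M * P\<close>
  vanish from left to right: once the earlier ones are 0, column \<open>j\<close> is mapped by
  \<open>\<alpha>\<close> to \<open>- ent b j j\<close> times itself, and this factor has positive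
  real part.\<close>

lemma sylvester_zero:
  assumes "corner p \<alpha>" "corner q \<beta>" and h: "hurwitz p \<alpha>" "hurwitz q \<beta>"
    and M: "prj 0 p * M = M" "M * prj 0 q = M" and eq: "\<alpha> * M + M * \<beta> = 0"
  shows "M = 0"
proof -
  obtain es where es: "char_poly (mt q q \<beta>) = (\<Prod>e \<leftarrow> es. [:- e, 1:])"
    using char_poly_factorized[OF mt_carrier] by blast
  obtain P P' b where P: "prj 0 q * P = P" "P * prj 0 q = P" "P * P' = prj 0 q" "\<beta> * P = P * b"
    "prj 0 q * b = b" "b * prj 0 q = b" "\<And>i j. j < i \<Longrightarrow> ent b i j = 0"
    "\<And>i. i < q \<Longrightarrow> ent b i i = es ! i" "length es = q"
    by (rule schur_fmat[OF _ _ es]) (use assms(2) in \<open>auto simp: corner_def\<close>)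
  have b: "utri q b" using P by (simp add: utri_def corner_def)
  have d: "Re (ent b i i) < 0" if i: "i < q" for i
  proof -
    have "es ! i \<in> set es" using i P by auto
    from root_eigenvector[OF assms(2) es this] h(2) show ?thesis
      unfolding hurwitz_def P(8)[OF i] by metis
  qed
  have "j \<le> q \<Longrightarrow> M * P * prj 0 j = 0" for j
  proof (induction j)
    case 0
    then show ?case by (simp add: prj_empty)
  next
    case (Suc j)
    define u m where "u = prj j (Suc j)" and "m = M * P * u"
    have "\<alpha> * m = (\<alpha> * M) * P * u" by (simp add: m_def mult.assoc)
    also have "\<alpha> * M = - (M * \<beta>)" using eq by (simp add: eq_neg_iff_add_eq_0)
    also have "- (M * \<beta>) * P * u = - (M * P * (b * u))" by (simp add: mult.assoc P(4)[symmetric] P(4)[symmetric, THEN mult_assocD])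
    also have "b * u = prj 0 j * (b * u) + scal (ent b j j) u" unfolding u_def by (rule utri_unit[OF b])
    also have "M * P * (prj 0 j * (b * u) + scal (ent b j j) u) = (M * P * prj 0 j) * (b * u) + scal (ent b j j) m"
      by (simp add: distrib_left mult.assoc m_def)
    finally have am: "\<alpha> * m = scal (- ent b j j) m" using Suc by (simp add: scal_uminus_left)
    have "m = 0" by (rule hurwitzD[OF h(1) _ am]) (use M d[of j] Suc.prems in \<open>auto simp: m_def mult.assoc[symmetric]\<close>)
    then show ?case using prj_split[of 0 j "Suc j"] Suc by (simp add: distrib_left m_def u_def)
  qed
  from this[of q] have "M * P = 0" using P by (simp add: mult.assoc)
  then have "M * (P * P') = 0" by (simp add: mult.assoc[symmetric])
  then show ?thesis using P(3) M(2) by simp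
qed

lemma unit_sandwich: "prj j (Suc j) * (x * prj j (Suc j)) = scal (ent x j j) (prj j (Suc j))"
  by (rule fmat_eqI) (auto simp: ent_prj_times ent_times_prj ent_prj le_less_Suc_eq)

lemma tr_unit [simp]: "tr (prj j (Suc j)) = 1"
proof -
  have "tr (prj j (Suc j)) = (\<Sum>i<Suc j. if i = j then 1 else 0)"
    by (subst tr_bnd[of "Suc j"]) (auto simp: bnd_def ent_prj intro: sum.cong)
  then show ?thesis by simp
qed

text \<open>
  Induction on the size: the first diagonal entry of \<open>g\<close> is nonnegative because its coefficient is stable.
  If it is positive, its Schur complement solves the Lyapunov equation of the smaller triangular block;
  if it is zero, then its column is an eigenvector of \<open>star b\<close> for an unstable eigenvalue, hence zero.
\<close>

lemma lyapunov_triangular: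
  assumes "star g = g" "prj j k * g = g" "prj j k * b = b" "b * prj j k = b"
    and "\<And>r s. s < r \<Longrightarrow> ent b r s = 0" "\<And>i. j \<le> i \<Longrightarrow> i < k \<Longrightarrow> Re (ent b i i) < 0"
    and "psdf q" "star b * g + g * b = - q"
  shows "psdf g"
  using assms
proof (induction "k - j" arbitrary: j g b q)
  case 0
  then have "g = 0" using prj_empty[of k j] by simp
  then show ?case by simp
next
  case (Suc d)
  then have jk: "j < k" by simp
  note q = \<open>psdf q\<close>
  note sg = \<open>star g = g\<close>
  define u f where "u = prj j (Suc j)" and "f = prj (Suc j) k"
  have uf: "u + f = prj j k" unfolding u_def f_def using jk by (simp add: prj_split[symmetric])
  have uu: "u * u = u" "f * f = f" "u * f = 0" "f * u = 0" "star u = u" "star f = f"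
    by (simp_all add: u_def f_def prj_inter prj_empty)
  note uu' = uu(1-4)[THEN mult_assocD]
  define \<gamma> l where "\<gamma> = Re (ent g j j)" and "l = ent b j j"
  have gjj: "ent g j j = of_real \<gamma>"
    using arg_cong[OF sg, of "\<lambda>x. ent x j j"] unfolding \<gamma>_def
    by (metis complex_In_mult_cnj_zero Reals_cnj_iff ent_star of_real_Re)
  have ugu: "u * (g * u) = scal (of_real \<gamma>) u" unfolding u_def unit_sandwich gjj ..
  have g1: "g = (u + f) * g" "g = g * (u + f)" unfolding uf using Suc.prems(2)
    by (simp, metis sg star_times star_prj)
  have bu: "b * u = scal l u"
  proof (rule fmat_eqI)
    fix r s
    have "ent b r j = 0" if "r < j"
    proof -
      have "ent (prj j k * b) r j = 0" using that by (simp add: ent_prj_times)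
      then show ?thesis using Suc.prems(3) by simp
    qed
    then show "ent (b * u) r s = ent (scal l u) r s"
      using Suc.prems(5)[of j r]
      by (cases "r = j"; cases "s = j") (auto simp: u_def ent_times_prj ent_prj l_def not_less nat_neq_iff)
  qed
  have ub: "u * star b = scal (cnj l) u" using arg_cong[OF bu, of star] uu by simp
  have Rl: "Re l < 0" using Suc.prems(6)[of j] jk by (simp add: l_def)
  have eq: "star b * g + g * b = - q" by fact
  \<comment> \<open>Sandwiching with \<open>u\<close> reads off the \<open>(j,j)\<close> entry of
    the Lyapunov equation, namely \<open>q_jj = - 2 Re l * \<gamma>\<close>. As
    \<open>Re l < 0\<close>, it follows that \<open>0 \<le> \<gamma>\<close>, and that
    \<open>q_jj = 0\<close> when \<open>\<gamma> = 0\<close>.\<close>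
  have "u * (star b * g + g * b) * u = scal (cnj l * of_real \<gamma> + of_real \<gamma> * l) u"
  proof -
    have "u * (star b * g + g * b) * u = (u * star b) * (g * u) + u * (g * (b * u))"
      by (simp add: distrib_left distrib_right mult.assoc)
    then show ?thesis unfolding ub bu by (simp add: ugu scal_add_left mult.commute)
  qed
  then have uqu: "u * (q * u) = scal (- (cnj l * of_real \<gamma> + of_real \<gamma> * l)) u"
    unfolding eq scal_uminus_left by (metis minus_minus mult.assoc mult_minus_left mult_minus_right)
  then have tq: "Re (tr (star u * (q * u))) = - 2 * Re l * \<gamma>" using uu by (simp add: u_def)
  have "0 \<le> - 2 * Re l * \<gamma>" using psdf_nonneg[OF q, of u] unfolding tq .
  then have g0: "0 \<le> \<gamma>" using Rl by (simp add: mult_le_0_iff zero_le_mult_iff)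
  have fb: "f * b * u = 0" unfolding mult.assoc bu by (simp add: uu)
  define b' where "b' = f * (b * f)"
  have b': "prj (Suc j) k * b' = b'" "b' * prj (Suc j) k = b'"
    by (simp_all add: b'_def f_def mult.assoc)
  have b'e: "\<And>r s. s < r \<Longrightarrow> ent b' r s = 0" "\<And>i. Suc j \<le> i \<Longrightarrow> i < k \<Longrightarrow> Re (ent b' i i) < 0"
    using Suc.prems(5,6) by (auto simp: b'_def f_def ent_prj_times ent_times_prj)
  have bf: "f * b = b' "
  proof -
    have "f * b = f * (b * (u + f))" unfolding uf using Suc.prems by simp
    then show ?thesis by (simp add: distrib_left b'_def bu uu)
  qed
  have bf': "star b * f = star b'" using arg_cong[OF bf, of star] uu by simp
  show ?case
  proof (cases "\<gamma> = 0")
    case True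
    then have qu: "q * u = 0" using psdf_kernel[OF q, of u] tq by simp
    define x where "x = g * u"
    have "star b * x = (star b * g) * u" by (simp add: x_def mult.assoc)
    also have "star b * g = - q - g * b" using eq by (simp add: eq_diff_eq)
    finally have bx: "star b * x = scal (- l) x"
      by (simp add: left_diff_distrib qu mult.assoc bu x_def scal_uminus_left)
    \<comment> \<open>\<open>b\<close> vanishes on the first \<open>j\<close> indices, which would
      contribute the eigenvalue 0 on the corner \<open>k\<close>. Subtracting \<open>prj 0 j\<close>
      replaces it by -1 and does not change the action of the adjoint on \<open>x\<close>.\<close>
    define b0 where "b0 = b - prj 0 j"
    have "corner k b0" unfolding b0_def corner_def using Suc.prems(3,4) jk
      by (simp add: right_diff_distrib left_diff_distrib prj_inter)
        (metis prj_inter mult.assoc max_0L min.idem max_0R)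
    moreover have "ent b r r = 0" if "r < j" for r
    proof -
      have "ent (prj j k * b) r r = 0" using that by (simp add: ent_prj_times)
      then show ?thesis using Suc.prems(3) by simp
    qed
    ultimately have b0: "utri k b0" "\<And>i. i < k \<Longrightarrow> Re (ent b0 i i) < 0"
      using Suc.prems(5,6) by (auto simp: utri_def b0_def ent_prj not_less)
    have hb: "hurwitz k (star b0)"
      by (rule hurwitz_star[OF _ utri_hurwitz[OF b0]]) (use b0 in \<open>auto simp: utri_def\<close>)
    have px: "prj j k * x = x" using Suc.prems(2) by (simp add: x_def mult.assoc[symmetric])
    have "prj 0 j * (prj j k * x) = 0"
      by (simp add: prj_inter[THEN mult_assocD] prj_empty)
    then have "star b0 * x = scal (- l) x" using bx px by (simp add: b0_def left_diff_distrib)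
    moreover have "prj 0 k * (prj j k * x) = prj j k * x"
      by (simp add: prj_inter[THEN mult_assocD])
    ultimately have "x = 0" using hurwitzD[OF hb, of x "- l"] Rl px by simp
    then have gu: "g * u = 0" by (simp add: x_def)
    have gu': "u * g = 0" using arg_cong[OF gu, of star] uu sg by simp
    have g2: "g = f * g" "g = g * f" using g1 gu gu' by (simp_all add: distrib_left distrib_right)
    have "star b' * g + g * b' = f * (star b * g + g * b) * f"
    proof -
      have 1: "f * (star b * g) * f = star b' * g"
      proof -
        have "f * (star b * g) * f = f * (star b * (f * (g * f)))" using g2 by (simp add: mult.assoc)
        also have "\<dots> = star b' * g" using g2 by (simp add: bf'[symmetric] b'_def uu mult.assoc)
        finally show ?thesis .
      qed
      have "f * (g * b) * f = f * (g * (f * (b * f)))" using g2 by (metis mult.assoc)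
      also have "\<dots> = g * b'" using g2 by (metis mult.assoc b'_def)
      finally show ?thesis using 1 by (simp add: distrib_left distrib_right)
    qed
    then have e': "star b' * g + g * b' = - (star f * q * f)" using eq uu by simp
    show ?thesis
      by (rule Suc.hyps(1)[of "Suc j" g b' "star f * q * f", OF _ sg _ b' b'e psdf_conj[OF q] e'])
        (use \<open>Suc d = k - j\<close> g2 in \<open>auto simp: f_def\<close>)
  next
    case False
    then have gp: "\<gamma> > 0" using g0 by simp
    define i where "i = complex_of_real (1 / \<gamma>)"
    have i: "i * of_real \<gamma> = 1" "of_real \<gamma> * i = 1" "cnj i = i" using gp by (simp_all add: i_def)
    \<comment> \<open>Block elimination with pivot \<open>\<gamma>\<close>:
      \<open>g * \<tau>\<close> has no \<open>u\<close> row, so \<open>g'\<close> is the Schur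
      complement of the pivot.\<close>
    define \<tau> where "\<tau> = f - scal i (u * (g * f))"
    define g' where "g' = g * \<tau>"
    have ug': "u * g' = 0"
      using ugu[THEN mult_assocD] by (simp add: g'_def \<tau>_def right_diff_distrib mult.assoc i)
    have g'e: "g' = f * g'"
    proof -
      have "g' = (u + f) * g'" using g1 by (metis g'_def mult.assoc)
      then show ?thesis using ug' by (simp add: distrib_right)
    qed
    have g'f: "g' * f = g'" by (simp add: g'_def \<tau>_def left_diff_distrib right_diff_distrib mult.assoc uu)
    have g'x: "g' = f * (g * f) - scal i (f * (g * (u * (g * f))))"
      using g'e by (simp add: g'_def \<tau>_def right_diff_distrib mult.assoc)
    have sg': "star g' = g'" unfolding g'x using sg uu i by (simp add: mult.assoc)
    have f\<tau>: "g' * \<tau> = g'" 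
    proof -
      have "g' * u = 0" using arg_cong[OF ug', of star] sg' uu by simp
      then show ?thesis by (simp add: \<tau>_def right_diff_distrib g'f mult_assocD)
    qed
    \<comment> \<open>Triangularity, in the form \<open>f * b = b'\<close>, lets \<open>b\<close>
      pass through the elimination once \<open>g'\<close> stands in front. This is why the Lyapunov
      equation descends to the Schur complement.\<close>
    have b\<tau>: "g' * (b * \<tau>) = g' * b'"
    proof -
      have "g' * (b * \<tau>) = g' * (f * (b * \<tau>))" using g'f by (simp add: mult.assoc[symmetric])
      also have "f * (b * \<tau>) = b' * \<tau>" using bf by (simp add: mult.assoc[symmetric])
      also have "b' * \<tau> = b'"
        by (simp add: \<tau>_def right_diff_distrib b'_def mult.assoc uu uu')
      finally show ?thesis .
    qed
    have "star \<tau> * (star b * g + g * b) * \<tau> = star (b * \<tau>) * (g * \<tau>) + star (g * \<tau>) * (b * \<tau>)"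
      using sg by (simp add: distrib_left distrib_right mult.assoc)
    also have "\<dots> = star (g' * (b * \<tau>)) + g' * (b * \<tau>)" using sg' by (simp add: g'_def[symmetric])
    also have "\<dots> = star b' * g' + g' * b'" unfolding b\<tau> using sg' by simp
    finally have e': "star b' * g' + g' * b' = - (star \<tau> * q * \<tau>)" using eq by simp
    have pg': "psdf g'"
      by (rule Suc.hyps(1)[of "Suc j" g' b' "star \<tau> * q * \<tau>", OF _ sg' _ b' b'e psdf_conj[OF q] e'])
        (use \<open>Suc d = k - j\<close> g'e in \<open>auto simp: f_def\<close>)
    \<comment> \<open>\<open>T\<close> undoes the elimination: \<open>g\<close> is congruent to the
      sum of \<open>scal \<gamma> u\<close> and \<open>g'\<close>.\<close>
    define T where "T = u + f + scal i (u * (g * f))"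
    have "psdf (scal (of_real \<gamma>) (star u * u))" by (rule psdf_scal[OF g0 psdf_square])
    then have "psdf (star T * (scal (of_real \<gamma>) u + g') * T)"
      using pg' uu by (intro psdf_conj psdf_add) auto
    also have "star T * (scal (of_real \<gamma>) u + g') * T = g"
    proof -
      have uT: "u * T = u + scal i (u * (g * f))" by (simp add: T_def distrib_left uu uu')
      have g'T: "g' * T = g'"
      proof -
        have "g' * u = 0" using arg_cong[OF ug', of star] sg' uu by simp
        then show ?thesis by (simp add: T_def distrib_left g'f mult_assocD)
      qed
      have "star T * (scal (of_real \<gamma>) u + g') * T = scal (of_real \<gamma>) (star (u * T) * (u * T)) + star (g' * T) * T"
        using sg' uu by (simp add: distrib_left distrib_right mult.assoc uu')
      also have "star (g' * T) * T = g'" using g'T sg' by simp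
      also have "scal (of_real \<gamma>) (star (u * T) * (u * T)) = 
          scal (of_real \<gamma>) u + u * (g * f) + f * (g * u) + scal i (f * (g * (u * (g * f))))"
        unfolding uT using sg uu i
        by (simp add: distrib_left distrib_right mult.assoc uu uu' scal_add)
          (simp add: mult.assoc[symmetric] add_ac)
      also have "\<dots> + g' = scal (of_real \<gamma>) u + u * (g * f) + f * (g * u) + f * (g * f)"
        unfolding g'x by simp
      also have "\<dots> = (u + f) * (g * (u + f))" by (simp add: distrib_left distrib_right ugu)
      also have "\<dots> = g" using g1 by simp
      finally show ?thesis .
    qed
    finally show ?thesis .
  qed
qed

section \<open>Algebraic Riccati equations\<close>

text \<open>Roots are compared with multiplicity, on which the count of stable eigenvalues below
  depends.\<close>

lemma linear_factors_mset:
  fixes as bs :: "complex list"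
  assumes "(\<Prod>e \<leftarrow> as. [:- e, 1:]) = (\<Prod>e \<leftarrow> bs. [:- e, 1:])"
  shows "mset as = mset bs"
  using assms
proof (induction as arbitrary: bs)
  case Nil
  then have "degree (\<Prod>e \<leftarrow> bs. [:- e, 1:]) = 0" by simp
  then show ?case by (simp add: degree_linear_factors[of uminus])
next
  case (Cons a as)
  have "poly (\<Prod>e \<leftarrow> bs. [:- e, 1:]) a = 0" unfolding Cons.prems[symmetric] by simp
  then have a: "a \<in> set bs" by (auto simp: poly_prod_list prod_list_zero_iff)
  have "(\<Prod>e \<leftarrow> bs. [:- e, 1:]) = [:- a, 1:] * (\<Prod>e \<leftarrow> remove1 a bs. [:- e, 1:])"
    by (rule prod_list_map_remove1[OF a])
  then have "[:- a, 1:] * (\<Prod>e \<leftarrow> as. [:- e, 1:]) = [:- a, 1:] * (\<Prod>e \<leftarrow> remove1 a bs. [:- e, 1:])"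
    using Cons.prems by (simp only: list.map prod_list.Cons)
  then have "(\<Prod>e \<leftarrow> as. [:- e, 1:]) = (\<Prod>e \<leftarrow> remove1 a bs. [:- e, 1:])"
    unfolding mult_cancel_left by simp
  from Cons.IH[OF this] a show ?case by simp
qed

text \<open>A Schur form \<open>b\<close> of \<open>h\<close> makes \<open>- star h\<close> similar
  to \<open>- star b\<close>, whose transpose is upper triangular with diagonal entries
  \<open>- cnj e\<close>.\<close>

lemma char_poly_star_uminus:
  assumes h: "corner m h" and es: "char_poly (mt m m h) = (\<Prod>e \<leftarrow> es. [:- e, 1:])"
  shows "char_poly (mt m m (- star h)) = (\<Prod>e \<leftarrow> map (\<lambda>e. - cnj e) es. [:- e, 1:])"
proof -
  obtain p p' b where p: "prj 0 m * p = p" "p * prj 0 m = p" "prj 0 m * p' = p'" "p' * prj 0 m = p'"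
    "prj 0 m * b = b" "b * prj 0 m = b" "p * p' = prj 0 m" "p' * p = prj 0 m" "h * p = p * b"
    "\<And>i j. j < i \<Longrightarrow> ent b i j = 0" "\<And>i. i < m \<Longrightarrow> ent b i i = es ! i" "length es = m"
    by (rule schur_fmat[OF _ _ es]) (use h in \<open>auto simp: corner_def\<close>)
  have b: "corner m b" using p by (simp add: corner_def)
  have q: "prj 0 m * star p' = star p'" "star p' * prj 0 m = star p'"
    "prj 0 m * star p = star p" "star p * prj 0 m = star p"
    using p by (metis star_prj star_times)+
  have "star p * star p' = prj 0 m" "star p' * star p = prj 0 m"
    using p by (metis star_prj star_times)+
  note q = q this
  have "p' * h = p' * (h * (p * p'))" using p h by (simp add: corner_simps)
  also have "\<dots> = p' * (h * p) * p'" by (simp only: mult.assoc)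
  also have "\<dots> = (p' * p) * b * p'" unfolding p(9) by (simp only: mult.assoc)
  also have "\<dots> = b * p'" using p by simp
  finally have "star h * star p' = star p' * star b" by (metis star_times)
  then have *: "(- star h) * star p' = star p' * (- star b)" by simp
  have "char_poly (mt m m (- star h)) = char_poly (mt m m (- star b))"
    by (rule char_poly_upper_diag[OF q(1-4) _ _ q(6,5) *])
      (use b h in \<open>simp_all add: corner_simps corner_star corner_uminus\<close>)
  also have "\<dots> = char_poly (transpose_mat (mt m m (- star b)))"
    by (rule char_poly_transpose_mat[OF mt_carrier, symmetric])
  also have "\<dots> = (\<Prod>e \<leftarrow> diag_mat (transpose_mat (mt m m (- star b))). [:- e, 1:])"
    by (rule char_poly_upper_triangular[of _ m]) (use p in \<open>auto simp: mt_def\<close>)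
  also have "diag_mat (transpose_mat (mt m m (- star b))) = map (\<lambda>e. - cnj e) es"
    by (rule nth_equalityI) (use p in \<open>auto simp: diag_mat_def mt_def\<close>)
  finally show ?thesis .
qed

text \<open>The partial isometry from the first \<open>k\<close> to the next \<open>k\<close>
  indices. With it, a matrix of four \<open>k\<close> by \<open>k\<close> blocks is written through
  matrices that all live in the corner \<open>k\<close>.\<close>

lift_definition shift_mat :: "nat \<Rightarrow> fmat" is "\<lambda>k i j. if j < k \<and> i = j + k then 1 else 0"
  subgoal for k by (intro exI[of _ "2 * k"]) auto done

lemma ent_shift_mat: "ent (shift_mat k) i j = (if j < k \<and> i = j + k then 1 else 0)"
  by (simp add: shift_mat.rep_eq)

lemma shift_mat_star_shift_mat: "star (shift_mat k) * shift_mat k = prj 0 k"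
  and shift_mat_shift_mat_star: "shift_mat k * star (shift_mat k) = prj k (2 * k)"
  and prj_shift_mat: "prj 0 k * shift_mat k = 0"
  and shift_mat_prj: "shift_mat k * prj 0 k = shift_mat k"
proof -
  have b: "bnd (2 * k) (shift_mat k)" "bnd (2 * k) (star (shift_mat k))" by (auto simp: bnd_def ent_shift_mat)
  show "star (shift_mat k) * shift_mat k = prj 0 k"
  proof (rule fmat_eqI)
    fix i j
    have "ent (star (shift_mat k) * shift_mat k) i j
      = (\<Sum>l<2*k. if l = i + k then (if i < k \<and> j = i then 1 else 0) else 0)"
      by (subst ent_times[OF b(2)], rule sum.cong) (auto simp: ent_shift_mat)
    then show "ent (star (shift_mat k) * shift_mat k) i j = ent (prj 0 k) i j" by (auto simp: ent_prj)
  qed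
  show "shift_mat k * star (shift_mat k) = prj k (2 * k)"
  proof (rule fmat_eqI)
    fix i j
    have "ent (shift_mat k * star (shift_mat k)) i j
      = (\<Sum>l<2*k. if l = i - k then (if k \<le> i \<and> i < 2 * k \<and> j = i then 1 else 0) else 0)"
      by (subst ent_times[OF b(1)], rule sum.cong) (auto simp: ent_shift_mat)
    then show "ent (shift_mat k * star (shift_mat k)) i j = ent (prj k (2 * k)) i j" by (auto simp: ent_prj)
  qed
qed (auto intro!: fmat_eqI simp: ent_prj_times ent_times_prj ent_shift_mat)

text \<open>Standing data of a classical Riccati equation. The last two assumptions are Hautus
  tests; \<open>s\<close> and \<open>w\<close> stand for \<open>B B^T\<close> and
  \<open>C^T C\<close>, which have the same kernels as \<open>B^T\<close> and
  \<open>C\<close>.\<close>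

locale riccati_data =
  fixes k :: nat and a s w :: fmat
  assumes corner_asw: "corner k a" "corner k s" "corner k w"
    and psd: "psdf s" "psdf w"
    and stabilizable: "\<And>lam y. 0 \<le> Re lam \<Longrightarrow> prj 0 k * y = y \<Longrightarrow> star a * y = scal lam y \<Longrightarrow> s * y = 0 \<Longrightarrow> y = 0"
    and detectable: "\<And>lam y. 0 \<le> Re lam \<Longrightarrow> prj 0 k * y = y \<Longrightarrow> a * y = scal lam y \<Longrightarrow> w * y = 0 \<Longrightarrow> y = 0"
begin

abbreviation (input) "\<sigma> \<equiv> shift_mat k"

text \<open>The Hamiltonian matrix with rows \<open>(a, -s)\<close> and
  \<open>(-w, - star a)\<close>; \<open>\<sigma>\<close> carries the upper half to the lower
  half.\<close>

definition ham :: fmat where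
  "ham = a - s * star \<sigma> - \<sigma> * w - \<sigma> * star a * star \<sigma>"

lemma sw: "star s = s" "star w = w"
  using psd psdf_star by auto

lemma sigma_rules:
  "star \<sigma> * \<sigma> = prj 0 k" "prj 0 k * \<sigma> = 0" "star \<sigma> * prj 0 k = 0" "\<sigma> * prj 0 k = \<sigma>" "prj 0 k * star \<sigma> = star \<sigma>"
  "\<sigma> * \<sigma> = 0" "star \<sigma> * star \<sigma> = 0"
proof -
  show 1: "star \<sigma> * \<sigma> = prj 0 k" "prj 0 k * \<sigma> = 0" "\<sigma> * prj 0 k = \<sigma>"
    by (rule shift_mat_star_shift_mat prj_shift_mat shift_mat_prj)+
  show 2: "star \<sigma> * prj 0 k = 0" using arg_cong[OF 1(2), of star] by simp
  show 3: "prj 0 k * star \<sigma> = star \<sigma>" using arg_cong[OF 1(3), of star] by simp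
  show "\<sigma> * \<sigma> = 0" by (metis 1(2,3) mult.assoc mult_zero_right)
  then show "star \<sigma> * star \<sigma> = 0" by (metis star_times star_zero)
qed

lemma corner_sigma: "corner k x \<Longrightarrow> x * \<sigma> = 0" "corner k x \<Longrightarrow> star \<sigma> * x = 0"
  by (metis corner_right mult.assoc mult_zero_right sigma_rules(2))
    (metis corner_left mult.assoc mult_zero_left sigma_rules(3))

lemma unit_2k: "prj 0 (2 * k) = prj 0 k + \<sigma> * star \<sigma>"
  by (subst shift_mat_shift_mat_star) (rule prj_split, auto)

lemma corner_star_a: "corner k (star a)"
  by (rule corner_star[OF corner_asw(1)])

lemma corner_ham: "corner (2 * k) ham"
proof -
  have "prj 0 (2 * k) * \<sigma> = \<sigma>" by (simp add: unit_2k distrib_right sigma_rules mult.assoc)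
  then have s1: "prj 0 (2 * k) * \<sigma> = \<sigma>" "star \<sigma> * prj 0 (2 * k) = star \<sigma>"
    by (simp, metis star_times star_prj)
  have "corner (2 * k) x" if "corner k x" for x using that corner_mono by force
  then have "corner (2 * k) a" "corner (2 * k) s" "corner (2 * k) w" "corner (2 * k) (star a)"
    using corner_asw corner_star_a by blast+
  then show ?thesis
    by (simp add: corner_def ham_def left_diff_distrib right_diff_distrib mult.assoc s1 s1[THEN mult_assocD]
        mult_assocD[of "prj 0 (2 * k)"])
qed

lemma ham_top: "prj 0 k * (ham * z) = a * (prj 0 k * z) - s * (star \<sigma> * z)"
  using corner_asw by (simp add: ham_def left_diff_distrib right_diff_distrib mult.assoc corner_simps
      sigma_rules[THEN mult_assocD])

lemma ham_bot: "star \<sigma> * (ham * z) = - (w * (prj 0 k * z)) - star a * (star \<sigma> * z)"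
  using corner_asw corner_star_a by (simp add: ham_def left_diff_distrib right_diff_distrib mult.assoc corner_simps
      sigma_rules[THEN mult_assocD] corner_sigma(2)[THEN mult_assocD])

text \<open>Pair the upper row with \<open>y\<close> and the lower row with \<open>x\<close>. For
  imaginary \<open>lam\<close> the real parts of the cross terms cancel, leaving that the energies
  of \<open>y\<close> under \<open>s\<close> and of \<open>x\<close> under \<open>w\<close> add up
  to 0. Both vanish, and the Hautus tests apply to \<open>x\<close> and \<open>y\<close>
  separately.\<close>

lemma ham_no_imaginary:
  assumes z: "prj 0 (2 * k) * z = z" "ham * z = scal lam z" and lam: "Re lam = 0"
  shows "z = 0"
proof -
  define x y where "x = prj 0 k * z" and "y = star \<sigma> * z"
  have zxy: "z = x + \<sigma> * y"
    using z(1) by (simp add: unit_2k distrib_right x_def y_def mult.assoc)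
  have 1: "a * x - s * y = scal lam x" using ham_top[of z] z(2) by (simp add: x_def y_def)
  have 2: "- (w * x) - star a * y = scal lam y" using ham_bot[of z] z(2) by (simp add: x_def y_def)
  have e1: "tr (star y * (a * x)) - tr (star y * (s * y)) = lam * tr (star y * x)"
    using arg_cong[OF 1, of "\<lambda>v. tr (star y * v)"] by (simp add: right_diff_distrib)
  have e2: "- tr (star x * (w * x)) - tr (star x * (star a * y)) = lam * tr (star x * y)"
    using arg_cong[OF 2, of "\<lambda>v. tr (star x * v)"] by (simp add: right_diff_distrib)
  have c1: "tr (star x * (star a * y)) = cnj (tr (star y * (a * x)))" by (simp flip: tr_star add: mult.assoc)
  have c2: "tr (star x * y) = cnj (tr (star y * x))" by (simp flip: tr_star)
  have "Re (tr (star y * (s * y))) + Re (tr (star x * (w * x))) = 0"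
    using arg_cong[OF e1, of Re] arg_cong[OF e2, of Re] lam unfolding c1 c2 by simp
  with psdf_nonneg[OF psd(1), of y] psdf_nonneg[OF psd(2), of x]
  have "Re (tr (star y * (s * y))) = 0" "Re (tr (star x * (w * x))) = 0" by linarith+
  then have sy: "s * y = 0" and wx: "w * x = 0" using psdf_kernel psd by auto
  have "x = 0" by (rule detectable[of lam]) (use 1 sy wx lam in \<open>auto simp: x_def\<close>)
  moreover have "y = 0"
    by (rule stabilizable[of "- lam"])
      (use 2 sy wx lam in \<open>auto simp: y_def sigma_rules[THEN mult_assocD] scal_uminus_left minus_equation_iff[of "star a * _"]\<close>)
  ultimately show ?thesis using zxy by simp
qed

text \<open>The spectrum is symmetric about the imaginary axis, with multiplicities, because
  \<open>ham\<close> is similar to \<open>- star ham\<close>. As no eigenvalue lies on the axis,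
  exactly half of the \<open>2 * k\<close> are stable.\<close>

lemma ham_spectrum:
  obtains es where "char_poly (mt (2 * k) (2 * k) ham) = (\<Prod>e \<leftarrow> es. [:- e, 1:])" "length es = 2 * k"
    "\<And>i. i < k \<Longrightarrow> Re (es ! i) < 0"
proof -
  obtain es where es: "char_poly (mt (2 * k) (2 * k) ham) = (\<Prod>e \<leftarrow> es. [:- e, 1:])" and len: "length es = 2 * k"
    using char_poly_factorized[OF mt_carrier] by blast
  have ni: "Re e \<noteq> 0" if e: "e \<in> set es" for e
    using root_eigenvector[OF corner_ham es e] ham_no_imaginary[of _ e] by metis
  \<comment> \<open>The symplectic unit with rows \<open>(0, I)\<close> and
    \<open>(-I, 0)\<close>.\<close>
  define p where "p = star \<sigma> - \<sigma>"
  have pp: "star p * p = prj 0 (2 * k)" "p * star p = prj 0 (2 * k)"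
    by (simp_all add: p_def left_diff_distrib right_diff_distrib sigma_rules unit_2k)
  have p2: "prj 0 (2 * k) * p = p"
    by (simp add: p_def unit_2k right_diff_distrib distrib_right sigma_rules mult.assoc)
  have p2': "p * prj 0 (2 * k) = p"
    by (simp add: p_def unit_2k left_diff_distrib distrib_left sigma_rules sigma_rules[THEN mult_assocD] mult.assoc[symmetric])
  have p3: "prj 0 (2 * k) * star p = star p" "star p * prj 0 (2 * k) = star p"
    using arg_cong[OF p2, of star] arg_cong[OF p2', of star] by simp_all
  have hp: "ham * p = p * (- star ham)"
    using corner_asw corner_star_a
    by (simp add: p_def ham_def left_diff_distrib right_diff_distrib mult.assoc sw corner_simps
        sigma_rules sigma_rules[THEN mult_assocD] corner_sigma corner_sigma[THEN mult_assocD])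
  have "char_poly (mt (2 * k) (2 * k) ham) = char_poly (mt (2 * k) (2 * k) (- star ham))"
    by (rule char_poly_upper_diag[OF p2 p2' p3 _ _ pp(2,1) hp])
      (use corner_ham in \<open>simp_all add: corner_simps corner_star corner_uminus\<close>)
  then have "(\<Prod>e \<leftarrow> es. [:- e, 1:]) = (\<Prod>e \<leftarrow> map (\<lambda>e. - cnj e) es. [:- e, 1:])"
    using es char_poly_star_uminus[OF corner_ham es] by simp
  then have ms: "mset es = mset (map (\<lambda>e. - cnj e) es)" by (rule linear_factors_mset)
  define neg where "neg e \<longleftrightarrow> Re e < 0" for e
  have "size (filter_mset neg (mset es)) = size (filter_mset neg (mset (map (\<lambda>e. - cnj e) es)))"
    using ms by simp
  also have "\<dots> = length (filter (\<lambda>e. neg (- cnj e)) es)"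
    by (simp flip: mset_filter mset_map add: filter_map o_def)
  also have "filter (\<lambda>e. neg (- cnj e)) es = filter (\<lambda>e. \<not> neg e) es"
    by (rule filter_cong) (use ni in \<open>auto simp: neg_def not_less order.order_iff_strict\<close>)
  finally have "length (filter neg es) = length (filter (\<lambda>e. \<not> neg e) es)" by (simp flip: mset_filter)
  then have lk: "length (filter neg es) = k" using sum_length_filter_compl[of neg es] len by simp
  \<comment> \<open>The stable eigenvalues are moved to the front, so that they head the diagonal of
    the Schur form.\<close>
  define es' where "es' = filter neg es @ filter (\<lambda>e. \<not> neg e) es"
  have "mset es' = mset es" by (simp add: es'_def)
  then have "(\<Prod>e \<leftarrow> es. [:- e, 1:]) = (\<Prod>e \<leftarrow> es'. [:- e, 1:])"
    by (metis mset_map prod_mset_prod_list)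
  moreover have "length es' = 2 * k" using \<open>mset es' = mset es\<close> len by (metis size_mset)
  moreover have "Re (es' ! i) < 0" if "i < k" for i
  proof -
    have "es' ! i \<in> set (filter neg es)"
      using that lk nth_mem[of i "filter neg es"] by (simp add: es'_def nth_append)
    then show ?thesis by (simp add: neg_def)
  qed
  ultimately show thesis using that[of es'] es by simp
qed

text \<open>The first \<open>k\<close> Schur vectors span the stable invariant subspace of
  \<open>ham\<close>; \<open>x\<close> and \<open>y\<close> are its upper and lower halves, and
  \<open>\<Lambda>\<close> is the restriction of \<open>ham\<close> in this basis.\<close>

lemma stable_subspace:
  obtains x y \<Lambda> where "corner k x" "corner k y" "utri k \<Lambda>" "\<And>i. i < k \<Longrightarrow> Re (ent \<Lambda> i i) < 0"
    "a * x - s * y = x * \<Lambda>" "- (w * x) - star a * y = y * \<Lambda>"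
    "\<And>v. prj 0 k * v = v \<Longrightarrow> x * v = 0 \<Longrightarrow> y * v = 0 \<Longrightarrow> v = 0"
proof -
  let ?m = "2 * k"
  obtain es where es: "char_poly (mt ?m ?m ham) = (\<Prod>e \<leftarrow> es. [:- e, 1:])"
    "\<And>i. i < k \<Longrightarrow> Re (es ! i) < 0" using ham_spectrum by blast
  obtain p p' b where p: "prj 0 ?m * p = p" "p * prj 0 ?m = p" "p' * p = prj 0 ?m" "ham * p = p * b"
    "prj 0 ?m * b = b" "b * prj 0 ?m = b" "\<And>i j. j < i \<Longrightarrow> ent b i j = 0"
    "\<And>i. i < ?m \<Longrightarrow> ent b i i = es ! i"
    by (rule schur_fmat[OF _ _ es(1)]) (use corner_ham in \<open>auto simp: corner_def\<close>)
  have b: "utri ?m b" using p by (simp add: utri_def corner_def)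
  define u x y \<Lambda> where "u = p * prj 0 k" and "x = prj 0 k * u" and "y = star \<sigma> * u" and "\<Lambda> = b * prj 0 k"
  have \<Lambda>: "prj 0 k * \<Lambda> = \<Lambda>" unfolding \<Lambda>_def by (rule utri_prj[OF b, symmetric])
  have hu: "ham * u = u * \<Lambda>"
    using p(4)[THEN mult_assocD] \<Lambda> by (simp add: u_def \<Lambda>_def mult.assoc p(4)[THEN mult_assocD])
  show thesis
  proof (rule that[of x y \<Lambda>])
    show "corner k x" "corner k y" using sigma_rules(5)[THEN mult_assocD]
      by (simp_all add: corner_def x_def y_def u_def mult.assoc)
    show "utri k \<Lambda>" using \<Lambda> p(7) by (auto simp: utri_def corner_def mult.assoc \<Lambda>_def ent_times_prj)
    show "Re (ent \<Lambda> i i) < 0" if "i < k" for i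
      using that es(2)[OF that] p(8)[of i] by (simp add: \<Lambda>_def ent_times_prj)
    show "a * x - s * y = x * \<Lambda>"
      using ham_top[of u] by (simp add: x_def y_def hu mult.assoc)
    show "- (w * x) - star a * y = y * \<Lambda>"
      using ham_bot[of u] by (simp add: x_def y_def hu mult.assoc)
    fix v assume v: "prj 0 k * v = v" "x * v = 0" "y * v = 0"
    have "u * v = prj 0 ?m * (u * v)" using p(1)[THEN mult_assocD] by (simp add: u_def mult.assoc)
    also have "\<dots> = x * v + \<sigma> * (y * v)" by (simp add: unit_2k distrib_right x_def y_def mult.assoc)
    finally have "u * v = 0" using v by simp
    then have "p' * (p * v) = 0" using v by (simp add: u_def mult.assoc)
    then have "prj 0 ?m * v = 0" using p(3) by (simp add: mult.assoc[symmetric])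
    then show "v = 0" using prj_vec_mono[OF v(1), of ?m] by simp
  qed
qed

end

text \<open>Pairing the equation with \<open>v\<close> shows that twice the quantity assumed
  nonnegative equals minus the \<open>S\<close>-energy of \<open>P * v\<close> minus the
  \<open>W\<close>-energy of \<open>v\<close>, so both energies vanish. \<open>P\<close> is not
  assumed symmetric, so that the lemma also serves the descriptor equation.\<close>

lemma psd_solution_kernel:
  assumes sol: "star A * P + star P * A - star P * S * P + W = 0"
    and psd: "psdf S" "psdf W"
    and v: "0 \<le> Re (tr (star v * (star P * ((A - S * P) * v))))"
  shows "S * (P * v) = 0" "W * v = 0"
proof -
  let ?c = "tr (star v * (star P * ((A - S * P) * v)))"
  have sS: "star S = S" using psd psdf_star by blast
  have "tr (star v * ((star A * P + star P * A - star P * S * P + W) * v)) = 0" using sol by simp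
  then have e: "tr (star v * (star A * (P * v))) + tr (star v * (star P * (A * v)))
      - tr (star v * (star P * (S * (P * v)))) + tr (star v * (W * v)) = 0"
    by (simp add: distrib_left distrib_right left_diff_distrib right_diff_distrib mult.assoc)
  have "tr (star v * (star A * (P * v))) = cnj (tr (star v * (star P * (A * v))))"
    by (simp flip: tr_star add: mult.assoc)
  then have "2 * Re (tr (star v * (star P * (A * v)))) = Re (tr (star v * (star P * (S * (P * v)))))
      - Re (tr (star v * (W * v)))"
    using arg_cong[OF e, of Re] by simp
  moreover have "Re ?c = Re (tr (star v * (star P * (A * v)))) - Re (tr (star v * (star P * (S * (P * v)))))"
    by (simp add: left_diff_distrib right_diff_distrib mult.assoc)
  moreover have "0 \<le> Re (tr (star v * (star P * (S * (P * v)))))"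
    using psdf_nonneg[OF psd(1), of "P * v"] by (simp add: mult.assoc)
  ultimately have "Re (tr (star (P * v) * (S * (P * v)))) = 0" "Re (tr (star v * (W * v))) = 0"
    using v psdf_nonneg[OF psd(2), of v] by (simp_all add: mult.assoc)
  then show "S * (P * v) = 0" "W * v = 0" using psdf_kernel psd by blast+
qed

context riccati_data
begin

text \<open>Lyapunov argument: an unstable closed-loop mode satisfies the sign condition of
  \<open>psd_solution_kernel\<close>, hence is a mode of \<open>a\<close> invisible to
  \<open>w\<close>.\<close>

lemma psd_solution_hurwitz:
  assumes x: "psdf x" "star a * x + x * a - x * s * x + w = 0"
  shows "hurwitz k (a - s * x)"
  unfolding hurwitz_def
proof (intro allI impI)
  fix lam v assume v: "prj 0 k * v = v" "(a - s * x) * v = scal lam v" "v \<noteq> 0"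
  have sx: "star x = x" using x psdf_star by blast
  show "Re lam < 0"
  proof (rule ccontr)
    assume "\<not> Re lam < 0"
    then have lam: "0 \<le> Re lam" by simp
    have "Im (tr (star v * (x * v))) = 0"
    proof -
      have "cnj (tr (star v * (x * v))) = tr (star v * (x * v))"
        by (simp flip: tr_star add: mult.assoc sx)
      then show ?thesis by (metis Reals_cnj_iff complex_is_Real_iff)
    qed
    then have "0 \<le> Re (tr (star v * (star x * ((a - s * x) * v))))"
      using lam psdf_nonneg[OF x(1), of v] unfolding v(2) by (simp add: sx)
    from psd_solution_kernel[of a x s w, OF _ psd this] x(2) sx
    have "s * (x * v) = 0" "w * v = 0" by simp_all
    then show False using detectable[of lam v] v lam by (simp add: left_diff_distrib mult.assoc)
  qed
qed

text \<open>The solution is \<open>X = y * t\<close> with \<open>t\<close> inverse to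
  \<open>x\<close>. In terms of \<open>g = star x * y\<close> it is \<open>star t * g * t\<close>,
  so it is semidefinite as soon as \<open>g\<close> is; the remaining work is the invertibility of
  \<open>x\<close>.\<close>

theorem riccati_psd_solution:
  obtains x where "corner k x" "psdf x" "star a * x + x * a - x * s * x + w = 0"
proof -
  obtain x y \<Lambda> where cxy: "corner k x" "corner k y" and \<Lambda>: "utri k \<Lambda>" "\<And>i. i < k \<Longrightarrow> Re (ent \<Lambda> i i) < 0"
    and e1: "a * x - s * y = x * \<Lambda>" and e2: "- (w * x) - star a * y = y * \<Lambda>"
    and inj: "\<And>v. prj 0 k * v = v \<Longrightarrow> x * v = 0 \<Longrightarrow> y * v = 0 \<Longrightarrow> v = 0"
    using stable_subspace by blast
  have c\<Lambda>: "corner k \<Lambda>" using \<Lambda> by (simp add: utri_def)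
  have hz: "hurwitz k \<Lambda>" using utri_hurwitz \<Lambda> by blast
  define g where "g = star x * y"
  have x\<Lambda>: "star x * (y * \<Lambda>) = - (star x * (w * x)) - star x * (star a * y)"
    unfolding e2[symmetric] by (simp add: right_diff_distrib)
  have y\<Lambda>: "star y * (x * \<Lambda>) = star y * (a * x) - star y * (s * y)"
    unfolding e1[symmetric] by (simp add: right_diff_distrib)
  have \<Lambda>x: "star \<Lambda> * (star x * y) = star x * (star a * y) - star y * (s * y)"
    using arg_cong[OF y\<Lambda>, of star] by (simp add: mult.assoc sw)
  have \<Lambda>y: "star \<Lambda> * (star y * x) = - (star x * (w * x)) - star y * (a * x)"
    using arg_cong[OF x\<Lambda>, of star] by (simp add: mult.assoc sw)
  \<comment> \<open>\<open>g - star g\<close> is the symplectic form restricted to the stable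
    subspace. Stability of \<open>\<Lambda>\<close> leaves only the zero solution of its Sylvester
    equation.\<close>
  have "g - star g = 0"
  proof (rule sylvester_zero[OF corner_star[OF c\<Lambda>] c\<Lambda> hurwitz_star[OF c\<Lambda> hz] hz])
    show "star \<Lambda> * (g - star g) + (g - star g) * \<Lambda> = 0"
      using x\<Lambda> y\<Lambda> \<Lambda>x \<Lambda>y by (simp add: g_def left_diff_distrib right_diff_distrib mult.assoc)
  qed (use cxy in \<open>simp_all add: g_def left_diff_distrib right_diff_distrib mult.assoc corner_simps corner_star\<close>)
  then have sg: "star g = g" by simp
  have "psdf g"
  proof (rule lyapunov_triangular[of g 0 k \<Lambda> "star x * w * x + star y * s * y"])
    show "star \<Lambda> * g + g * \<Lambda> = - (star x * w * x + star y * s * y)"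
      using x\<Lambda> \<Lambda>x by (simp add: g_def mult.assoc)
    show "psdf (star x * w * x + star y * s * y)" by (intro psdf_add psdf_conj psd)
    show "prj 0 k * g = g" using cxy by (simp add: g_def mult.assoc[symmetric] corner_simps corner_star)
  qed (use sg c\<Lambda> \<Lambda> in \<open>auto simp: corner_def utri_def\<close>)
  \<comment> \<open>A nonzero kernel of \<open>x\<close> would be \<open>\<Lambda>\<close>-invariant
    and contain an eigenvector \<open>u\<close>. Then \<open>y * u\<close> would be an unstable mode
    of \<open>star a\<close> in the kernel of \<open>s\<close>, or zero, against stabilizability and
    injectivity of the pair.\<close>
  have xinj: "v = 0" if v: "prj 0 k * v = v" "x * v = 0" for v
  proof (rule ccontr)
    assume "v \<noteq> 0"
    let ?K = "\<lambda>v. prj 0 k * v = v \<and> x * v = 0"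
    have inv: "x * (\<Lambda> * v) = 0" "s * (y * v) = 0" if "x * v = 0" for v
    proof -
      have 1: "x * (\<Lambda> * v) = - (s * (y * v))"
        using e1[symmetric] that by (simp add: mult.assoc[symmetric] left_diff_distrib)
          (simp add: mult.assoc that)
      \<comment> \<open>Symmetry of \<open>g\<close> moves \<open>x\<close> onto \<open>v\<close>,
        where it vanishes; so \<open>y * v\<close> has zero \<open>s\<close>-energy.\<close>
      have "star v * (star y * (x * (\<Lambda> * v))) = star (x * v) * (y * (\<Lambda> * v))"
        using sg by (simp add: g_def mult.assoc[symmetric])
      then have "star (y * v) * (s * (y * v)) = 0" unfolding 1 that by (simp add: mult.assoc)
      then show "s * (y * v) = 0" by (rule psdf_kernel'[OF psd(1)])
      then show "x * (\<Lambda> * v) = 0" using 1 by simp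
    qed
    have "\<exists>u \<mu>. ?K u \<and> u \<noteq> 0 \<and> prj 0 k * u = u \<and> \<Lambda> * u = scal \<mu> u"
    proof (rule utri_invariant_eigenvector[OF \<Lambda>(1), of ?K v k])
      show "?K (\<Lambda> * v - scal c v)" if "?K v" for v c
        using that inv(1)[of v] c\<Lambda> by (simp add: right_diff_distrib corner_simps)
    qed (use v \<open>v \<noteq> 0\<close> in auto)
    then obtain u \<mu> where u: "prj 0 k * u = u" "x * u = 0" "u \<noteq> 0" "\<Lambda> * u = scal \<mu> u" by blast
    have \<mu>: "Re \<mu> < 0" using hz u by (auto simp: hurwitz_def)
    have "- (w * (x * u)) - star a * (y * u) = y * (\<Lambda> * u)"
      using e2 by (simp add: mult.assoc[symmetric] flip: e2) (simp add: left_diff_distrib)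
    then have "star a * (y * u) = scal (- \<mu>) (y * u)"
      using u by (simp add: scal_uminus_left minus_equation_iff[of "star a * _"])
    then have "y * u = 0" using stabilizable[of "- \<mu>" "y * u"] inv(2)[OF u(2)] \<mu> cxy by (simp add: corner_simps)
    then show False using inj u by blast
  qed
  obtain t where t: "prj 0 k * t = t" "t * prj 0 k = t" "x * t = prj 0 k" "t * x = prj 0 k"
    by (rule inj_imp_inverse[of k x]) (use cxy xinj in \<open>auto simp: corner_def\<close>)
  define X where "X = y * t"
  have "prj 0 k = star t * star x" using t(3) by (metis star_prj star_times)
  moreover have "X = prj 0 k * (y * t)" using cxy by (simp add: X_def corner_simps)
  ultimately have "X = star t * g * t" by (simp add: g_def mult.assoc)
  then have pX: "psdf X" using psdf_conj[OF \<open>psdf g\<close>] by simp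
  have cX: "corner k X" using cxy t by (simp add: X_def corner_def mult.assoc mult.assoc[symmetric, of _ y])
  have Xx: "X * x = y" using t cxy by (simp add: X_def mult.assoc corner_simps)
  \<comment> \<open>Multiplied by \<open>x\<close>, the Riccati residual of \<open>X\<close> reduces
    to the lower row of the subspace equation; the factor \<open>t\<close> then removes
    \<open>x\<close>.\<close>
  have "(star a * X + X * a - X * s * X + w) * x = star a * y + X * (a * x - s * y) + w * x"
    by (simp add: distrib_right left_diff_distrib right_diff_distrib mult.assoc Xx add.assoc)
  also have "\<dots> = star a * y + y * \<Lambda> + w * x" by (simp add: e1 mult.assoc[symmetric] Xx)
  also have "\<dots> = 0" by (simp flip: e2)
  finally have "(star a * X + X * a - X * s * X + w) * (x * t) = 0" by (simp add: mult.assoc[symmetric])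
  moreover have "corner k (star a * X + X * a - X * s * X + w)"
    by (intro corner_intros cX corner_asw)
  ultimately have "star a * X + X * a - X * s * X + w = 0" by (simp add: t corner_simps)
  then show thesis using that cX pX by blast
qed

text \<open>The conjugate of a solution solves the same real equation. The difference of two
  semidefinite solutions satisfies a Sylvester equation whose coefficients are the two stable closed
  loops, so it is 0.\<close>

theorem riccati_real_psd_solution:
  assumes real: "cconj a = a" "cconj s = s" "cconj w = w"
  obtains x where "corner k x" "psdf x" "star a * x + x * a - x * s * x + w = 0" "cconj x = x"
proof -
  obtain x where x: "corner k x" "psdf x" "star a * x + x * a - x * s * x + w = 0"
    using riccati_psd_solution by blast
  define z where "z = cconj x"
  have z: "corner k z" "psdf z" using x by (simp_all add: z_def corner_cconj psdf_cconj)
  have z3: "star a * z + z * a - z * s * z + w = 0"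
    using arg_cong[OF x(3), of cconj] real by (simp add: z_def)
  have h: "hurwitz k (a - s * x)" "hurwitz k (a - s * z)"
    using psd_solution_hurwitz x(2,3) z(2) z3 by blast+
  have c: "corner k (a - s * x)" "corner k (a - s * z)"
    by (intro corner_intros corner_asw x z)+
  have sx: "star x = x" using x psdf_star by blast
  have "x - z = 0"
  proof (rule sylvester_zero[OF corner_star[OF c(1)] c(2) hurwitz_star[OF c(1) h(1)] h(2)])
    have "star (a - s * x) * (x - z) + (x - z) * (a - s * z) =
        (star a * x + x * a - x * s * x + w) - (star a * z + z * a - z * s * z + w)"
      by (simp add: sx sw left_diff_distrib right_diff_distrib mult.assoc)
    then show "star (a - s * x) * (x - z) + (x - z) * (a - s * z) = 0" unfolding x z3 by simp
  qed (use x z in \<open>simp_all add: corner_simps left_diff_distrib right_diff_distrib\<close>)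
  then have "cconj x = x" by (simp add: z_def)
  then show thesis using that x by blast
qed

end

section \<open>Rank normal form and changes of coordinates\<close>

text \<open>Mutually inverse matrices on the index block from \<open>a\<close> to \<open>b\<close>.
  Reality is included so that changes of coordinates preserve real data.\<close>

definition inv_pair :: "nat \<Rightarrow> nat \<Rightarrow> fmat \<Rightarrow> fmat \<Rightarrow> bool" where
  "inv_pair a b u u' \<longleftrightarrow> prj a b * u = u \<and> u * prj a b = u \<and> prj a b * u' = u' \<and> u' * prj a b = u'
     \<and> u * u' = prj a b \<and> u' * u = prj a b \<and> cconj u = u \<and> cconj u' = u'"

lemma inv_pair_prj: "inv_pair a b (prj a b) (prj a b)"
  by (simp add: inv_pair_def)

lemma inv_pair_sym: "inv_pair a b u u' \<Longrightarrow> inv_pair a b u' u"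
  by (simp add: inv_pair_def)

lemma inv_pair_star: "inv_pair a b u u' \<Longrightarrow> inv_pair a b (star u) (star u')"
  unfolding inv_pair_def by (metis cconj_star star_prj star_times)

lemma inv_pair_mult:
  assumes "inv_pair a b u u'" "inv_pair a b w w'"
  shows "inv_pair a b (u * w) (w' * u')"
proof -
  note 1 = assms[unfolded inv_pair_def]
  have "u * (w * (w' * u')) = prj a b" "w' * (u' * (u * w)) = prj a b"
    using 1 mult_assocD[of w w' "prj a b"] mult_assocD[of u' u "prj a b"]
      mult_assocD[of "prj a b" u' u'] mult_assocD[of "prj a b" w w] by auto
  then show ?thesis using 1 by (simp add: inv_pair_def mult.assoc mult_assocD[of "prj a b"])
qed

lemma inv_pair_cancel:
  assumes "inv_pair a b u u'"
  shows "prj a b * v = v \<Longrightarrow> u * v = 0 \<Longrightarrow> v = 0"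
  using assms unfolding inv_pair_def by (metis mult.assoc mult_zero_right)

section \<open>Elimination to rank normal form\<close>

lift_definition unit_at :: "nat \<Rightarrow> nat \<Rightarrow> fmat" is "\<lambda>p q i j. if i = p \<and> j = q then 1 else 0"
  subgoal for p q by (intro exI[of _ "Suc (max p q)"]) auto done

lemma ent_unit_at: "ent (unit_at p q) i j = (if i = p \<and> j = q then 1 else 0)"
  by (simp add: unit_at.rep_eq)

lemma ent_unit_at_times: "ent (unit_at p q * x) i j = (if i = p then ent x q j else 0)"
proof -
  have "bnd (Suc (max p q)) (unit_at p q)" by (auto simp: bnd_def ent_unit_at)
  then have "ent (unit_at p q * x) i j = (\<Sum>k<Suc (max p q). if k = q then (if i = p then ent x q j else 0) else 0)"
    by (subst ent_times, assumption, intro sum.cong) (auto simp: ent_unit_at)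
  then show ?thesis by simp
qed

text \<open>If the wanted entry is 0, adding row \<open>i\<close> to row \<open>a\<close> makes it
  nonzero. The shear has a nilpotent part of square 0, hence its inverse is obtained by changing the
  sign.\<close>

lemma row_pivot:
  assumes "a \<le> i" "i < b" "prj a b * x = x" "ent x i j \<noteq> 0"
  shows "\<exists>u u'. inv_pair a b u u' \<and> ent (u * x) a j \<noteq> 0"
proof (cases "ent x a j = 0")
  case False
  then show ?thesis using inv_pair_prj[of a b] assms by (intro exI[of _ "prj a b"]) auto
next
  case True
  let ?u = "unit_at a i"
  have ia: "i \<noteq> a" using True assms by auto
  have 1: "prj a b * ?u = ?u" "?u * prj a b = ?u" "?u * ?u = 0" "cconj ?u = ?u"
    using ia assms
    by (auto intro!: fmat_eqI simp: ent_prj_times ent_times_prj ent_unit_at_times ent_unit_at)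
  then have "inv_pair a b (prj a b + ?u) (prj a b - ?u)"
    by (simp add: inv_pair_def distrib_left distrib_right left_diff_distrib right_diff_distrib)
  moreover have "ent ((prj a b + ?u) * x) a j \<noteq> 0"
    using assms True by (simp add: distrib_right ent_unit_at_times)
  ultimately show ?thesis by blast
qed

text \<open>Columns are treated by applying the row version to the adjoint.\<close>

lemma pivot:
  assumes x: "prj a b * x = x" "x * prj a b = x" "x \<noteq> 0"
  obtains u u' v v' where "inv_pair a b u u'" "inv_pair a b v v'" "ent (u * x * v) a a \<noteq> 0"
proof -
  obtain i j where ij: "ent x i j \<noteq> 0" using x(3) by (metis ent_zero fmat_eqI)
  have "ent (prj a b * x) i j \<noteq> 0" "ent (x * prj a b) i j \<noteq> 0" using ij x by simp_all
  then have i: "a \<le> i" "i < b" and j: "a \<le> j" "j < b" 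
    by (auto simp: ent_prj_times ent_times_prj split: if_splits)
  obtain u u' where u: "inv_pair a b u u'" "ent (u * x) a j \<noteq> 0" using row_pivot[OF i x(1) ij] by blast
  have "prj a b * star (u * x) = star (u * x)" using arg_cong[OF x(2), of star]
    by (simp add: mult.assoc[symmetric])
  moreover have "ent (star (u * x)) j a \<noteq> 0" using u(2) by (simp del: star_times)
  ultimately obtain w w' where w: "inv_pair a b w w'" "ent (w * star (u * x)) a a \<noteq> 0"
    using row_pivot[OF j] by blast
  have "ent (star (w * star (u * x))) a a \<noteq> 0" using w(2) unfolding ent_star complex_cnj_zero_iff .
  then have "ent (u * x * star w) a a \<noteq> 0" by simp
  then show thesis using that[OF u(1) inv_pair_star[OF w(1)]] by blast
qed

text \<open>Gaussian elimination: bring a nonzero entry to position \<open>(a,a)\<close>, clear its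
  row and column, and continue with the Schur complement on the interval from
  \<open>a + 1\<close>.\<close>

lemma rank_normal_form:
  assumes "a \<le> b" "prj a b * x = x" "x * prj a b = x" "cconj x = x"
  shows "\<exists>u u' v v' c. inv_pair a b u u' \<and> inv_pair a b v v' \<and> a \<le> c \<and> c \<le> b \<and> u * x * v = prj a c"
  using assms
proof (induction "b - a" arbitrary: a x)
  case 0
  then have "x = 0" using prj_empty[of b a] by simp
  then show ?case using inv_pair_prj[of a b] 0
    by (intro exI[of _ "prj a b"] exI[of _ a]) (auto simp: prj_empty)
next
  case (Suc d)
  show ?case
  proof (cases "x = 0")
    case True
    then show ?thesis using inv_pair_prj[of a b] Suc.prems
      by (intro exI[of _ "prj a b"] exI[of _ a]) (auto simp: prj_empty)
  next
    case False
    obtain u1 u1' v1 v1' where uv: "inv_pair a b u1 u1'" "inv_pair a b v1 v1'" "ent (u1 * x * v1) a a \<noteq> 0"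
      using pivot Suc.prems False by metis
    define z where "z = u1 * x * v1"
    have zc: "prj a b * z = z" "z * prj a b = z" "cconj z = z"
      using uv Suc.prems(4) by (simp_all add: z_def inv_pair_def mult.assoc mult_assocD[of "prj a b"])
    define p f where "p = prj a (Suc a)" and "f = prj (Suc a) b"
    have pf: "p + f = prj a b" using Suc.hyps(2) by (simp add: p_def f_def prj_split[symmetric])
    have pp: "p * p = p" "f * f = f" "p * f = 0" "f * p = 0" "cconj p = p" "cconj f = f"
      by (simp_all add: p_def f_def prj_inter prj_empty)
    note pp' = pp(1-4)[THEN mult_assocD]
    define \<gamma> i where "\<gamma> = ent z a a" and "i = 1 / \<gamma>"
    have i: "i * \<gamma> = 1" "\<gamma> * i = 1" using uv(3) by (simp_all add: i_def \<gamma>_def z_def)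
    have "cnj \<gamma> = \<gamma>" using arg_cong[OF zc(3), of "\<lambda>x. ent x a a"] by (simp add: \<gamma>_def)
    then have ir: "cnj \<gamma> = \<gamma>" "cnj i = i" by (simp_all add: i_def)
    have pzp: "p * (z * p) = scal \<gamma> p" unfolding p_def \<gamma>_def by (rule unit_sandwich)
    note pzp' = pzp[THEN mult_assocD, unfolded mult.assoc, simplified]
    \<comment> \<open>\<open>u2\<close> clears the column below the pivot; \<open>v2\<close> scales
      the pivot to 1 and clears its row. What remains is the Schur complement
      \<open>y\<close>.\<close>
    define u2 u2' v2 v2' where "u2 = p + f - scal i (f * (z * p))" and "u2' = p + f + scal i (f * (z * p))"
      and "v2 = f + scal i p - scal i (p * (z * f))" and "v2' = f + scal \<gamma> p + p * (z * f)"
    note ds = distrib_left distrib_right left_diff_distrib right_diff_distrib mult.assoc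
    have u2: "inv_pair a b u2 u2'"
      using zc(3) ir by (simp add: inv_pair_def u2_def u2'_def pf[symmetric] ds pp pp')
    have v2: "inv_pair a b v2 v2'"
      using zc(3) ir i by (simp add: inv_pair_def v2_def v2'_def pf[symmetric] ds pp pp' scal_add scal_minus)
    define y where "y = f * (z * f) - scal i (f * (z * (p * (z * f))))"
    have uzv: "u2 * z * v2 = p + y"
    proof -
      have z4: "z = p * (z * p) + p * (z * f) + f * (z * p) + f * (z * f)"
      proof -
        have "z = (p + f) * (z * (p + f))" unfolding pf using zc by simp
        also have "\<dots> = p * (z * p) + p * (z * f) + f * (z * p) + f * (z * f)" by (simp add: ds add_ac)
        finally show ?thesis .
      qed
      have pu: "p * u2 = p" "f * u2 = f - scal i (f * (z * p))" "v2 * p = scal i p" "v2 * f = f - scal i (p * (z * f))"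
        by (simp_all add: u2_def v2_def ds pp pp')
      have "p * (u2 * z * v2) * p = p" "p * (u2 * z * v2) * f = 0" "f * (u2 * z * v2) * p = 0"
        "f * (u2 * z * v2) * f = y"
      proof -
        have *: "r * (u2 * z * v2) * s = (r * u2) * (z * (v2 * s))" for r s by (simp add: mult.assoc)
        show "p * (u2 * z * v2) * p = p" unfolding * pu by (simp add: ds pzp i)
        show "p * (u2 * z * v2) * f = 0" unfolding * pu by (simp add: ds pzp' i)
        show "f * (u2 * z * v2) * p = 0" unfolding * pu by (simp add: ds pzp i pzp')
        show "f * (u2 * z * v2) * f = y" unfolding * pu by (simp add: ds pzp i pzp' y_def)
      qed
      moreover have "u2 * z * v2 = (p + f) * (u2 * z * v2) * (p + f)"
        unfolding pf using u2 v2 by (simp add: inv_pair_def ds mult_assocD[of "prj a b"])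
      ultimately show ?thesis by (simp add: ds)
    qed
    have y: "f * y = y" "y * f = y" "cconj y = y" using zc(3) ir pp by (simp_all add: y_def ds pp')
    have "\<exists>u3 u3' v3 v3' c. inv_pair (Suc a) b u3 u3' \<and> inv_pair (Suc a) b v3 v3' \<and> Suc a \<le> c \<and> c \<le> b
        \<and> u3 * y * v3 = prj (Suc a) c"
      by (rule Suc.hyps(1)) (use Suc.hyps(2) y in \<open>auto simp: f_def\<close>)
    then obtain u3 u3' v3 v3' c where IH: "inv_pair (Suc a) b u3 u3'" "inv_pair (Suc a) b v3 v3'"
      "Suc a \<le> c" "c \<le> b" "u3 * y * v3 = prj (Suc a) c"
      by blast
    have ext: "inv_pair a b (p + w) (p + w')" if "inv_pair (Suc a) b w w'" for w w'
    proof -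
      note w = that[unfolded inv_pair_def, folded f_def]
      have pw: "p * w = 0" "w * p = 0" "p * w' = 0" "w' * p = 0"
        using w pp by (metis mult.assoc mult_zero_left mult_zero_right)+
      show ?thesis using w pw pp by (simp add: inv_pair_def pf[symmetric] ds)
    qed
    have pu3: "p * y = 0" "y * p = 0" "u3 * p = 0" "p * v3 = 0"
      using y pp IH(1,2)[unfolded inv_pair_def, folded f_def]
      by (metis mult.assoc mult_zero_left mult_zero_right)+
    have pac: "prj a c = p + prj (Suc a) c" unfolding p_def using IH(3) by (intro prj_split) auto
    have "((p + u3) * u2 * u1) * x * (v1 * v2 * (p + v3)) = (p + u3) * (u2 * z * v2) * (p + v3)"
      by (simp add: z_def mult.assoc)
    also have "\<dots> = prj a c" unfolding uzv pac using IH(5) pu3 by (simp add: ds pp pu3[THEN mult_assocD])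
    finally have "((p + u3) * u2 * u1) * x * (v1 * v2 * (p + v3)) = prj a c" .
    moreover have "inv_pair a b ((p + u3) * u2 * u1) (u1' * (u2' * (p + u3')))"
      "inv_pair a b (v1 * v2 * (p + v3)) ((p + v3') * (v2' * v1'))"
      by (intro inv_pair_mult ext IH uv u2 v2)+
    moreover have "a \<le> c" using IH(3) by simp
    ultimately show ?thesis using IH(4) by blast
  qed
qed

text \<open>(GC) is the case \<open>S = B B^T\<close>, \<open>W = C^T C\<close>. (GF) is the case of
  the transposed \<open>A\<close> with \<open>S = C^T C\<close>, \<open>W = B B^T + 2 R\<close> and
  the transpose of \<open>Pf\<close> as unknown. The symmetry condition involving \<open>E\<close>
  is kept apart.\<close>

definition gare :: "fmat \<Rightarrow> fmat \<Rightarrow> fmat \<Rightarrow> fmat \<Rightarrow> bool" where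
  "gare A S W P \<longleftrightarrow> star A * P + star P * A - star P * S * P + W = 0"

text \<open>Left kernel form of strong stabilizability, with \<open>S = B B\<^sup>T\<close> in place of \<open>B\<close>.\<close>

definition adm :: "nat \<Rightarrow> fmat \<Rightarrow> fmat \<Rightarrow> fmat \<Rightarrow> bool" where
  "adm n E A S \<longleftrightarrow>
     (\<forall>lam y. 0 \<le> Re lam \<longrightarrow> prj 0 n * y = y \<longrightarrow> star A * y = scal lam (star E * y) \<longrightarrow> S * y = 0 \<longrightarrow> y = 0) \<and>
     (\<forall>y z. prj 0 n * y = y \<longrightarrow> star E * y = 0 \<longrightarrow> star A * y = star E * z \<longrightarrow> S * y = 0 \<longrightarrow> y = 0)"

lemma adm1: "adm n E A S \<Longrightarrow> 0 \<le> Re lam \<Longrightarrow> prj 0 n * y = y \<Longrightarrow> star A * y = scal lam (star E * y) \<Longrightarrow> S * y = 0 \<Longrightarrow> y = 0"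
  and adm2: "adm n E A S \<Longrightarrow> prj 0 n * y = y \<Longrightarrow> star E * y = 0 \<Longrightarrow> star A * y = star E * z \<Longrightarrow> S * y = 0 \<Longrightarrow> y = 0"
  unfolding adm_def by blast+

text \<open>A left kernel vector \<open>y\<close> of the transformed data gives the left kernel
  vector \<open>star U * y\<close> of the original ones; \<open>star V\<close> only multiplies the
  resulting equations and cancels.\<close>

lemma adm_transform:
  assumes U: "inv_pair 0 n U U'" and V: "inv_pair 0 n V V'" and c: "corner n E" "corner n A" "corner n S"
    and adm: "adm n E A S"
  shows "adm n (U * E * V) (U * A * V) (U * S * star U)"
proof -
  have sU: "inv_pair 0 n (star U) (star U')" and sV: "inv_pair 0 n (star V) (star V')"
    using U V inv_pair_star by blast+
  have cl: "prj 0 n * (star E * z) = star E * z" "prj 0 n * (star A * z) = star A * z" "prj 0 n * (S * z) = S * z"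
    "prj 0 n * (star U * z) = star U * z" for z
    using c sU by (simp_all add: corner_simps corner_star inv_pair_def mult_assocD[of "prj 0 n"])
  have y0: "y = 0" if "prj 0 n * y = y" "star U * y = 0" for y
    using inv_pair_cancel[OF sU] that by blast
  have S0: "S * (star U * y) = 0" if "U * S * star U * y = 0" for y
    using inv_pair_cancel[OF U, of "S * (star U * y)"] cl that by (simp add: mult.assoc)
  have V0: "z = w" if "star V * z = star V * w" "prj 0 n * z = z" "prj 0 n * w = w" for z w
    using inv_pair_cancel[OF sV, of "z - w"] that by (simp add: right_diff_distrib)
  show ?thesis unfolding adm_def
  proof (intro conjI allI impI)
    fix lam y assume y: "0 \<le> Re lam" "prj 0 n * y = y" "star (U * A * V) * y = scal lam (star (U * E * V) * y)"
      "U * S * star U * y = 0"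
    have "star A * (star U * y) = scal lam (star E * (star U * y))"
      by (rule V0) (use y(3) cl in \<open>simp_all add: mult.assoc\<close>)
    from adm1[OF adm y(1) cl(4) this S0[OF y(4)]] y0[OF y(2)] show "y = 0" by simp
  next
    fix y z assume y: "prj 0 n * y = y" "star (U * E * V) * y = 0" "star (U * A * V) * y = star (U * E * V) * z"
      "U * S * star U * y = 0"
    have 1: "star E * (star U * y) = 0" by (rule V0) (use y(2) cl in \<open>simp_all add: mult.assoc\<close>)
    have 2: "star A * (star U * y) = star E * (star U * z)"
      by (rule V0) (use y(3) cl in \<open>simp_all add: mult.assoc\<close>)
    from adm2[OF adm cl(4) 1 2 S0[OF y(4)]] y0[OF y(1)] show "y = 0" by simp
  qed
qed

text \<open>In \<open>star A * P\<close> the factor \<open>U\<close> cancels between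
  \<open>A\<close> and the unknown, and \<open>V\<close> acts as a congruence on the whole equation.
  Hence \<open>U\<close> and \<open>V\<close> are independent of each other.\<close>

lemma gare_transform:
  assumes U: "inv_pair 0 n U U'" and V: "inv_pair 0 n V V'" and c: "corner n A" "corner n W"
    and g: "gare (U * A * V) (U * S * star U) (star V * W * V) P"
  shows "gare A S W (star U * P * V')"
proof -
  note u = U[unfolded inv_pair_def] and v = V[unfolded inv_pair_def]
  have v': "star V' * star V = prj 0 n" using v by (metis star_prj star_times)
  have A: "A * V * V' = A" using c v by (simp add: mult.assoc corner_simps)
  have sA: "star V' * star V * star A = star A" using A by (metis star_times mult.assoc)
  have W: "star V' * (star V * W * V) * V' = W"
    using c v v' by (simp add: mult.assoc corner_simps mult_assocD[OF v'])
  have "star V' * (star (U * A * V) * P + star P * (U * A * V) - star P * (U * S * star U) * P + star V * W * V) * V' = 0"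
    using g by (simp add: gare_def)
  then have "(star V' * star V * star A) * (star U * P * V') + star (star U * P * V') * (A * V * V')
      - star (star U * P * V') * S * (star U * P * V') + star V' * (star V * W * V) * V' = 0"
    by (simp add: distrib_left distrib_right left_diff_distrib right_diff_distrib mult.assoc)
  then show ?thesis unfolding A sA W gare_def .
qed

section \<open>Generalized Riccati equations in reduced coordinates\<close>

lemmas ring_ds = distrib_left distrib_right left_diff_distrib right_diff_distrib mult.assoc

lemma real_scalar: "cnj t = t \<Longrightarrow> Im t = 0"
  by (metis Reals_cnj_iff complex_is_Real_iff)

text \<open>In these coordinates the algebraic part of \<open>A\<close> is \<open>- prj r q\<close>, so shifting it by \<open>- prj 0 r\<close>
  gives a negative semidefinite matrix whose unstable modes are all at the eigenvalue \<open>0\<close>.\<close>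

lemma algebraic_part_admissible:
  assumes rq: "r \<le> q" "q \<le> n" and T: "psdf T"
    and C: "prj 0 n * C = C" "prj r n * (C * prj r n) = - prj r q"
    and inj: "\<And>y z. prj 0 n * y = y \<Longrightarrow> prj 0 r * y = 0 \<Longrightarrow> C * y = prj 0 r * z \<Longrightarrow> T * y = 0 \<Longrightarrow> y = 0"
    and y: "0 \<le> Re lam" "prj 0 n * y = y" "- (prj 0 q * y) = scal lam y" "prj r n * (T * (prj r n * y)) = 0"
  shows "y = 0"
proof -
  let ?e = "prj 0 r" and ?f = "prj r n"
  have ef: "?e + ?f = prj 0 n" using rq by (simp add: prj_split[symmetric])
  have "cnj (tr (star y * y)) = tr (star y * y)" by (simp flip: tr_star)
  then have im: "Im (tr (star y * y)) = 0" by (rule real_scalar)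
  \<comment> \<open>Pairing the mode with \<open>y\<close> equates minus the squared norm of
    \<open>prj 0 q * y\<close> with \<open>lam\<close> times that of \<open>y\<close>; for
    \<open>0 \<le> Re lam\<close> the former must vanish.\<close>
  have "- tr (star (prj 0 q * y) * (prj 0 q * y)) = lam * tr (star y * y)"
    using arg_cong[OF y(3), of "\<lambda>v. tr (star y * v)"] by (simp add: mult.assoc)
  then have "- Re (tr (star (prj 0 q * y) * (prj 0 q * y))) = Re lam * Re (tr (star y * y))"
    using im by (metis Re_complex_of_real complex_eq_iff mult.right_neutral mult_zero_right diff_zero times_complex.sel(1) uminus_complex.sel(1))
  then have "Re (tr (star (prj 0 q * y) * (prj 0 q * y))) = 0"
    using tr_star_self_nonneg[of "prj 0 q * y"] tr_star_self_nonneg[of y] y(1)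
    by (smt (verit) mult_nonneg_nonneg)
  then have qy: "prj 0 q * y = 0" by (rule tr_star_self_eq_0)
  have ey: "?e * y = 0"
    using rq arg_cong[OF qy, of "\<lambda>v. ?e * v"] by (simp add: prj_inter[THEN mult_assocD])
  have dy: "prj r q * y = 0"
    using rq arg_cong[OF qy, of "\<lambda>v. prj r q * v"] by (simp add: prj_inter[THEN mult_assocD])
  have fy: "?f * y = y" using y(2) ey by (simp add: ef[symmetric] distrib_right)
  have "star y * (T * y) = star (?f * y) * (T * (?f * y))" unfolding fy ..
  then have "star y * (T * y) = star y * (?f * (T * (?f * y)))" by (simp add: mult.assoc)
  then have Ty: "T * y = 0" using psdf_kernel'[OF T] y(4) by simp
  \<comment> \<open>\<open>y\<close> lies in the kernel of the algebraic block, so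
    \<open>C * y\<close> has only differential components: the premise of the impulse test
    \<open>inj\<close>.\<close>
  have "?f * (C * y) = 0"
    using C(2)[THEN mult_assocD, of y] dy fy by (simp add: mult.assoc)
  moreover have "C * y = ?e * (C * y) + ?f * (C * y)"
    using C(1)[THEN mult_assocD, of y] by (simp add: ef distrib_right[symmetric])
  ultimately have "C * y = ?e * (C * y)" by simp
  then show ?thesis using inj[OF y(2) ey _ Ty] by blast
qed

text \<open>The solution has the blocks \<open>e * P = p\<close> and \<open>P * f = X\<close>, both
  from classical Riccati equations, and a lower left block that is affine in \<open>p\<close>. The
  last two conclusions expose the algebraic block for \<open>reduced_pair_injective\<close>.\<close>

lemma reduced_gare:
  assumes rq: "r \<le> q" "q \<le> n" and cA: "corner n A" and cS: "corner n S" and cW: "corner n W"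
    and psd: "psdf S" "psdf W" and real: "cconj A = A" "cconj S = S" "cconj W = W"
    and A22: "prj r n * (A * prj r n) = - prj r q"
    and stab: "adm n (prj 0 r) A S" and det: "adm n (prj 0 r) (star A) W"
  obtains P where "corner n P" "cconj P = P" "psdf (prj 0 r * P)" "gare A S W P"
    "prj r n * (P * prj r n) = P * prj r n" "psdf (P * prj r n)"
proof -
  define e f where "e = prj 0 r" and "f = prj r n"
  have ef: "e + f = prj 0 n" unfolding e_def f_def using rq by (simp add: prj_split[symmetric])
  have ee: "e * e = e" "f * f = f" "e * f = 0" "f * e = 0" "star e = e" "star f = f" "cconj e = e" "cconj f = f"
    by (simp_all add: e_def f_def prj_inter prj_empty)
  note ee' = ee(1-4)[THEN mult_assocD]
  note st = adm1[OF stab, folded e_def, unfolded ee] adm2[OF stab, folded e_def, unfolded ee]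
  note dt = adm1[OF det, folded e_def, unfolded ee star_star] adm2[OF det, folded e_def, unfolded ee star_star]
  have sS: "star S = S" "star W = W" using psd psdf_star by blast+
  note csA = corner_star[OF cA]
  have A22': "f * (star A * f) = - prj r q"
    using arg_cong[OF A22, of star] ee by (simp add: f_def mult.assoc)
  have cf: "corner n f" "corner n e" unfolding f_def e_def using rq by (auto intro: corner_prj)

  \<comment> \<open>Lower right block: the algebraic Riccati equation\<close>
  interpret alg: riccati_data n "- prj 0 q" "f * (S * f)" "f * (W * f)"
  proof
    show "corner n (- prj 0 q)" "corner n (f * (S * f))" "corner n (f * (W * f))"
      using rq by (auto intro!: corner_intros cf cS cW)
    show "psdf (f * (S * f))" "psdf (f * (W * f))"
      using psdf_conj[OF psd(1), of f] psdf_conj[OF psd(2), of f] ee by (simp_all add: mult.assoc)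
    fix lam y assume y: "0 \<le> Re lam" "prj 0 n * y = y"
    show "y = 0" if "star (- prj 0 q) * y = scal lam y" "f * (S * f) * y = 0"
      by (rule algebraic_part_admissible[OF rq psd(1), of "star A"])
        (use that y st(2) A22' csA in \<open>auto simp: e_def f_def mult.assoc corner_simps\<close>)
    show "y = 0" if "- prj 0 q * y = scal lam y" "f * (W * f) * y = 0"
      by (rule algebraic_part_admissible[OF rq psd(2), of A])
        (use that y dt(2) A22 cA in \<open>auto simp: e_def f_def mult.assoc corner_simps\<close>)
  qed
  obtain X where X: "corner n X" "psdf X" "cconj X = X"
    and are: "star (- prj 0 q) * X + X * (- prj 0 q) - X * (f * (S * f)) * X + f * (W * f) = 0"
    by (rule alg.riccati_real_psd_solution) (simp_all add: ee real)
  have sX: "star X = X" using X psdf_star by blast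
  \<comment> \<open>On the added coordinates the equation says that \<open>- 2 e X e\<close> is the
    \<open>S\<close>-energy of \<open>f * (X * e)\<close>. Both \<open>X\<close> and
    \<open>S\<close> are semidefinite, so \<open>X\<close> vanishes there and the shift by
    \<open>- prj 0 r\<close> leaves no trace.\<close>
  have Xe: "X * e = 0"
  proof -
    have eq: "e * prj 0 q = e" "prj 0 q * e = e" "prj 0 q * (e * z) = e * z" "e * (prj 0 q * z) = e * z" for z
      using rq by (simp_all add: e_def prj_inter prj_inter[THEN mult_assocD])
    have "e * (star (- prj 0 q) * X + X * (- prj 0 q) - X * (f * (S * f)) * X + f * (W * f)) * e = 0"
      unfolding are by simp
    then have "- (e * (X * e)) - e * (X * e) - star (f * (X * e)) * (S * (f * (X * e))) = 0"
      by (simp add: ring_ds eq ee ee' sX)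
    from arg_cong[OF this, of "\<lambda>x. Re (tr x)"]
    have "- 2 * Re (tr (e * (X * e))) = Re (tr (star (f * (X * e)) * (S * (f * (X * e)))))"
      by (simp only: tr_minus tr_uminus tr_zero minus_complex.sel uminus_complex.sel zero_complex.sel)
    then have "Re (tr (star e * (X * e))) = 0"
      using psdf_nonneg[OF psd(1), of "f * (X * e)"] psdf_nonneg[OF X(2), of e] ee by simp
    then show ?thesis by (rule psdf_kernel[OF X(2)])
  qed
  have eX: "e * X = 0" using arg_cong[OF Xe, of star] ee sX by simp
  have Xf: "X * f = X" "f * X = X"
    using X(1) eX Xe by (simp_all add: corner_def ef[symmetric] ring_ds)
  note Xr = Xf Xf[THEN mult_assocD] Xe eX Xe[THEN mult_assocD] eX[THEN mult_assocD]

  \<comment> \<open>Lower left block: a linear equation\<close>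
  define A2 Ac where "A2 = f * (A * f)" and "Ac = A2 - f * (S * X)"
  have are2: "star A2 * X + X * A2 - X * (S * X) + f * (W * f) = 0"
  proof -
    have d: "prj 0 q * f = prj r q" using rq by (simp add: f_def prj_inter)
    have "prj 0 q * X = prj r q * X" "X * prj 0 q = X * prj r q"
      using Xf d arg_cong[OF d, of star] ee by (metis mult.assoc, metis mult.assoc star_prj star_times)
    then show ?thesis using are A22 A22' ee unfolding A2_def f_def[symmetric]
      by (simp add: ring_ds Xr)
  qed
  have fA2: "f * A2 = A2" "A2 * f = A2" "e * A2 = 0" "A2 * e = 0" by (simp_all add: A2_def mult.assoc ee ee')
  have fAc: "f * Ac = Ac" "Ac * f = Ac" "e * Ac = 0" "Ac * e = 0" by (simp_all add: Ac_def ring_ds fA2 ee ee' Xr)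
  have cA2: "corner n A2" and cAc: "corner n Ac"
    unfolding Ac_def A2_def by (intro corner_intros cA cS cf X)+
  have sAc: "star Ac = star A2 - X * (S * f)" by (simp add: Ac_def sX sS ee mult.assoc)

  \<comment> \<open>The closed-loop algebraic block \<open>Ac\<close> is invertible,
    \<open>e\<close> being added to fill the corner. By \<open>psd_solution_kernel\<close> a kernel
    vector is invisible to \<open>W\<close> and mapped by \<open>A\<close> into the image of
    \<open>e\<close>, which the dual impulse test excludes.\<close>
  have inj: "v = 0" if v: "prj 0 n * v = v" "(Ac + e) * v = 0" for v
  proof -
    have "e * ((Ac + e) * v) = e * v" by (simp add: ring_ds ee' fAc[THEN mult_assocD])
    then have ev: "e * v = 0" using v by simp
    then have Acv: "Ac * v = 0" using v by (simp add: distrib_right)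
    have fv: "f * v = v" using v(1) ev by (simp add: ef[symmetric] distrib_right)
    have "star X * ((A2 - S * X) * v) = X * (Ac * v)" by (simp add: sX Ac_def ring_ds Xr)
    then have 0: "0 \<le> Re (tr (star v * (star X * ((A2 - S * X) * v))))" using Acv by simp
    have fW: "psdf (f * (W * f))" by (rule alg.psd(2))
    have sol: "star A2 * X + star X * A2 - star X * S * X + f * (W * f) = 0"
      using are2 by (simp add: sX mult.assoc)
    note ker = psd_solution_kernel[OF sol psd(1) fW 0]
    have "star v * (W * v) = star v * (f * (W * f) * v)"
    proof -
      have "star v * f = star v" using arg_cong[OF fv, of star] ee by simp
      then show ?thesis by (simp add: mult.assoc fv mult_assocD[of "star v" f])
    qed
    then have Wv: "W * v = 0" using ker psdf_kernel'[OF psd(2)] by simp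
    have "f * (A * v) = Ac * v + f * (S * (X * v))" by (simp add: Ac_def A2_def ring_ds fv)
    then have "f * (A * v) = 0" using Acv ker by simp
    then have "A * v = e * (A * v)"
      using cA by (metis add.right_neutral corner_left' distrib_right ef)
    then show ?thesis using dt(2)[OF v(1) ev _ Wv] by blast
  qed
  obtain t where t: "prj 0 n * t = t" "t * prj 0 n = t" "(Ac + e) * t = prj 0 n" "t * (Ac + e) = prj 0 n"
    "cconj (Ac + e) = Ac + e \<Longrightarrow> cconj t = t"
    by (rule inj_imp_inverse[of n "Ac + e", OF _ _ inj]) (use cAc cf in \<open>auto simp: corner_simps ring_ds\<close>)
  have t': "Ac * t + e * t = e + f" "t * Ac + t * e = e + f"
    using t(3,4) unfolding ef[symmetric] by (simp_all add: distrib_left distrib_right)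
  define k where "k = f * (t * f)"
  have rA2: "cconj A2 = A2" and rAc: "cconj Ac = Ac" by (simp_all add: A2_def Ac_def real ee X)
  have k: "f * k = k" "k * f = k" "Ac * k = f" "k * Ac = f" "cconj k = k" "e * k = 0" "k * e = 0"
  proof -
    have "f * (Ac * t + e * t) = f * (e + f)" by (simp only: t')
    then have 1: "Ac * t = f" using fAc by (simp add: ring_ds ee ee' fAc[THEN mult_assocD])
    have "(t * Ac + t * e) * f = (e + f) * f" by (simp only: t')
    then have 2: "t * Ac = f" using fAc by (simp add: ring_ds ee ee')
    show "Ac * k = f" using 1 fAc(2)[THEN mult_assocD] by (simp add: k_def mult.assoc[symmetric] fAc ee)
    show "k * Ac = f" using 2 by (simp add: k_def mult.assoc fAc ee)
    show "f * k = k" "k * f = k" "e * k = 0" "k * e = 0" by (simp_all add: k_def mult.assoc ee ee')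
    show "cconj k = k" using t(5) rAc by (simp add: k_def ee)
  qed
  have ks: "f * star k = star k" "star k * f = star k" "e * star k = 0" "star k * e = 0" "cconj (star k) = star k"
    using k(1,2,5,6,7) ee by (metis star_times, metis star_times, metis star_times star_zero, metis star_times star_zero, simp)
  note kr = k(1-4,6,7) k(1-4,6,7)[THEN mult_assocD] ks(1-4) ks(1-4)[THEN mult_assocD]

  \<comment> \<open>For a matrix with \<open>e * P0 = 0\<close> and \<open>P0 * f = X\<close> the
    \<open>f\<close> rows of the Riccati equation become linear:
    \<open>star Ac * P0 + f * W + X * A = 0\<close>. Here \<open>k\<close> is the inverse of
    \<open>Ac\<close> on the block.\<close>
  define P0 where "P0 = - (star k * (f * W + X * A))"
  have fP0: "f * P0 = P0" "e * P0 = 0" by (simp_all add: P0_def mult.assoc kr)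
  have cP0: "corner n P0" "cconj P0 = P0"
  proof -
    have "corner n k" unfolding k_def using t cf by (intro corner_times) (auto simp: corner_def)
    then show "corner n P0" unfolding P0_def by (intro corner_intros cf cW X cA)
    show "cconj P0 = P0" by (simp add: P0_def real X ee ks(5) k(5))
  qed
  have P0f: "P0 * f = X"
  proof -
    have "f * (W * f) + X * (A * f) = - (star Ac * X)"
    proof -
      have "X * A2 = X * (A * f)" by (simp add: A2_def Xr)
      then show ?thesis using are2 unfolding sAc by (simp add: ring_ds Xr algebra_simps)
    qed
    then have "P0 * f = star k * (star Ac * X)" by (simp add: P0_def mult.assoc distrib_right)
    also have "\<dots> = star (Ac * k) * X" by (simp add: mult.assoc)
    also have "\<dots> = X" using k ee Xr by simp
    finally show ?thesis .
  qed
  have sP0: "star P0 = - ((W * f + star A * X) * k)" by (simp add: P0_def sS sX ee)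
  have P0s: "star P0 * f = star P0" "star P0 * e = 0" "f * star P0 = X"
    using arg_cong[OF fP0(1), of star] arg_cong[OF fP0(2), of star] arg_cong[OF P0f, of star] ee sX by simp_all

  \<comment> \<open>Upper left block: a Riccati equation for the reduced dynamics\<close>
  define A0 where "A0 = A - S * P0"
  have cA0: "corner n A0" unfolding A0_def by (intro corner_intros cA cS cP0)
  have A0: "f * (A0 * f) = Ac" "cconj A0 = A0" by (simp_all add: A0_def Ac_def A2_def ring_ds P0f real cP0)
  have sA0: "star A0 = star A - star P0 * S" by (simp add: A0_def sS)
  define R0 where "R0 = star A * P0 + star P0 * A - star P0 * S * P0 + W"
  have cR0: "corner n R0" unfolding R0_def by (intro corner_intros cA cS cP0 cW)
  have rR0: "cconj R0 = R0" by (simp add: R0_def real cP0)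
  have sR0: "star R0 = R0" by (simp add: R0_def sS mult.assoc)
  have R0f: "R0 * f = 0"
  proof -
    have "R0 * f = star A * X + W * f + star P0 * (A * f - S * X)"
      by (simp add: R0_def ring_ds P0f)
    also have "star P0 * (A * f - S * X) = star P0 * f * (A * f - S * X)" by (simp add: P0s)
    also have "\<dots> = star P0 * Ac" by (simp add: Ac_def A2_def ring_ds)
    also have "\<dots> = - (W * f + star A * X)" unfolding sP0 by (simp add: mult.assoc kr ring_ds Xr ee)
    finally show ?thesis by simp
  qed
  have fR0: "f * R0 = 0" using arg_cong[OF R0f, of star] sR0 ee by simp
  have eR0: "e * R0 = R0" "R0 * e = R0"
    using cR0 R0f fR0 by (simp_all add: corner_def ef[symmetric] ring_ds)

  \<comment> \<open>\<open>M\<close> and \<open>N\<close> choose algebraic components so that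
    \<open>f * A0 * M = 0\<close> and \<open>star N * A0 * f = 0\<close>. Then \<open>a\<close>, the
    Schur complement of the algebraic block in \<open>A0\<close>, satisfies
    \<open>A0 * M = a = star N * A0\<close>.\<close>
  define M N a where "M = e - k * (A0 * e)" and "N = e - star k * (star A0 * e)" and "a = e * (A0 * e) - e * (A0 * (k * (A0 * e)))"
  have MN: "e * M = e" "e * N = e" "N * e = N" "star N * e = e" "star M * e = e"
  proof -
    show "e * M = e" "e * N = e" "N * e = N" by (simp_all add: M_def N_def ring_ds ee kr)
    show "star N * e = e" "star M * e = e" by (simp_all add: M_def N_def ring_ds ee kr)
  qed
  have a: "e * a = a" "a * e = a" "cconj a = a" by (simp_all add: a_def ring_ds ee ee' A0 k)
  have A0M: "A0 * M = a"
  proof -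
    have "f * (A0 * (k * z)) = Ac * (k * z)" for z
      using A0(1)[THEN mult_assocD, of "k * z"] by (simp add: mult.assoc kr)
    then have "f * (A0 * M) = 0" by (simp add: M_def ring_ds kr ee)
    then have "A0 * M = e * (A0 * M)" using cA0 by (metis add.right_neutral corner_left' distrib_right ef)
    then show ?thesis by (simp add: M_def a_def ring_ds)
  qed
  have NA0: "star N * A0 = a"
  proof -
    have N: "star N = e - e * (A0 * k)" by (simp add: N_def ee mult.assoc)
    have "k * (A0 * f) = f"
    proof -
      have "k * (A0 * f) = k * (f * (A0 * f))" by (simp add: kr)
      then show ?thesis by (simp add: A0 kr)
    qed
    then have "star N * A0 * f = 0" by (simp add: N ring_ds kr)
    then have "star N * A0 = star N * A0 * e" using cA0
      by (metis add.right_neutral corner_right distrib_left ef mult.assoc)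
    then show ?thesis by (simp add: N a_def ring_ds)
  qed
  have NA0s: "star A0 * N = star a" using arg_cong[OF NA0, of star] by simp
  \<comment> \<open>In terms of \<open>A0\<close> the residual has the constant part
    \<open>star P0 * S * P0 + W\<close>. The two linear terms die under \<open>M\<close>, since
    \<open>A0 * M\<close> lies in the image of \<open>e\<close> and \<open>e * P0 = 0\<close>. This
    shows that \<open>R0\<close> is semidefinite.\<close>
  have R0M: "R0 = star M * (star P0 * S * P0 + W) * M"
  proof -
    have "star M * (star A0 * (P0 * M)) = star a * (e * (P0 * M))"
      using arg_cong[OF A0M, of star] a(1) ee by (metis mult.assoc star_times)
    then have 2: "star M * (star A0 * (P0 * M)) = 0" by (simp add: fP0[THEN mult_assocD])
    have 3: "star M * (star P0 * (A0 * M)) = 0" using arg_cong[OF 2, of star] by (simp add: mult.assoc)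
    have "R0 = star M * (R0 * M)"
      using eR0 MN by (metis mult.assoc)
    also have "\<dots> = star M * (star A0 * (P0 * M)) + star M * (star P0 * (A0 * M)) + star M * (star P0 * S * P0 + W) * M"
      by (simp add: R0_def A0_def sS ring_ds)
    finally show ?thesis using 2 3 by simp
  qed
  have psdPSP: "psdf (star P0 * S * P0 + W)" by (intro psdf_add psdf_conj psd)
  have psdR0: "psdf R0" unfolding R0M by (rule psdf_conj[OF psdPSP])

  interpret dyn: riccati_data r a "star N * S * N" R0
  proof
    show "corner r a" "corner r R0" using a eR0 by (simp_all add: corner_def e_def)
    have "e * star N = star N" using arg_cong[OF MN(3), of star] ee by simp
    then show "corner r (star N * S * N)" using MN unfolding corner_def e_def[symmetric]
      by (simp add: mult.assoc mult_assocD[of e "star N"])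
    show "psdf (star N * S * N)" by (rule psdf_conj[OF psd(1)])
    show "psdf R0" by (rule psdR0)
    fix lam y assume y: "0 \<le> Re lam" "prj 0 r * y = y"
    then have ey: "e * y = y" by (simp add: e_def)
    \<comment> \<open>As \<open>star A0 * N = star a\<close>, an uncontrollable unstable mode
      \<open>y\<close> of the reduced pair lifts to the mode \<open>N * y\<close> of the pencil.
      Detectability is lifted with \<open>M\<close> in the same way.\<close>
    show "y = 0" if "star a * y = scal lam y" "star N * S * N * y = 0"
    proof -
      have "star (N * y) * (S * (N * y)) = star y * (star N * S * N * y)" by (simp add: mult.assoc)
      then have SN: "S * (N * y) = 0" using that psdf_kernel'[OF psd(1)] by simp
      have eNy: "e * (N * y) = y" using MN(2)[THEN mult_assocD] ey by simp
      have "star A * (N * y) = star A0 * (N * y) + star P0 * (S * (N * y))" by (simp add: sA0 ring_ds)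
      also have "\<dots> = star a * y" using SN NA0s[THEN mult_assocD] by simp
      finally have "star A * (N * y) = scal lam (e * (N * y))" using that eNy by simp
      moreover have "prj 0 n * (N * y) = N * y"
      proof -
        have "prj 0 n * N = N" unfolding ef[symmetric] by (simp add: N_def ring_ds ee kr)
        then show ?thesis by (rule mult_assocD)
      qed
      ultimately have "N * y = 0" using st(1)[OF y(1)] SN by blast
      then show ?thesis using eNy by simp
    qed
    show "y = 0" if "a * y = scal lam y" "R0 * y = 0"
    proof -
      define v where "v = M * y"
      have "star v * ((star P0 * S * P0 + W) * v) = star y * (R0 * y)" unfolding R0M v_def by (simp add: mult.assoc)
      then have 0: "star v * (star P0 * S * P0 + W) * v = 0" using that by (simp add: mult.assoc)
      have "Re (tr (star (P0 * v) * (S * (P0 * v)))) + Re (tr (star v * (W * v))) = 0"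
        using arg_cong[OF 0, of "\<lambda>x. Re (tr x)"] by (simp add: ring_ds)
      then have z: "Re (tr (star (P0 * v) * (S * (P0 * v)))) = 0" "Re (tr (star v * (W * v))) = 0"
        using psdf_nonneg[OF psd(1), of "P0 * v"] psdf_nonneg[OF psd(2), of v] by linarith+
      note z = psdf_kernel[OF psd(1) z(1)] psdf_kernel[OF psd(2) z(2)]
      have ev: "e * v = y" using MN(1)[THEN mult_assocD] ey by (simp add: v_def)
      have "A * v = A0 * v + S * (P0 * v)" by (simp add: A0_def ring_ds)
      also have "\<dots> = scal lam (e * v)" using z that ev A0M[THEN mult_assocD] by (simp add: v_def)
      finally have "A * v = scal lam (e * v)" .
      moreover have "prj 0 n * v = v"
      proof -
        have "prj 0 n * M = M" unfolding ef[symmetric] by (simp add: M_def ring_ds ee kr)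
        then show ?thesis unfolding v_def by (rule mult_assocD)
      qed
      ultimately have "v = 0" using dt(1)[OF y(1)] z by blast
      then show ?thesis using ev by simp
    qed
  qed
  have rN: "cconj N = N" by (simp add: N_def ee ks A0 k)
  obtain p where p: "corner r p" "psdf p" "cconj p = p"
    and pe: "star a * p + p * a - p * (star N * S * N) * p + R0 = 0"
    by (rule dyn.riccati_real_psd_solution) (simp_all add: a real rN rR0)
  have sp: "star p = p" using p psdf_star by blast
  have ep: "e * p = p" "p * e = p" using p by (simp_all add: corner_def e_def)
  \<comment> \<open>The term \<open>N * p\<close> inserts \<open>p\<close> as upper left block
    together with the correction of the lower left block that keeps the \<open>f\<close> rows
    solved.\<close>
  define P where "P = P0 + N * p"
  have eP: "e * P = p" using MN(2)[THEN mult_assocD] by (simp add: P_def distrib_left fP0 ep)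
  have Pf: "P * f = X"
  proof -
    have "p * f = 0" using ep ee by (metis mult.assoc mult_zero_right)
    then show ?thesis by (simp add: P_def distrib_right P0f mult.assoc)
  qed
  show thesis
  proof (rule that[of P])
    show "corner n P" 
    proof -
      have "corner n k" unfolding k_def using t cf by (intro corner_times) (auto simp: corner_def)
      then show ?thesis unfolding P_def N_def using rq by (intro corner_intros cP0 cf cA0 corner_mono[OF p(1)]) auto
    qed
    show "cconj P = P" by (simp add: P_def cP0 rN p)
    show "psdf (prj 0 r * P)" using eP p by (simp add: e_def)
    show "prj r n * (P * prj r n) = P * prj r n" "psdf (P * prj r n)"
      unfolding f_def[symmetric] Pf by (simp_all add: Xf X)
    have "star A * P + star P * A - star P * S * P + W =
        R0 + star A0 * N * p + p * (star N * A0) - p * (star N * S * N) * p"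
      by (simp add: P_def R0_def A0_def sS sp ring_ds)
    also have "\<dots> = 0" using pe by (simp add: NA0 NA0s algebra_simps)
    finally show "gare A S W P" unfolding gare_def .
  qed
qed

section \<open>Stabilizing solutions\<close>

text \<open>Blockwise, a product of two semidefinite matrices has no eigenvalue -1: from
  \<open>u = - Y X u\<close> the \<open>X\<close>-energy of \<open>u\<close> is minus the
  \<open>Y\<close>-energy of \<open>X * u\<close>, so both vanish. Triangularity isolates the
  algebraic component first; with it gone, the same argument applies to the symmetric blocks
  \<open>e * P\<close> and \<open>e * G\<close>.\<close>

lemma reduced_pair_injective:
  assumes rn: "r \<le> n"
    and P: "corner n P" "psdf (prj 0 r * P)" "prj r n * (P * prj r n) = P * prj r n" "psdf (P * prj r n)"
    and G: "corner n G" "psdf (prj 0 r * G)" "prj r n * (G * prj r n) = G * prj r n" "psdf (G * prj r n)"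
    and w: "prj 0 n * w = w" "w + star G * (star P * w) = 0"
  shows "w = 0"
proof -
  define e f where "e = prj 0 r" and "f = prj r n"
  have ef: "e + f = prj 0 n" unfolding e_def f_def using rn by (simp add: prj_split[symmetric])
  have ee: "e * e = e" "f * f = f" "star e = e" "star f = f"
    by (simp_all add: e_def f_def)
  define X Y where "X = P * f" and "Y = G * f"
  have X12: "psdf X" "f * X = X" and Y12: "psdf Y" "f * Y = Y"
    using P G by (simp_all add: X_def Y_def f_def)
  note X = X12 psdf_star[OF X12(1)] and Y = Y12 psdf_star[OF Y12(1)]
  have fP: "f * star P = X" and fG: "f * star G = Y"
    using X(3) Y(3) ee by (simp_all add: X_def Y_def)
  have Xf: "X * f = X" and Yf: "Y * f = Y"
    using arg_cong[OF X(2), of star] arg_cong[OF Y(2), of star] X(3) Y(3) ee by simp_all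
  define u where "u = f * w"
  have "f * (w + star G * (star P * w)) = 0" using w by simp
  then have "u + Y * (star P * w) = 0" by (simp add: distrib_left u_def fG[THEN mult_assocD])
  moreover have "Y * (star P * w) = Y * (X * u)"
  proof -
    have "Y * (star P * w) = Y * (f * (star P * w))" by (simp add: Yf[THEN mult_assocD])
    also have "f * (star P * w) = X * u" by (simp add: u_def fP[THEN mult_assocD] Xf[THEN mult_assocD])
    finally show ?thesis .
  qed
  ultimately have u: "u = - (Y * (X * u))" by (simp add: eq_neg_iff_add_eq_0)
  have "star u * (X * u) = - (star (X * u) * (Y * (X * u)))"
    by (subst (2) u) (simp add: X mult.assoc)
  from arg_cong[OF this, of "\<lambda>x. Re (tr x)"]
  have "Re (tr (star u * (X * u))) = - Re (tr (star (X * u) * (Y * (X * u))))"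
    by (simp only: tr_uminus uminus_complex.sel)
  then have "Re (tr (star u * (X * u))) = 0"
    using psdf_nonneg[OF X(1), of u] psdf_nonneg[OF Y(1), of "X * u"] by linarith
  then have "X * u = 0" by (rule psdf_kernel[OF X(1)])
  then have "u = 0" using u by simp
  then have ew: "e * w = w" using w(1) by (simp add: ef[symmetric] distrib_right u_def)
  define h where "h = P * w"
  have sP: "star P * e = e * P" and sG: "star G * e = e * G"
    using P(2) G(2) psdf_star[of "e * P"] psdf_star[of "e * G"] ee by (simp_all add: e_def)
  have "star P * w = e * h" using sP[THEN mult_assocD, of w] by (simp add: ew h_def mult.assoc)
  then have wh: "w = - (e * G * h)" using w(2) sG[THEN mult_assocD, of h] by (simp add: eq_neg_iff_add_eq_0)
  have we: "star w * e = star w" using arg_cong[OF ew, of star] ee by simp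
  have swh: "star w = - (star h * (e * G))" 
    using arg_cong[OF wh, of star] psdf_star[of "e * G"] G(2) by (simp add: e_def)
  have "star w * (e * P * w) = star w * h" by (simp add: mult.assoc we[THEN mult_assocD] h_def)
  also have "\<dots> = - (star h * (e * G * h))" unfolding swh by (simp add: mult.assoc)
  finally have "star w * (e * P * w) = - (star h * (e * G * h))" .
  from arg_cong[OF this, of "\<lambda>x. Re (tr x)"]
  have "Re (tr (star w * (e * P * w))) = - Re (tr (star h * (e * G * h)))"
    by (simp only: tr_uminus uminus_complex.sel)
  then have "Re (tr (star h * (e * G * h))) = 0"
    using psdf_nonneg[OF P(2), of w] psdf_nonneg[OF G(2), of h] by (simp add: e_def)
  then have "e * G * h = 0" using psdf_kernel[OF G(2)] by (simp add: e_def)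
  then show ?thesis using wh by simp
qed

text \<open>One pair \<open>U\<close>, \<open>V\<close> reduces both equations, the dual one through
  \<open>star V\<close> and \<open>star U\<close>; only so can the blocks of the two solutions be
  compared.\<close>

theorem gare_pair_exists:
  assumes c: "corner n E" "corner n A" "corner n S1" "corner n W1" "corner n S2" "corner n W2"
    and psd: "psdf S1" "psdf W1" "psdf S2" "psdf W2"
    and real: "cconj E = E" "cconj A = A" "cconj S1 = S1" "cconj W1 = W1" "cconj S2 = S2" "cconj W2 = W2"
    and adm: "adm n E A S1" "adm n (star E) (star A) W1" "adm n (star E) (star A) S2" "adm n E A W2"
  obtains P G where "corner n P" "cconj P = P" "psdf (star E * P)" "gare A S1 W1 P"
    "corner n G" "cconj G = G" "psdf (E * G)" "gare (star A) S2 W2 G"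
    "\<And>w. prj 0 n * w = w \<Longrightarrow> w + star G * (star P * w) = 0 \<Longrightarrow> w = 0"
proof -
  obtain u u' v v' r where uv: "inv_pair 0 n u u'" "inv_pair 0 n v v'" "r \<le> n" "u * E * v = prj 0 r"
    using rank_normal_form[of 0 n E] c real by (auto simp: corner_def)
  define e f where "e = prj 0 r" and "f = prj r n"
  have ef: "e + f = prj 0 n" unfolding e_def f_def using uv(3) by (simp add: prj_split[symmetric])
  have ee: "e * e = e" "f * f = f" "e * f = 0" "f * e = 0" "star e = e" "star f = f" "cconj e = e" "cconj f = f"
    by (simp_all add: e_def f_def prj_inter prj_empty)
  note ee' = ee(1-4)[THEN mult_assocD]
  have "\<exists>u2 u2' v2 v2' q. inv_pair r n u2 u2' \<and> inv_pair r n v2 v2' \<and> r \<le> q \<and> q \<le> n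
      \<and> u2 * (f * (u * A * v * f)) * v2 = prj r q"
    by (rule rank_normal_form) (use uv real ee in \<open>simp_all add: f_def mult.assoc inv_pair_def\<close>)
  then obtain u2 u2' v2 v2' q where uv2: "inv_pair r n u2 u2'" "inv_pair r n v2 v2'" "r \<le> q" "q \<le> n"
    "u2 * (f * (u * A * v * f)) * v2 = prj r q" by blast
  note i2 = uv2(1,2)[unfolded inv_pair_def, folded f_def]
  have z2: "e * u2 = 0" "u2 * e = 0" "e * u2' = 0" "u2' * e = 0" "e * v2 = 0" "v2 * e = 0" "e * v2' = 0" "v2' * e = 0"
    using i2 ee by (metis mult.assoc mult_zero_left mult_zero_right)+
  \<comment> \<open>The minus sign turns the algebraic block into \<open>- prj r q\<close>, while
    \<open>e\<close> keeps the normal form of \<open>E\<close>.\<close>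
  have p1: "inv_pair 0 n (e - u2) (e - u2')" and p2: "inv_pair 0 n (e + v2) (e + v2')"
    unfolding inv_pair_def ef[symmetric] using i2 z2 ee by (simp_all add: ring_ds)
  define U U' V V' where "U = (e - u2) * u" and "U' = u' * (e - u2')"
    and "V = v * (e + v2)" and "V' = (e + v2') * v'"
  have U: "inv_pair 0 n U U'" and V: "inv_pair 0 n V V'"
    unfolding U_def U'_def V_def V'_def by (intro inv_pair_mult p1 p2 uv)+
  note Ui = U[unfolded inv_pair_def] and Vi = V[unfolded inv_pair_def]
  have UEV: "U * E * V = e"
  proof -
    have "U * E * V = (e - u2) * (u * E * v) * (e + v2)" by (simp add: U_def V_def mult.assoc)
    also have "\<dots> = (e - u2) * e * (e + v2)" unfolding uv(4) e_def ..
    also have "\<dots> = e" using z2 ee by (simp add: ring_ds)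
    finally show ?thesis .
  qed
  define A0 where "A0 = U * A * V"
  have A22: "f * (A0 * f) = - prj r q"
  proof -
    have 1: "f * (e - u2) = - u2" "(e + v2) * f = v2" using i2 ee by (simp_all add: ring_ds)
    have "f * (A0 * f) = (f * (e - u2)) * (u * A * v) * ((e + v2) * f)" by (simp add: A0_def U_def V_def mult.assoc)
    also have "\<dots> = - ((u2 * f) * (u * A * v) * (f * v2))" unfolding 1 using i2 by simp
    also have "\<dots> = - prj r q" using uv2(5) by (simp add: mult.assoc)
    finally show ?thesis .
  qed
  have A22s: "f * (star A0 * f) = - prj r q" using arg_cong[OF A22, of star] ee by (simp add: mult.assoc)
  have cU: "corner n U" "corner n V" "corner n U'" "corner n V'" using U V by (simp_all add: inv_pair_def corner_def)
  have cA0: "corner n A0" unfolding A0_def by (intro corner_intros cU c)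
  have rA0: "cconj A0 = A0" using Ui Vi real by (simp add: A0_def)
  have sU: "inv_pair 0 n (star U) (star U')" and sV: "inv_pair 0 n (star V) (star V')"
    using U V inv_pair_star by blast+
  have sEV: "star V * star E * star U = e" and sAV: "star V * star A * star U = star A0"
    using arg_cong[OF UEV, of star] ee by (simp_all add: A0_def mult.assoc)
  have a1: "adm n e A0 (U * S1 * star U)" and a4: "adm n e A0 (U * W2 * star U)"
    using adm_transform[OF U V c(1,2)] c adm unfolding UEV A0_def[symmetric] by blast+
  have a2: "adm n e (star A0) (star V * W1 * V)" and a3: "adm n e (star A0) (star V * S2 * V)"
    using adm_transform[OF sV sU corner_star[OF c(1)] corner_star[OF c(2)]] c adm unfolding sEV sAV star_star by blast+
  obtain P0 where P0: "corner n P0" "cconj P0 = P0" "psdf (e * P0)" "gare A0 (U * S1 * star U) (star V * W1 * V) P0"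
    "f * (P0 * f) = P0 * f" "psdf (P0 * f)"
  proof (rule reduced_gare[OF uv2(3,4) cA0, of "U * S1 * star U" "star V * W1 * V"])
    show "psdf (U * S1 * star U)" "psdf (star V * W1 * V)"
      using psdf_conj[OF psd(1), of "star U"] psdf_conj[OF psd(2), of V] by simp_all
  qed (use cU c Ui Vi real rA0 A22 a1 a2 in \<open>auto simp: e_def f_def intro!: corner_intros\<close>)
  obtain G0 where G0: "corner n G0" "cconj G0 = G0" "psdf (e * G0)" "gare (star A0) (star V * S2 * V) (U * W2 * star U) G0"
    "f * (G0 * f) = G0 * f" "psdf (G0 * f)"
  proof (rule reduced_gare[OF uv2(3,4) corner_star[OF cA0], of "star V * S2 * V" "U * W2 * star U"])
    show "psdf (U * W2 * star U)" "psdf (star V * S2 * V)"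
      using psdf_conj[OF psd(4), of "star U"] psdf_conj[OF psd(3), of V] by simp_all
  qed (use cU c Ui Vi real rA0 A22s a3 a4 in \<open>auto simp: e_def f_def intro!: corner_intros\<close>)
  define P G where "P = star U * P0 * V'" and "G = V * G0 * star U'"
  have uu: "star U' * star U = prj 0 n" "star U * star U' = prj 0 n" "star V * star V' = prj 0 n" "star V' * star V = prj 0 n"
    using sU sV by (simp_all add: inv_pair_def)
  have E: "E = U' * e * V'"
    unfolding UEV[symmetric] using Ui Vi c by (simp add: mult.assoc corner_simps mult_assocD[of U' U])
  show thesis
  proof (rule that[of P G])
    show "corner n P" "corner n G" unfolding P_def G_def by (intro corner_intros cU P0 G0)+
    show "cconj P = P" "cconj G = G" using P0 G0 Ui Vi by (simp_all add: P_def G_def)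
    have "star E * P = star V' * (e * P0) * V'"
      using P0(1) by (simp add: E P_def ee mult.assoc uu[THEN mult_assocD] corner_simps)
    then show "psdf (star E * P)" using psdf_conj[OF P0(3)] by simp
    have "E * G = U' * (e * G0) * star U'"
      using G0(1) Vi by (simp add: E G_def mult.assoc mult_assocD[of V' V] corner_simps)
    then show "psdf (E * G)" using psdf_conj[OF G0(3), of "star U'"] by simp
    show "gare A S1 W1 P" unfolding P_def
      by (rule gare_transform[OF U V c(2,4)]) (use P0(4) in \<open>simp add: A0_def\<close>)
    have "gare (star A) S2 W2 (star (star V) * G0 * star U')"
      by (rule gare_transform[OF sV sU corner_star[OF c(2)] c(6)]) (use G0(4) in \<open>simp add: sAV\<close>)
    then show "gare (star A) S2 W2 G" by (simp add: G_def)
    fix w assume w: "prj 0 n * w = w" "w + star G * (star P * w) = 0"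
    \<comment> \<open>The factors \<open>star V\<close> and \<open>star V'\<close> cancel in the
      middle, so the product of the two solutions is merely conjugated by \<open>U\<close>.\<close>
    have "star G * (star P * w) = U' * (star G0 * (star P0 * (U * w)))"
      using P0(1) by (simp add: P_def G_def mult.assoc uu[THEN mult_assocD] corner_simps corner_star)
    then have "U * (w + U' * (star G0 * (star P0 * (U * w)))) = 0" using w by simp
    then have "U * w + star G0 * (star P0 * (U * w)) = 0"
      using Ui G0(1) by (simp add: distrib_left mult_assocD[of U U'] corner_simps corner_star)
    moreover have "prj 0 n * (U * w) = U * w" using cU by (simp add: corner_simps)
    ultimately have "U * w = 0"
      using reduced_pair_injective[OF uv(3), of P0 G0 "U * w"] P0 G0 unfolding e_def f_def by blast
    then show "w = 0" using inv_pair_cancel[OF U w(1)] by simp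
  qed
qed

text \<open>The Weierstrass form with \<open>N = 0\<close>: \<open>L\<close> and \<open>T\<close>
  are its left and right transformations and \<open>w\<close> is the finite part.\<close>

definition index_one_form :: "nat \<Rightarrow> fmat \<Rightarrow> fmat \<Rightarrow> fmat \<Rightarrow> fmat \<Rightarrow> fmat \<Rightarrow> fmat \<Rightarrow> nat \<Rightarrow> fmat \<Rightarrow> bool" where
  "index_one_form n E A L L' T T' k w \<longleftrightarrow> inv_pair 0 n L L' \<and> inv_pair 0 n T T' \<and> k \<le> n \<and> corner k w \<and> cconj w = w \<and>
     E * T = L * prj 0 k \<and> A * T = L * (w + prj k n)"

text \<open>Regularity is implicit: 1 is not a finite eigenvalue, hence \<open>E - A\<close> is
  injective on the corner.\<close>

definition stable_f :: "nat \<Rightarrow> fmat \<Rightarrow> fmat \<Rightarrow> bool" where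
  "stable_f n E A \<longleftrightarrow> (\<exists>L L' T T' k w. index_one_form n E A L L' T T' k w) \<and>
     (\<forall>lam v. prj 0 n * v = v \<longrightarrow> A * v = scal lam (E * v) \<longrightarrow> v \<noteq> 0 \<longrightarrow> Re lam < 0)"

text \<open>The hypothesis \<open>inj\<close> excludes chains of length two at infinity. After
  reducing \<open>E\<close> it says that the algebraic block of \<open>B = U * A * V\<close> is
  invertible, and eliminating with this block gives the form.\<close>

lemma weierstrass_index_one:
  assumes c: "corner n E" "corner n A" and real: "cconj E = E" "cconj A = A"
    and inj: "\<And>v z. prj 0 n * v = v \<Longrightarrow> E * v = 0 \<Longrightarrow> A * v = E * z \<Longrightarrow> v = 0"
  shows "\<exists>L L' T T' k w. index_one_form n E A L L' T T' k w"
proof -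
  obtain U U' V V' r where uv: "inv_pair 0 n U U'" "inv_pair 0 n V V'" "r \<le> n" "U * E * V = prj 0 r"
    using rank_normal_form[of 0 n E] c real by (auto simp: corner_def)
  note Ui = uv(1)[unfolded inv_pair_def] and Vi = uv(2)[unfolded inv_pair_def]
  define e f where "e = prj 0 r" and "f = prj r n"
  have ef: "e + f = prj 0 n" unfolding e_def f_def using uv(3) by (simp add: prj_split[symmetric])
  have ee: "e * e = e" "f * f = f" "e * f = 0" "f * e = 0" "star e = e" "star f = f" "cconj e = e" "cconj f = f"
    by (simp_all add: e_def f_def prj_inter prj_empty)
  note ee' = ee(1-4)[THEN mult_assocD]
  define B where "B = U * A * V"
  have cU: "corner n U" "corner n V" "corner n U'" "corner n V'" "corner n e" "corner n f"
    using uv(1,2) uv(3) by (auto simp: inv_pair_def corner_def[of _ U] corner_def[of _ V] corner_def[of _ U'] corner_def[of _ V'] e_def f_def intro: corner_prj)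
  have cB: "corner n B" unfolding B_def by (intro corner_intros cU c)
  have rB: "cconj B = B" using Ui Vi real by (simp add: B_def)
  have EV: "E * V = U' * e" and AV: "A * V = U' * B"
  proof -
    have "U' * (U * E * V) = E * V" "U' * (U * A * V) = A * V" using Ui c by (simp_all add: mult.assoc mult_assocD[of U' U] corner_simps)
    then show "E * V = U' * e" "A * V = U' * B" unfolding uv(4) e_def[symmetric] B_def[symmetric] by simp_all
  qed
  have "v = 0" if v: "prj 0 n * v = v" "(e + f * (B * f)) * v = 0" for v
  proof -
    have "e * ((e + f * (B * f)) * v) = 0" using v by simp
    then have ev: "e * v = 0" by (simp add: ring_ds ee ee')
    then have fv: "f * v = v" using v(1) by (simp add: ef[symmetric] distrib_right)
    have fBv: "f * (B * v) = 0" using v ev fv by (simp add: ring_ds)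
    then have Bv: "B * v = e * (B * v)" using cB
      by (metis add.right_neutral corner_left' distrib_right ef)
    have "E * (V * v) = 0" using EV[THEN mult_assocD, of v] ev by (simp add: mult.assoc)
    moreover have "A * (V * v) = E * (V * (B * v))"
      using AV[THEN mult_assocD, of v] EV[THEN mult_assocD, of "B * v"] Bv by (simp add: mult.assoc)
    ultimately have "V * v = 0" using inj[of "V * v"] cU by (simp add: corner_simps)
    then show "v = 0" using inv_pair_cancel[OF uv(2) v(1)] by simp
  qed
  then obtain t where t: "(e + f * (B * f)) * t = prj 0 n" "t * (e + f * (B * f)) = prj 0 n"
    "cconj (e + f * (B * f)) = e + f * (B * f) \<Longrightarrow> cconj t = t" "prj 0 n * t = t" "t * prj 0 n = t"
    using inj_imp_inverse[of n "e + f * (B * f)"] cU cB by (metis corner_add corner_left corner_right corner_times)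
  define k where "k = f * (t * f)"
  have k: "f * k = k" "k * f = k" "e * k = 0" "k * e = 0" "f * (B * k) = f" "k * (B * f) = f" "cconj k = k"
  proof -
    show "f * k = k" "k * f = k" "e * k = 0" "k * e = 0" by (simp_all add: k_def mult.assoc ee ee')
    show "cconj k = k" using t(3) rB ee by (simp add: k_def)
    have "f * ((e + f * (B * f)) * t) * f = f * (e + f) * f" by (simp only: t ef)
    then show "f * (B * k) = f" by (simp add: ring_ds ee ee' k_def)
    have "f * (t * (e + f * (B * f))) * f = f * (e + f) * f" by (simp only: t ef)
    then show "k * (B * f) = f" by (simp add: ring_ds ee ee' k_def)
  qed
  note kr = k(1-6) k(1-6)[THEN mult_assocD, unfolded mult.assoc]
  \<comment> \<open>As \<open>k\<close> inverts the algebraic block, \<open>M\<close> annihilates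
    the \<open>f\<close> rows of \<open>B\<close>, and the Schur complement \<open>a\<close> is the
    finite part.\<close>
  define M a where "M = e - k * (B * e)" and "a = e * (B * e) - e * (B * (k * (B * e)))"
  have a: "e * a = a" "a * e = a" "f * a = 0" "cconj a = a" by (simp_all add: a_def ring_ds ee ee' rB k)
  have BM: "B * M = a"
  proof -
    have "B * M = (e + f) * (B * M)" unfolding ef using cB by (simp add: corner_simps)
    also have "\<dots> = a" by (simp add: M_def a_def ring_ds kr ee ee')
    finally show ?thesis .
  qed
  have i1: "inv_pair 0 n (M + f) (prj 0 n + k * (B * e))"
    unfolding inv_pair_def ef[symmetric] M_def by (simp add: ring_ds ee ee' kr rB k(7))
  have i2: "inv_pair 0 n (e + B * f) (e + k - e * (B * k))"
  proof -
    have Bf: "B * f = e * (B * f) + f * (B * f)" unfolding distrib_right[symmetric] ef using cB by (simp add: corner_simps)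
    have "B * k = (e + f) * (B * k)" unfolding ef using cB by (simp add: corner_simps)
    then have "B * k = e * (B * k) + f" by (simp add: distrib_right kr)
    then have Bk: "B * k - e * (B * k) = f" by (metis add_diff_cancel_left')
    have "(e + B * f) * (e + k - e * (B * k)) = e + f"
      using Bk by (simp add: ring_ds ee ee' kr)
    moreover have "(e + k - e * (B * k)) * (e + B * f) = e + f"
      by (subst Bf) (simp add: ring_ds ee ee' kr)
    moreover have "(e + f) * (e + B * f) = e + B * f" by (simp add: ef distrib_left) (use cB cU in \<open>simp add: corner_simps\<close>)
    ultimately show ?thesis unfolding inv_pair_def ef[symmetric] by (simp add: ring_ds ee ee' kr rB k(7))
  qed
  have "index_one_form n E A (U' * (e + B * f)) ((e + k - e * (B * k)) * U) (V * (M + f)) ((prj 0 n + k * (B * e)) * V') r a"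
    unfolding index_one_form_def
  proof (intro conjI)
    show "inv_pair 0 n (U' * (e + B * f)) ((e + k - e * (B * k)) * U)"
      by (rule inv_pair_mult[OF inv_pair_sym[OF uv(1)] i2])
    show "inv_pair 0 n (V * (M + f)) ((prj 0 n + k * (B * e)) * V')"
      by (rule inv_pair_mult[OF uv(2) i1])
    show "corner r a" using a by (simp add: corner_def e_def)
    have "E * (V * (M + f)) = U' * (e * (M + f))" using EV[THEN mult_assocD] by (simp add: mult.assoc)
    also have "e * (M + f) = e" by (simp add: M_def ring_ds ee kr)
    finally show "E * (V * (M + f)) = U' * (e + B * f) * prj 0 r" by (simp add: e_def[symmetric] ring_ds ee)
    have "A * (V * (M + f)) = U' * (B * (M + f))" using AV[THEN mult_assocD] by (simp add: mult.assoc)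
    also have "B * (M + f) = (e + B * f) * (a + f)" by (simp add: ring_ds BM a ee)
    finally show "A * (V * (M + f)) = U' * (e + B * f) * (a + prj r n)" by (simp add: f_def[symmetric] mult.assoc)
  qed (use uv a in auto)
  then show ?thesis by blast
qed

text \<open>\<open>T\<close> maps eigenvectors of the finite part \<open>w\<close> to finite
  eigenvectors of the pencil.\<close>

lemma index_one_form_hurwitz:
  assumes c: "corner n E" "corner n A" and w: "index_one_form n E A L L' T T' k w"
    and ev: "\<And>lam v. prj 0 n * v = v \<Longrightarrow> A * v = scal lam (E * v) \<Longrightarrow> v \<noteq> 0 \<Longrightarrow> Re lam < 0"
  shows "hurwitz k w"
  unfolding hurwitz_def
proof (intro allI impI)
  fix lam x assume x: "prj 0 k * x = x" "w * x = scal lam x" "x \<noteq> 0"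
  note W = w[unfolded index_one_form_def]
  have T: "inv_pair 0 n T T'" and kn: "k \<le> n" using W by blast+
  have px: "prj 0 n * x = x" by (rule prj_vec_mono[OF x(1) kn])
  have kx: "prj k n * x = 0"
    using arg_cong[OF x(1), of "\<lambda>v. prj k n * v"] by (simp add: prj_inter[THEN mult_assocD] prj_empty)
  have ET: "E * (T * x) = L * x" using W x(1) mult_assocD[of E T "L * prj 0 k" x] by (simp add: mult.assoc)
  have AT: "A * (T * x) = L * (w * x)" using W kx mult_assocD[of A T "L * (w + prj k n)" x]
    by (simp add: mult.assoc distrib_right)
  show "Re lam < 0"
  proof (rule ev[of "T * x"])
    show "prj 0 n * (T * x) = T * x" using T by (simp add: inv_pair_def mult_assocD[of "prj 0 n"])
    show "A * (T * x) = scal lam (E * (T * x))" using ET AT x(2) by simp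
    show "T * x \<noteq> 0" using inv_pair_cancel[OF T px] x(3) by blast
  qed
qed

text \<open>Transposition exchanges the roles of \<open>L\<close> and \<open>T\<close> and replaces
  \<open>w\<close> by its adjoint. It turns the closed loop of the dual equation into the pencil
  required for (GF).\<close>

lemma stable_f_star:
  assumes c: "corner n E" "corner n A" and s: "stable_f n E A"
  shows "stable_f n (star E) (star A)"
proof -
  obtain L L' T T' k w where w: "index_one_form n E A L L' T T' k w" using s by (auto simp: stable_f_def)
  have hz: "hurwitz k w" by (rule index_one_form_hurwitz[OF c w]) (use s in \<open>auto simp: stable_f_def\<close>)
  note W = w[unfolded index_one_form_def]
  have L: "inv_pair 0 n L L'" and T: "inv_pair 0 n T T'" and kn: "k \<le> n" and cw: "corner k w" and rw: "cconj w = w" using W by blast+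
  note Li = L[unfolded inv_pair_def] and Ti = T[unfolded inv_pair_def]
  have sL: "inv_pair 0 n (star L) (star L')" and sT: "inv_pair 0 n (star T) (star T')" using L T inv_pair_star by blast+
  have E: "E = L * prj 0 k * T'" and A: "A = L * (w + prj k n) * T'"
  proof -
    have "E * T * T' = E" "A * T * T' = A" using Ti c by (simp_all add: mult.assoc corner_simps)
    then show "E = L * prj 0 k * T'" "A = L * (w + prj k n) * T'" using W by simp_all
  qed
  have ll: "star L * star L' = prj 0 n" using sL by (simp add: inv_pair_def)
  have kk: "prj 0 k * prj 0 n = prj 0 k" "prj k n * prj 0 n = prj k n" using kn by (simp_all add: prj_inter)
  have cwn: "corner n (star w)" by (rule corner_mono[OF corner_star[OF cw] kn])
  have sE: "star E * star L' = star T' * prj 0 k" unfolding E by (simp add: mult.assoc ll kk)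
  have sA: "star A * star L' = star T' * (star w + prj k n)" unfolding A
    using cwn by (simp add: mult.assoc ll kk distrib_right distrib_left corner_simps)
  have w': "index_one_form n (star E) (star A) (star T') (star T) (star L') (star L) k (star w)"
    unfolding index_one_form_def using inv_pair_sym[OF sL] inv_pair_sym[OF sT] kn corner_star[OF cw] rw sE sA by simp
  moreover have "Re lam < 0" if v: "prj 0 n * v = v" "star A * v = scal lam (star E * v)" "v \<noteq> 0" for lam v
  proof -
    define x where "x = star L * v"
    have px: "prj 0 n * x = x" using Li by (metis x_def mult.assoc star_prj star_times)
    have "x \<noteq> 0" using inv_pair_cancel[OF sL v(1)] v(3) by (auto simp: x_def)
    have cancel: "y = z" if "star T' * y = star T' * z" "prj 0 n * y = y" "prj 0 n * z = z" for y z
      using inv_pair_cancel[OF sT[THEN inv_pair_sym], of "y - z"] that by (simp add: right_diff_distrib)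
    have nk: "prj 0 n * prj 0 k = prj 0 k" "prj 0 n * prj k n = prj k n" using kn by (simp_all add: prj_inter)
    have eq: "star w * x + prj k n * x = scal lam (prj 0 k * x)"
    proof (rule cancel)
      show "star T' * (star w * x + prj k n * x) = star T' * scal lam (prj 0 k * x)"
        using v(2) unfolding E A by (simp add: x_def mult.assoc distrib_left distrib_right)
    qed (use cwn in \<open>simp_all add: distrib_left corner_simps nk[THEN mult_assocD]\<close>)
    have z: "prj k n * prj 0 k = 0" "prj 0 k * prj k n = 0" using kn by (simp_all add: prj_inter prj_empty)
    have "prj k n * (star w * x) = 0"
      using corner_left'[OF corner_star[OF cw], of x] z(1)[THEN mult_assocD, of "star w * x"] by simp
    then have kx: "prj k n * x = 0"
      using arg_cong[OF eq, of "\<lambda>v. prj k n * v"] z by (simp add: distrib_left z[THEN mult_assocD])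
    then have ex: "prj 0 k * x = x" using px prj_split[of 0 k n] kn by (simp add: distrib_right)
    have "star w * x = scal lam x" using eq kx ex by simp
    then show ?thesis using hurwitz_star[OF cw hz] ex \<open>x \<noteq> 0\<close> by (auto simp: hurwitz_def)
  qed
  ultimately show ?thesis unfolding stable_f_def by blast
qed

text \<open>The Lyapunov argument is used twice: a finite unstable mode, and also a chain of length
  two at infinity (where the pairing is 0 because \<open>E * v = 0\<close>), satisfies the sign
  condition of \<open>psd_solution_kernel\<close>. It is then a forbidden mode of the open loop
  invisible to \<open>W\<close>.\<close>

lemma stable_f_of_psd:
  assumes c: "corner n E" "corner n A" "corner n S" "corner n P" and real: "cconj E = E" "cconj A = A" "cconj S = S" "cconj P = P"
    and psd: "psdf S" "psdf W" "psdf (star E * P)" and g: "gare A S W P"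
    and adm: "adm n (star E) (star A) W"
  shows "stable_f n E (A - S * P)"
proof -
  note g' = g[unfolded gare_def]
  have sEP: "star P * E = star E * P" using psdf_star[OF psd(3)] by simp
  have cl: "corner n (A - S * P)" by (intro corner_intros c)
  have "\<exists>L L' T T' k w. index_one_form n E (A - S * P) L L' T T' k w"
  proof (rule weierstrass_index_one[OF c(1) cl])
    fix v z assume v: "prj 0 n * v = v" "E * v = 0" "(A - S * P) * v = E * z"
    have "star v * (star P * ((A - S * P) * v)) = star (E * v) * (P * z)"
      unfolding v(3) using sEP[THEN mult_assocD, of z] by (simp add: mult.assoc)
    then have "0 \<le> Re (tr (star v * (star P * ((A - S * P) * v))))" using v by simp
    note ker = psd_solution_kernel[OF g' psd(1,2) this]
    have "A * v = E * z" using v(3) ker by (simp add: left_diff_distrib mult.assoc)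
    then show "v = 0" using adm2[OF adm v(1), of z] v(2) ker by simp
  qed (simp_all add: real)
  moreover have "Re lam < 0" if v: "prj 0 n * v = v" "(A - S * P) * v = scal lam (E * v)" "v \<noteq> 0" for lam v
  proof (rule ccontr)
    assume "\<not> Re lam < 0"
    then have lam: "0 \<le> Re lam" by simp
    have "Im (tr (star v * (star E * P * v))) = 0"
    proof (rule real_scalar)
      show "cnj (tr (star v * (star E * P * v))) = tr (star v * (star E * P * v))"
        by (simp flip: tr_star add: mult.assoc sEP[THEN mult_assocD])
    qed
    moreover have "star v * (star P * ((A - S * P) * v)) = scal lam (star v * (star E * P * v))"
      unfolding v(2) using sEP[THEN mult_assocD, of v] by (simp add: mult.assoc)
    ultimately have "0 \<le> Re (tr (star v * (star P * ((A - S * P) * v))))"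
      using lam psdf_nonneg[OF psd(3), of v] by simp
    note ker = psd_solution_kernel[OF g' psd(1,2) this]
    have "A * v = scal lam (E * v)" using v(2) ker by (simp add: left_diff_distrib mult.assoc)
    then show False using adm1[OF adm lam v(1)] v(3) ker by simp
  qed
  ultimately show ?thesis unfolding stable_f_def by blast
qed

text \<open>Subtracting the equations gives \<open>star A1 * D + star D * A2 = 0\<close> for the
  difference \<open>D\<close>. Compressed to the finite deflating subspaces of the two closed loops,
  it becomes a Sylvester equation for \<open>M\<close>. Since \<open>E\<close> annihilates the
  infinite parts, \<open>M\<close> determines all of \<open>star E * D\<close>.\<close>

lemma stabilizing_unique:
  assumes c: "corner n E" "corner n A" "corner n S" "corner n P1" "corner n P2" and sS: "star S = S"
    and g: "gare A S W P1" "gare A S W P2" and sym: "star E * P1 = star P1 * E" "star E * P2 = star P2 * E"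
    and st: "stable_f n E (A - S * P1)" "stable_f n E (A - S * P2)"
  shows "star E * P1 = star E * P2"
proof -
  define A1 A2 D where "A1 = A - S * P1" and "A2 = A - S * P2" and "D = P1 - P2"
  have cA: "corner n A1" "corner n A2" unfolding A1_def A2_def by (intro corner_intros c)+
  obtain L1 L1' T1 T1' k1 w1 where w1: "index_one_form n E A1 L1 L1' T1 T1' k1 w1" using st by (auto simp: stable_f_def A1_def)
  obtain L2 L2' T2 T2' k2 w2 where w2: "index_one_form n E A2 L2 L2' T2 T2' k2 w2" using st by (auto simp: stable_f_def A2_def)
  have h1: "hurwitz k1 w1" by (rule index_one_form_hurwitz[OF c(1) cA(1) w1]) (use st in \<open>auto simp: stable_f_def A1_def\<close>)
  have h2: "hurwitz k2 w2" by (rule index_one_form_hurwitz[OF c(1) cA(2) w2]) (use st in \<open>auto simp: stable_f_def A2_def\<close>)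
  note W1 = w1[unfolded index_one_form_def] and W2 = w2[unfolded index_one_form_def]
  have cw: "corner k1 w1" "corner k2 w2" using W1 W2 by blast+
  have symD: "star E * D = star D * E" using sym by (simp add: D_def ring_ds)
  have lyap: "star A1 * D + star D * A2 = 0"
  proof -
    have "star A1 * D + star D * A2 = (star A * P1 + star P1 * A - star P1 * S * P1 + W) 
        - (star A * P2 + star P2 * A - star P2 * S * P2 + W)"
      by (simp add: A1_def A2_def D_def ring_ds sS)
    also have "\<dots> = 0" unfolding g[unfolded gare_def] by simp
    finally show ?thesis .
  qed
  have ET1: "E * T1 = L1 * prj 0 k1" "E * T2 = L2 * prj 0 k2" using W1 W2 by blast+
  have ETe: "E * (T1 * prj 0 k1) = E * T1" "E * (T2 * prj 0 k2) = E * T2"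
    using ET1 by (simp_all add: mult.assoc[symmetric]) (simp_all add: mult.assoc)
  \<comment> \<open>The deflating relation: on the finite part the pencil matrix equals
    \<open>E\<close> after the action of \<open>w\<close>.\<close>
  have AT: "A' * (T * prj 0 k) = E * (T * w)" if "index_one_form n E A' L L' T T' k w" for A' L L' T T' k w
  proof -
    note W = that[unfolded index_one_form_def]
    have cw: "corner k w" and ET: "E * T = L * prj 0 k" and AT: "A' * T = L * (w + prj k n)" using W by blast+
    have z: "prj k n * prj 0 k = 0" by (simp add: prj_inter prj_empty)
    have "A' * (T * prj 0 k) = L * w" using AT[THEN mult_assocD, of "prj 0 k"] cw
      by (simp add: mult.assoc distrib_right z corner_simps)
    moreover have "E * (T * w) = L * w" using ET[THEN mult_assocD, of w] cw by (simp add: mult.assoc corner_simps)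
    ultimately show ?thesis by simp
  qed
  define M where "M = star T1 * (star E * (D * T2))"
  have M1: "M = prj 0 k1 * M"
    using arg_cong[OF ETe(1), of star] by (simp add: M_def mult.assoc[symmetric])
  have M2: "M = M * prj 0 k2"
  proof -
    have "M = star T1 * (star D * (E * T2))" using symD[THEN mult_assocD, of T2] by (simp add: M_def mult.assoc)
    then show ?thesis using ETe(2) by (metis mult.assoc)
  qed
  have "M = 0"
  proof (rule sylvester_zero[OF corner_star[OF cw(1)] cw(2) hurwitz_star[OF cw(1) h1] h2])
    have 1: "star w1 * M = prj 0 k1 * (star T1 * (star A1 * (D * (T2 * prj 0 k2))))"
    proof -
      have "star w1 * M = star w1 * (M * prj 0 k2)" using M2 by simp
      also have "\<dots> = star (E * (T1 * w1)) * (D * (T2 * prj 0 k2))" by (simp add: M_def mult.assoc)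
      also have "\<dots> = star (A1 * (T1 * prj 0 k1)) * (D * (T2 * prj 0 k2))" unfolding AT[OF w1] ..
      finally show ?thesis by (simp add: mult.assoc)
    qed
    have 2: "M * w2 = prj 0 k1 * (star T1 * (star D * (A2 * (T2 * prj 0 k2))))"
    proof -
      have "M * w2 = prj 0 k1 * M * w2" using M1 by simp
      also have "\<dots> = prj 0 k1 * (star T1 * (star D * (E * (T2 * w2))))"
        using symD[THEN mult_assocD] by (simp add: M_def mult.assoc)
      finally show ?thesis unfolding AT[OF w2] .
    qed
    show "star w1 * M + M * w2 = 0"
      using arg_cong[OF lyap, of "\<lambda>x. prj 0 k1 * (star T1 * (x * (T2 * prj 0 k2)))"]
      unfolding 1 2 by (simp add: ring_ds)
  qed (use M1 M2 in simp_all)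
  have T: "inv_pair 0 n T1 T1'" "inv_pair 0 n T2 T2'" using W1 W2 by blast+
  have cD: "corner n D" unfolding D_def by (intro corner_intros c)
  have "star E * D = star T1' * M * T2'"
  proof -
    have "star T1' * star T1 = prj 0 n" "T2 * T2' = prj 0 n"
      using T inv_pair_star[OF T(1)] by (simp_all add: inv_pair_def)
    then show ?thesis using cD corner_star[OF c(1)] by (simp add: M_def mult.assoc mult_assocD[of "star T1'" "star T1"] corner_simps)
  qed
  then have "star E * D = 0" using \<open>M = 0\<close> by simp
  then show ?thesis by (simp add: D_def right_diff_distrib)
qed

section \<open>The port-Hamiltonian system\<close>

definition emr :: "real mat \<Rightarrow> fmat" where
  "emr M = emb (cmat M)"

lemma cmat_carrier [simp]: "cmat M \<in> carrier_mat n m \<longleftrightarrow> M \<in> carrier_mat n m"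
  by (simp add: cmat_def)

lemma ent_emr: "ent (emr M) i j = (if i < dim_row M \<and> j < dim_col M then of_real (M $$ (i,j)) else 0)"
  by (simp add: emr_def ent_emb cmat_def)

lemma emr_mult: "A \<in> carrier_mat n m \<Longrightarrow> B \<in> carrier_mat m k \<Longrightarrow> emr (A * B) = emr A * emr B"
  unfolding emr_def by (subst emb_mult[symmetric]) (auto simp: cmat_def of_real_hom.mat_hom_mult)

lemma emr_add: "A \<in> carrier_mat n m \<Longrightarrow> B \<in> carrier_mat n m \<Longrightarrow> emr (A + B) = emr A + emr B"
  and emr_minus: "A \<in> carrier_mat n m \<Longrightarrow> B \<in> carrier_mat n m \<Longrightarrow> emr (A - B) = emr A - emr B"
  and emr_uminus: "emr (- A) = - emr A"
  and emr_smult: "emr (c \<cdot>\<^sub>m A) = scal (of_real c) (emr A)"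
  and emr_one: "emr (1\<^sub>m n) = prj 0 n"
  and emr_zero: "emr (0\<^sub>m n m) = 0"
  and emr_transpose: "emr (transpose_mat A) = star (emr A)"
  and cconj_emr [simp]: "cconj (emr A) = emr A"
  by (auto intro!: fmat_eqI simp: ent_emr ent_prj)

lemma emr_inj: "A \<in> carrier_mat n m \<Longrightarrow> B \<in> carrier_mat n m \<Longrightarrow> emr A = emr B \<Longrightarrow> A = B"
  unfolding emr_def using emb_inj[of "cmat A" n m "cmat B"]
  by (simp add: cmat_def of_real_hom.mat_hom_inj)

lemma emr_surj:
  assumes "prj 0 n * x = x" "x * prj 0 m = x" "cconj x = x"
  obtains M where "M \<in> carrier_mat n m" "emr M = x"
proof
  let ?M = "mat n m (\<lambda>(i,j). Re (ent x i j))"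
  show "?M \<in> carrier_mat n m" by simp
  have "Im (ent x i j) = 0" for i j
    using arg_cong[OF assms(3), of "\<lambda>x. ent x i j"] by (intro real_scalar) simp
  then have r: "of_real (Re (ent x i j)) = ent x i j" for i j by (simp add: complex_eq_iff)
  have z: "ent x i j = 0" if "\<not> (i < n \<and> j < m)" for i j
    using that arg_cong[OF assms(1), of "\<lambda>x. ent x i j"] arg_cong[OF assms(2), of "\<lambda>x. ent x i j"]
    by (auto simp: ent_prj_times ent_times_prj split: if_splits)
  show "emr ?M = x" by (rule fmat_eqI) (auto simp: ent_emr r z)
qed

lemma emr_prj: "A \<in> carrier_mat n m \<Longrightarrow> prj 0 n * emr A = emr A"
  and emr_prj': "A \<in> carrier_mat n m \<Longrightarrow> emr A * prj 0 m = emr A"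
  by (simp_all add: emr_def)

lemma corner_emr: "A \<in> carrier_mat n n \<Longrightarrow> corner n (emr A)"
  by (simp add: corner_def emr_prj emr_prj')

text \<open>For real symmetric \<open>M\<close> the complex form is the sum of the real forms at the
  real and imaginary parts of each column.\<close>

lemma psdf_emr:
  assumes "psd n M"
  shows "psdf (emr M)"
  unfolding psdf_def
proof (intro conjI allI)
  have M: "M \<in> carrier_mat n n" "transpose_mat M = M"
    and nn: "\<And>x. x \<in> carrier_vec n \<Longrightarrow> 0 \<le> x \<bullet> (M *\<^sub>v x)" using assms by (auto simp: psd_def)
  show "star (emr M) = emr M" using M(2) emr_transpose[of M] by simp
  fix v
  obtain N0 where N0: "bnd N0 v" using ex_bnd by blast
  define N where "N = max N0 n"
  have N: "bnd N v" "bnd N (star v)" "n \<le> N" using bnd_mono[OF N0, of N] by (auto simp: N_def)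
  have bM: "bnd N (emr M)" using M N(3) by (auto simp: bnd_def ent_emr)
  have form: "x \<bullet> (M *\<^sub>v x) = (\<Sum>i<n. \<Sum>k<n. x $ i * (M $$ (i,k) * x $ k))" if "x \<in> carrier_vec n" for x
    using that M by (simp add: scalar_prod_def sum_distrib_left atLeast0LessThan)
  have inner: "(\<Sum>k<N. ent (emr M) i k * ent v k j) = (\<Sum>k<n. ent (emr M) i k * ent v k j)" for i j
    by (rule sum.mono_neutral_right) (use M N in \<open>auto simp: ent_emr\<close>)
  have "tr (star v * emr M * v) = (\<Sum>j<N. \<Sum>i<N. cnj (ent v i j) * (\<Sum>k<N. ent (emr M) i k * ent v k j))"
    using N bM by (simp add: mult.assoc tr_bnd[of N] bnd_times ent_times[of N])
  also have "\<dots> = (\<Sum>j<N. \<Sum>i<n. cnj (ent v i j) * (\<Sum>k<n. ent (emr M) i k * ent v k j))"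
    unfolding inner by (intro sum.cong refl sum.mono_neutral_right) (use M N in \<open>auto simp: ent_emr\<close>)
  finally have t: "tr (star v * emr M * v) = (\<Sum>j<N. \<Sum>i<n. cnj (ent v i j) * (\<Sum>k<n. ent (emr M) i k * ent v k j))" .
  let ?re = "\<lambda>j. vec n (\<lambda>i. Re (ent v i j))" and ?im = "\<lambda>j. vec n (\<lambda>i. Im (ent v i j))"
  have "Re (\<Sum>i<n. cnj (ent v i j) * (\<Sum>k<n. ent (emr M) i k * ent v k j))
      = ?re j \<bullet> (M *\<^sub>v ?re j) + ?im j \<bullet> (M *\<^sub>v ?im j)" for j
  proof -
    have "Re (\<Sum>i<n. cnj (ent v i j) * (\<Sum>k<n. ent (emr M) i k * ent v k j)) =
        (\<Sum>i<n. \<Sum>k<n. ?re j $ i * (M $$ (i,k) * ?re j $ k) + ?im j $ i * (M $$ (i,k) * ?im j $ k))"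
      unfolding sum_distrib_left Re_sum
      by (intro sum.cong refl) (use M in \<open>simp add: ent_emr\<close>)
    also have "\<dots> = ?re j \<bullet> (M *\<^sub>v ?re j) + ?im j \<bullet> (M *\<^sub>v ?im j)"
      unfolding form[OF vec_carrier] sum.distrib ..
    finally show ?thesis .
  qed
  then have "Re (tr (star v * emr M * v)) = (\<Sum>j<N. ?re j \<bullet> (M *\<^sub>v ?re j) + ?im j \<bullet> (M *\<^sub>v ?im j))"
    unfolding t Re_sum by simp
  then show "0 \<le> Re (tr (star v * emr M * v))"
    by (simp only:) (intro sum_nonneg add_nonneg_nonneg nn vec_carrier)
qed

section \<open>Rank conditions as kernel conditions\<close>

lemma emb_hcat_kernel:
  assumes X: "X \<in> carrier_mat n p" and Y: "Y \<in> carrier_mat n q"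
    and z: "emb (transpose_mat X) * y = 0" "emb (transpose_mat Y) * y = 0"
  shows "emb (transpose_mat (hcat X Y)) * y = 0"
proof (rule fmat_eqI)
  fix i j
  obtain N where N: "bnd N (emb (transpose_mat X))" "bnd N (emb (transpose_mat Y))" "bnd N (emb (transpose_mat (hcat X Y)))"
    using ex_bnd3 by blast
  have "ent (emb (transpose_mat (hcat X Y))) i k =
      (if i < p then ent (emb (transpose_mat X)) i k else ent (emb (transpose_mat Y)) (i - p) k)" for k
    using X Y by (auto simp: ent_emb hcat_def)
  then have "ent (emb (transpose_mat (hcat X Y)) * y) i j =
      (if i < p then ent (emb (transpose_mat X) * y) i j else ent (emb (transpose_mat Y) * y) (i - p) j)"
    by (simp add: ent_times[OF N(1)] ent_times[OF N(2)] ent_times[OF N(3)])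
  then show "ent (emb (transpose_mat (hcat X Y)) * y) i j = ent 0 i j" by (simp add: z)
qed

lemma hcat_carrier: "X \<in> carrier_mat n p \<Longrightarrow> Y \<in> carrier_mat n q \<Longrightarrow> hcat X Y \<in> carrier_mat n (p + q)"
  by (auto simp: hcat_def)

lemma cmat_hcat: "X \<in> carrier_mat n p \<Longrightarrow> Y \<in> carrier_mat n q \<Longrightarrow> cmat (hcat X Y) = hcat (cmat X) (cmat Y)"
  by (auto simp: hcat_def cmat_def intro!: eq_matI)

lemma cmat_transpose: "cmat (transpose_mat X) = transpose_mat (cmat X)"
  by (auto simp: cmat_def)

lemma full_rank_kernel_complex:
  fixes M :: "complex mat"
  assumes M: "M \<in> carrier_mat n c" and r: "vec_space.rank n M = n"
    and y: "prj 0 n * y = y" "emb (transpose_mat M) * y = 0"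
  shows "y = 0"
proof (rule colv_zeroD[OF _ y(1)])
  fix j
  have "transpose_mat M *\<^sub>v colv n y j = 0\<^sub>v c"
    using colv_mult[of "transpose_mat M" c n y j] M y(2) by simp
  then show "colv n y j = 0\<^sub>v n"
    by (intro vec_space.full_rank_left_kernel[OF M r]) simp_all
qed

text \<open>The rank is taken over the reals but \<open>y\<close> is complex, so real and imaginary
  parts of each column are treated separately.\<close>

lemma full_rank_kernel_real:
  fixes M :: "real mat"
  assumes M: "M \<in> carrier_mat n c" and r: "vec_space.rank n M = n"
    and y: "prj 0 n * y = y" "star (emr M) * y = 0"
  shows "y = 0"
proof (rule colv_zeroD[OF _ y(1)])
  fix j
  let ?c = "colv n y j"
  have "emb (cmat (transpose_mat M)) * y = 0"
    using y(2) by (simp add: emb_transpose_cmat emr_def)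
  then have z: "cmat (transpose_mat M) *\<^sub>v ?c = 0\<^sub>v c"
    using colv_mult[of "cmat (transpose_mat M)" c n y j] M by simp
  have zi: "(\<Sum>l = 0..<n. complex_of_real (M $$ (l, i)) * ent y l j) = 0" if "i < c" for i
    using arg_cong[OF z, of "\<lambda>v. v $ i"] that M by (simp add: cmat_def scalar_prod_def colv_def)
  have "transpose_mat M *\<^sub>v vec n (\<lambda>i. Re (ent y i j)) = 0\<^sub>v c"
  proof (rule eq_vecI)
    fix i assume "i < dim_vec (0\<^sub>v c :: real vec)"
    then show "(transpose_mat M *\<^sub>v vec n (\<lambda>i. Re (ent y i j))) $ i = 0\<^sub>v c $ i"
      using arg_cong[OF zi, of i Re] M by (simp add: scalar_prod_def)
  qed (use M in auto)
  then have 1: "vec n (\<lambda>i. Re (ent y i j)) = 0\<^sub>v n"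
    by (intro vec_space.full_rank_left_kernel[OF M r]) simp_all
  have "transpose_mat M *\<^sub>v vec n (\<lambda>i. Im (ent y i j)) = 0\<^sub>v c"
  proof (rule eq_vecI)
    fix i assume "i < dim_vec (0\<^sub>v c :: real vec)"
    then show "(transpose_mat M *\<^sub>v vec n (\<lambda>i. Im (ent y i j))) $ i = 0\<^sub>v c $ i"
      using arg_cong[OF zi, of i Im] M by (simp add: scalar_prod_def)
  qed (use M in auto)
  then have 2: "vec n (\<lambda>i. Im (ent y i j)) = 0\<^sub>v n"
    by (intro vec_space.full_rank_left_kernel[OF M r]) simp_all
  show "?c = 0\<^sub>v n"
  proof (rule eq_vecI)
    fix i assume "i < dim_vec (0\<^sub>v n :: complex vec)"
    then have i: "i < n" by simp
    show "?c $ i = 0\<^sub>v n $ i"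
      using arg_cong[OF 1, of "\<lambda>v. v $ i"] arg_cong[OF 2, of "\<lambda>v. v $ i"] i
      by (simp add: colv_def complex_eq_iff)
  qed simp
qed

text \<open>Full row rank means a trivial left kernel, and \<open>B B^T\<close> has the kernel of
  \<open>B^T\<close>.\<close>

lemma strongly_stabilizable_adm:
  assumes c: "E \<in> carrier_mat n n" "A \<in> carrier_mat n n" "B \<in> carrier_mat n m"
    and s: "strongly_stabilizable n E A B"
  shows "adm n (emr E) (emr A) (emr B * star (emr B))"
proof -
  have B0: "star (emr B) * y = 0" if "emr B * star (emr B) * y = 0" for y
  proof -
    have "star (star (emr B) * y) * (star (emr B) * y) = 0" using that by (simp add: mult.assoc)
    then show ?thesis by (intro tr_star_self_eq_0) simp
  qed
  show ?thesis unfolding adm_def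
  proof (intro conjI allI impI)
    fix lam y assume y: "0 \<le> Re lam" "prj 0 n * y = y" "star (emr A) * y = scal lam (star (emr E) * y)"
      "emr B * star (emr B) * y = 0"
    let ?M = "lam \<cdot>\<^sub>m cmat E - cmat A"
    have r: "vec_space.rank n (hcat ?M (cmat B)) = n" using s y(1) by (simp add: strongly_stabilizable_def)
    have M: "?M \<in> carrier_mat n n" by (rule minus_carrier_mat) (use c in simp)
    have "transpose_mat ?M = lam \<cdot>\<^sub>m cmat (transpose_mat E) - cmat (transpose_mat A)"
      using c by (auto intro!: eq_matI simp: cmat_def)
    moreover have "emb (lam \<cdot>\<^sub>m cmat (transpose_mat E) - cmat (transpose_mat A)) =
        scal lam (star (emr E)) - star (emr A)"
      using c by (subst emb_minus[of _ n n]) (simp_all add: emb_smult emr_def emb_transpose_cmat)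
    ultimately have 1: "emb (transpose_mat ?M) * y = 0" using y(3) by (simp add: left_diff_distrib)
    have 2: "emb (transpose_mat (cmat B)) * y = 0"
      using B0[OF y(4)] by (simp add: cmat_transpose[symmetric] emr_def emb_transpose_cmat)
    show "y = 0"
      by (rule full_rank_kernel_complex[OF hcat_carrier[OF M] r y(2) emb_hcat_kernel[OF M _ 1 2]])
        (use c in simp_all)
  next
    fix y z assume y: "prj 0 n * y = y" "star (emr E) * y = 0" "star (emr A) * y = star (emr E) * z"
      "emr B * star (emr B) * y = 0"
    obtain k S where S: "S \<in> carrier_mat n k" "{S *\<^sub>v x | x. x \<in> carrier_vec k} = mat_kernel E"
      "vec_space.rank n (hcat (hcat E (A * S)) B) = n"
      using s unfolding strongly_stabilizable_def impulse_controllable_def by blast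
    have "E * S = 0\<^sub>m n k"
    proof (rule eq_matI)
      fix i j assume ij: "i < dim_row (0\<^sub>m n k :: real mat)" "j < dim_col (0\<^sub>m n k :: real mat)"
      have "S *\<^sub>v unit_vec k j \<in> mat_kernel E" unfolding S(2)[symmetric] using unit_vec_carrier by blast
      moreover have "S *\<^sub>v unit_vec k j = col S j" using S(1) ij by (intro eq_vecI) auto
      ultimately have "E *\<^sub>v col S j = 0\<^sub>v n" using c by (auto simp: mat_kernel_def)
      from arg_cong[OF this, of "\<lambda>v. v $ i"] show "(E * S) $$ (i,j) = 0\<^sub>m n k $$ (i,j)"
        using c S(1) ij by simp
    qed (use c S in auto)
    then have ES: "emr E * emr S = 0" using c S(1) emr_mult[of E n n S k] by (simp add: emr_zero)
    \<comment> \<open>As \<open>E * S = 0\<close>, the transpose of \<open>S\<close> annihilates the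
      image of \<open>star E\<close>; so the vector \<open>z\<close> of the impulse clause
      disappears and \<open>y\<close> lies in the left kernel of the block
      \<open>A S\<close>.\<close>
    have "star (emr S) * (star (emr A) * y) = star (emr S) * (star (emr E) * z)" using y(3) by simp
    also have "\<dots> = 0" using arg_cong[OF ES, of star] by (simp add: mult.assoc[symmetric])
    finally have AS: "star (emr (A * S)) * y = 0" using c S(1) emr_mult[of A n n S k] by (simp add: mult.assoc)
    have tr: "emb (transpose_mat (cmat X)) = star (emr X)" for X
      by (simp add: cmat_transpose[symmetric] emr_def emb_transpose_cmat)
    have c2: "A * S \<in> carrier_mat n k" "hcat E (A * S) \<in> carrier_mat n (n + k)"
      using c S(1) by (auto intro!: hcat_carrier)
    have 1: "emb (transpose_mat (hcat (cmat E) (cmat (A * S)))) * y = 0"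
      by (rule emb_hcat_kernel[of _ n n _ k]) (use c c2 y AS in \<open>simp_all add: tr\<close>)
    then have "emb (transpose_mat (hcat (cmat (hcat E (A * S))) (cmat B))) * y = 0"
      by (intro emb_hcat_kernel[of _ n "n + k" _ m])
        (use c c2 y B0 in \<open>simp_all add: tr cmat_hcat[of E n n _ k, symmetric]\<close>)
    then have "star (emr (hcat (hcat E (A * S)) B)) * y = 0"
      using c c2 by (simp add: cmat_hcat[of _ n "n + k" _ m, symmetric] tr)
    then show "y = 0"
      using full_rank_kernel_real[OF hcat_carrier[OF c2(2) c(3)] S(3) y(1)] by blast
  qed
qed

section \<open>Stable pencils and both equations in terms of \<open>fmat\<close>\<close>

lemma invertible_mat_inv_pair:
  assumes P: "P \<in> carrier_mat n n"
  shows "invertible_mat P \<longleftrightarrow> (\<exists>L'. inv_pair 0 n (emr P) L')"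
proof
  assume "invertible_mat P"
  then obtain B where B: "P * B = 1\<^sub>m n" "B * P = 1\<^sub>m (dim_row B)"
    using P by (auto simp: invertible_mat_def inverts_mat_def)
  have "dim_col B = n" using arg_cong[OF B(1), of dim_col] by simp
  moreover have "dim_row B = n" using arg_cong[OF B(2), of dim_col] P by simp
  ultimately have cB: "B \<in> carrier_mat n n" by blast
  then have "inv_pair 0 n (emr P) (emr B)" using P B
    by (simp add: inv_pair_def emr_prj emr_prj' emr_mult[symmetric, of _ n n _ n] emr_one)
  then show "\<exists>L'. inv_pair 0 n (emr P) L'" by blast
next
  assume "\<exists>L'. inv_pair 0 n (emr P) L'"
  then obtain L' where L: "inv_pair 0 n (emr P) L'" by blast
  then obtain B where B: "B \<in> carrier_mat n n" "emr B = L'"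
    by (auto simp: inv_pair_def intro: emr_surj)
  have "P * B = 1\<^sub>m n" "B * P = 1\<^sub>m n"
    by (rule emr_inj[of _ n n], use P B L in \<open>auto simp: inv_pair_def emr_mult[of _ n n _ n] emr_one\<close>)+
  then show "invertible_mat P" using P B by (auto simp: invertible_mat_def inverts_mat_def)
qed

lemma emr_four_block:
  assumes "W \<in> carrier_mat k k" "k \<le> n"
  shows "emr (four_block_mat W (0\<^sub>m k (n - k)) (0\<^sub>m (n - k) k) (1\<^sub>m (n - k))) = emr W + prj k n"
    and "emr (four_block_mat (1\<^sub>m k) (0\<^sub>m k (n - k)) (0\<^sub>m (n - k) k) (0\<^sub>m (n - k) (n - k))) = prj 0 k"
  using assms by (auto intro!: fmat_eqI simp: ent_emr ent_prj)

lemma stable_pencil_iff: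
  assumes c: "E \<in> carrier_mat n n" "A \<in> carrier_mat n n"
  shows "stable_pencil n E A \<longleftrightarrow> stable_f n (emr E) (emr A)"
proof
  assume s: "stable_pencil n E A"
  obtain P Pt k W where w: "weierstrass_form n E A P Pt k W (0\<^sub>m (n - k) (n - k))"
    using s by (auto simp: stable_pencil_def impulse_free_def)
  note w = w[unfolded weierstrass_form_def]
  have P: "P \<in> carrier_mat n n" "Pt \<in> carrier_mat n n" and kn: "k \<le> n" and W: "W \<in> carrier_mat k k" using w by blast+
  obtain L' T' where LT: "inv_pair 0 n (emr P) L'" "inv_pair 0 n (emr Pt) T'"
  proof -
    have "invertible_mat P" "invertible_mat Pt" using w by blast+
    then show ?thesis using that unfolding invertible_mat_inv_pair[OF P(1)] invertible_mat_inv_pair[OF P(2)] by blast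
  qed
  let ?F = "four_block_mat (1\<^sub>m k) (0\<^sub>m k (n - k)) (0\<^sub>m (n - k) k) (0\<^sub>m (n - k) (n - k)) :: real mat"
  let ?G = "four_block_mat W (0\<^sub>m k (n - k)) (0\<^sub>m (n - k) k) (1\<^sub>m (n - k))"
  have F: "?F \<in> carrier_mat n n" and G: "?G \<in> carrier_mat n n" using W kn by (intro carrier_matI; simp)+
  have "emr (E * Pt) = emr (P * ?F)" "emr (A * Pt) = emr (P * ?G)" using w by simp_all
  then have "emr E * emr Pt = emr P * prj 0 k" "emr A * emr Pt = emr P * (emr W + prj k n)"
    using c P F G W kn by (simp_all add: emr_mult[of _ n n _ n] emr_four_block)
  then have "index_one_form n (emr E) (emr A) (emr P) L' (emr Pt) T' k (emr W)"
    using LT kn W by (simp add: index_one_form_def corner_emr)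
  moreover have "Re lam < 0" if v: "prj 0 n * v = v" "emr A * v = scal lam (emr E * v)" "v \<noteq> 0" for lam v
  proof -
    \<comment> \<open>\<open>v\<close> may have many columns; any nonzero one is an eigenvector of
      the pencil.\<close>
    obtain j where j: "colv n v j \<noteq> 0\<^sub>v n" using colv_zeroD v by blast
    have sc: "colv n (scal lam x) j = lam \<cdot>\<^sub>v colv n x j" for x by (auto simp: colv_def)
    have "lam \<cdot>\<^sub>v (cmat E *\<^sub>v colv n v j) = cmat A *\<^sub>v colv n v j"
      using c v(2) by (simp add: colv_mult[of _ n n] sc[symmetric] emr_def)
    then have "finite_eigenvalue n E A lam" unfolding finite_eigenvalue_def using j colv_carrier by blast
    then show ?thesis using s by (simp add: stable_pencil_def)
  qed
  ultimately show "stable_f n (emr E) (emr A)" unfolding stable_f_def by blast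
next
  assume s: "stable_f n (emr E) (emr A)"
  have reg: "regular_pencil n E A"
  proof -
    \<comment> \<open>The point 1 lies in the closed right half-plane, so it is no eigenvalue and
      can witness regularity.\<close>
    let ?M = "1 \<cdot>\<^sub>m cmat E - cmat A"
    have M: "?M \<in> carrier_mat n n" by (rule minus_carrier_mat) (use c in simp)
    have eM: "emb ?M = emr E - emr A" using c by (subst emb_minus[of _ n n]) (simp_all add: emb_smult emr_def)
    have "x = 0" if x: "prj 0 n * x = x" "emb ?M * x = 0" for x
    proof (rule ccontr)
      assume "x \<noteq> 0"
      have "emr A * x = scal 1 (emr E * x)" using x(2) unfolding eM by (simp add: left_diff_distrib)
      with s x \<open>x \<noteq> 0\<close> have "Re 1 < 0" unfolding stable_f_def by blast
      then show False by simp
    qed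
    then have "det ?M \<noteq> 0" using det_nonzero_iff_inj[OF M] by blast
    then show ?thesis unfolding regular_pencil_def by blast
  qed
  obtain L L' T T' k w where w: "index_one_form n (emr E) (emr A) L L' T T' k w" using s by (auto simp: stable_f_def)
  note w = w[unfolded index_one_form_def]
  obtain P where P: "P \<in> carrier_mat n n" "emr P = L" using w by (auto simp: inv_pair_def intro: emr_surj)
  obtain Pt where Pt: "Pt \<in> carrier_mat n n" "emr Pt = T" using w by (auto simp: inv_pair_def intro: emr_surj)
  obtain W where W: "W \<in> carrier_mat k k" "emr W = w" using w by (auto simp: corner_def intro: emr_surj)
  have kn: "k \<le> n" using w by blast
  let ?F = "four_block_mat (1\<^sub>m k) (0\<^sub>m k (n - k)) (0\<^sub>m (n - k) k) (0\<^sub>m (n - k) (n - k)) :: real mat"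
  let ?G = "four_block_mat W (0\<^sub>m k (n - k)) (0\<^sub>m (n - k) k) (1\<^sub>m (n - k))"
  have F: "?F \<in> carrier_mat n n" and G: "?G \<in> carrier_mat n n" using W kn by (intro carrier_matI; simp)+
  have "emr (E * Pt) = emr (P * ?F)"
    unfolding emr_mult[OF c(1) Pt(1)] emr_mult[OF P(1) F] emr_four_block(2)[OF W(1) kn] P(2) Pt(2) using w by blast
  then have "E * Pt = P * ?F"
    by (rule emr_inj[OF mult_carrier_mat[OF c(1) Pt(1)] mult_carrier_mat[OF P(1) F]])
  moreover have "emr (A * Pt) = emr (P * ?G)"
    unfolding emr_mult[OF c(2) Pt(1)] emr_mult[OF P(1) G] emr_four_block(1)[OF W(1) kn] P(2) Pt(2) W(2) using w by blast
  then have "A * Pt = P * ?G"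
    by (rule emr_inj[OF mult_carrier_mat[OF c(2) Pt(1)] mult_carrier_mat[OF P(1) G]])
  moreover have "invertible_mat P" "invertible_mat Pt"
    unfolding invertible_mat_inv_pair[OF P(1)] invertible_mat_inv_pair[OF Pt(1)] P(2) Pt(2) using w by blast+
  moreover have "\<exists>j. (0\<^sub>m (n - k) (n - k) :: real mat) ^\<^sub>m j = 0\<^sub>m (n - k) (n - k)"
    by (rule exI[of _ 1]) simp
  ultimately have "weierstrass_form n E A P Pt k W (0\<^sub>m (n - k) (n - k))"
    unfolding weierstrass_form_def using P Pt W kn by simp
  then have imp: "impulse_free n E A" unfolding impulse_free_def using reg by blast
  have "Re lam < 0" if ev: "finite_eigenvalue n E A lam" for lam
  proof -
    obtain v where v: "v \<in> carrier_vec n" "v \<noteq> 0\<^sub>v n" "lam \<cdot>\<^sub>v (cmat E *\<^sub>v v) = cmat A *\<^sub>v v"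
      using ev by (auto simp: finite_eigenvalue_def)
    have "emr A * emv v = scal lam (emr E * emv v)"
      using arg_cong[OF v(3), of emv] c v(1) by (simp add: emv_smult emv_mult[of _ n n] emr_def)
    then show ?thesis using s emv_carrier[OF v(1)] emv_eq_0[OF v(1)] v(2) unfolding stable_f_def by blast
  qed
  then show "stable_pencil n E A" unfolding stable_pencil_def using reg imp by blast
qed

lemma GC_stabilizing_iff:
  assumes c: "E \<in> carrier_mat n n" "A \<in> carrier_mat n n" "B \<in> carrier_mat n m" "C \<in> carrier_mat m n"
    and P: "P \<in> carrier_mat n n"
  defines "S \<equiv> emr B * star (emr B)"
  shows "GC_stabilizing n E A B C P \<longleftrightarrow> gare (emr A) S (star (emr C) * emr C) (emr P) \<and>
     star (emr E) * emr P = star (emr P) * emr E \<and> stable_f n (emr E) (emr A - S * emr P)"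
proof -
  note m = emr_mult[of _ n n _ n] emr_mult[of _ n n _ m] emr_mult[of _ n m _ n] emr_mult[of _ m n _ n] mult_carrier_mat[of _ m n _ n] emr_add[of _ n n] emr_minus[of _ n n]
    emr_transpose emr_zero mult_carrier_mat[of _ n n _ n] mult_carrier_mat[of _ n n _ m] mult_carrier_mat[of _ n m _ n]
    add_carrier_mat minus_carrier_mat
  let ?L = "transpose_mat A * P + transpose_mat P * A - transpose_mat P * B * transpose_mat B * P + transpose_mat C * C"
  have L: "?L \<in> carrier_mat n n" using c P by (simp add: m)
  have eL: "emr ?L = star (emr A) * emr P + star (emr P) * emr A - star (emr P) * S * emr P + star (emr C) * emr C"
    using c P by (simp add: m S_def mult.assoc)
  have "?L = 0\<^sub>m n n \<longleftrightarrow> gare (emr A) S (star (emr C) * emr C) (emr P)"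
    unfolding gare_def eL[symmetric] using emr_inj[OF L, of "0\<^sub>m n n"] emr_zero[of n n] by auto
  moreover have "transpose_mat E * P = transpose_mat P * E \<longleftrightarrow> star (emr E) * emr P = star (emr P) * emr E"
  proof -
    have "emr (transpose_mat E * P) = star (emr E) * emr P" "emr (transpose_mat P * E) = star (emr P) * emr E"
      using c P by (simp_all add: m)
    moreover have "transpose_mat E * P \<in> carrier_mat n n" "transpose_mat P * E \<in> carrier_mat n n"
      using c P by (simp_all add: m)
    ultimately show ?thesis using emr_inj by metis
  qed
  moreover have "stable_pencil n E (A - B * transpose_mat B * P) \<longleftrightarrow> stable_f n (emr E) (emr A - S * emr P)"
  proof -
    have "A - B * transpose_mat B * P \<in> carrier_mat n n" using c P by (simp add: m)
    from stable_pencil_iff[OF c(1) this] show ?thesis using c P by (simp add: m S_def mult.assoc)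
  qed
  ultimately show ?thesis unfolding GC_stabilizing_def GC_sol_def using P by blast
qed

lemma stable_f_star_iff:
  "corner n E \<Longrightarrow> corner n A \<Longrightarrow> stable_f n (star E) (star A) \<longleftrightarrow> stable_f n E A"
  using stable_f_star[of n E A] stable_f_star[of n "star E" "star A"] by (auto simp: corner_star)

text \<open>(GF) read as (GC) of the transposed system. The closed loop
  \<open>star A - S * G\<close> is the adjoint of \<open>A - Pf C^T C\<close>, so
  \<open>stable_f_star_iff\<close> returns to the untransposed pencil.\<close>

lemma GF_stabilizing_iff:
  assumes c: "E \<in> carrier_mat n n" "A \<in> carrier_mat n n" "B \<in> carrier_mat n m" "C \<in> carrier_mat m n" "R \<in> carrier_mat n n"
    and P: "P \<in> carrier_mat n n"
  defines "S \<equiv> star (emr C) * emr C" and "G \<equiv> star (emr P)"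
  shows "GF_stabilizing n E A B C R P \<longleftrightarrow>
     gare (star (emr A)) S (emr B * star (emr B) + scal 2 (emr R)) G \<and>
     emr E * G = star G * star (emr E) \<and> stable_f n (star (emr E)) (star (emr A) - S * G)"
proof -
  note m = emr_mult[of _ n n _ n] emr_mult[of _ n n _ m] emr_mult[of _ n m _ n] emr_mult[of _ m n _ n] mult_carrier_mat[of _ m n _ n] emr_add[of _ n n] emr_minus[of _ n n]
    emr_transpose emr_zero mult_carrier_mat[of _ n n _ n] mult_carrier_mat[of _ n n _ m] mult_carrier_mat[of _ n m _ n]
    add_carrier_mat minus_carrier_mat emr_smult
  let ?L = "A * transpose_mat P + P * transpose_mat A - P * transpose_mat C * C * transpose_mat P
       + B * transpose_mat B + 2 \<cdot>\<^sub>m R"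
  have L: "?L \<in> carrier_mat n n" using c P by (simp add: m)
  have eL: "emr ?L = emr A * G + star G * star (emr A) - star G * S * G + (emr B * star (emr B) + scal 2 (emr R))"
    using c P by (simp add: m S_def G_def mult.assoc add.assoc)
  have "?L = 0\<^sub>m n n \<longleftrightarrow> gare (star (emr A)) S (emr B * star (emr B) + scal 2 (emr R)) G"
    unfolding gare_def star_star eL[symmetric] using emr_inj[OF L, of "0\<^sub>m n n"] emr_zero[of n n] by auto
  moreover have "E * transpose_mat P = P * transpose_mat E \<longleftrightarrow> emr E * G = star G * star (emr E)"
  proof -
    have "emr (E * transpose_mat P) = emr E * G" "emr (P * transpose_mat E) = star G * star (emr E)"
      using c P by (simp_all add: m G_def)
    moreover have "E * transpose_mat P \<in> carrier_mat n n" "P * transpose_mat E \<in> carrier_mat n n"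
      using c P by (simp_all add: m)
    ultimately show ?thesis using emr_inj by metis
  qed
  moreover have "stable_pencil n E (A - P * transpose_mat C * C) \<longleftrightarrow> stable_f n (star (emr E)) (star (emr A) - S * G)"
  proof -
    have 1: "A - P * transpose_mat C * C \<in> carrier_mat n n" using c P by (simp add: m)
    have "star (emr A) - S * G = star (emr (A - P * transpose_mat C * C))"
      using c P by (simp add: m S_def G_def mult.assoc)
    then show ?thesis
      using stable_pencil_iff[OF c(1) 1] stable_f_star_iff[OF corner_emr[OF c(1)] corner_emr[OF 1]] by simp
  qed
  ultimately show ?thesis unfolding GF_stabilizing_def GF_sol_def using P by blast
qed

text \<open>The kernel of a sum of semidefinite matrices lies in the kernel of each; so
  admissibility with \<open>B B^T\<close> passes to \<open>B B^T + 2 R\<close>.\<close>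

lemma adm_add_psd:
  assumes a: "adm n E A S" and psd: "psdf S" "psdf R"
  shows "adm n E A (S + R)"
proof -
  have S0: "S * y = 0" if y: "(S + R) * y = 0" for y
  proof -
    have "Re (tr (star y * ((S + R) * y))) = 0" unfolding y by simp
    then have "Re (tr (star y * (S * y))) + Re (tr (star y * (R * y))) = 0"
      by (simp add: distrib_left distrib_right)
    then have "Re (tr (star y * (S * y))) = 0"
      using psdf_nonneg[OF psd(1), of y] psdf_nonneg[OF psd(2), of y] by linarith
    then show ?thesis by (rule psdf_kernel[OF psd(1)])
  qed
  show ?thesis unfolding adm_def
  proof (intro conjI allI impI)
    fix lam y assume "0 \<le> Re lam" "prj 0 n * y = y" "star A * y = scal lam (star E * y)" "(S + R) * y = 0"
    then show "y = 0" using adm1[OF a] S0 by blast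
  next
    fix y z assume "prj 0 n * y = y" "star E * y = 0" "star A * y = star E * z" "(S + R) * y = 0"
    then show "y = 0" using adm2[OF a] S0 by blast
  qed
qed

text \<open>In claim (iii) \<open>Q\<close> is square, so the equation \<open>Q * Qi = 1\<close>
  expresses invertibility with inverse \<open>Qi\<close>, and \<open>Q^{-T}\<close> is the transpose
  of \<open>Qi\<close>.\<close>

theorem mainTheorem3:
  fixes n m :: nat and E J R Q B :: "real mat"
  defines "A \<equiv> (J - R) * Q"
  defines "C \<equiv> transpose_mat B * Q"
  assumes pH: "pH_system n m E J R Q B"
    and reg: "regular_pencil n E A"
    and stab: "strongly_stabilizable n E A B"
    and det: "strongly_detectable n E A C"
  shows "((\<exists>Pc. GC_stabilizing n E A B C Pc) \<and> (\<exists>Pf. GF_stabilizing n E A B C R Pf)) \<and>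
         (\<forall>Pc1 Pc2. GC_stabilizing n E A B C Pc1 \<longrightarrow> GC_stabilizing n E A B C Pc2 \<longrightarrow>
           transpose_mat E * Pc1 = transpose_mat E * Pc2) \<and>
         (\<forall>Pf1 Pf2. GF_stabilizing n E A B C R Pf1 \<longrightarrow> GF_stabilizing n E A B C R Pf2 \<longrightarrow>
           E * transpose_mat Pf1 = E * transpose_mat Pf2) \<and>
         (\<forall>Qi \<in> carrier_mat n n. Q * Qi = 1\<^sub>m n \<longrightarrow> GF_stabilizing n E A B C R (transpose_mat Qi)) \<and>
         (\<exists>Pc Pf. GC_stabilizing n E A B C Pc \<and> GF_stabilizing n E A B C R Pf \<and>
           invertible_mat (1\<^sub>m n + Pf * transpose_mat Pc))"
proof -
  have c: "E \<in> carrier_mat n n" "J \<in> carrier_mat n n" "R \<in> carrier_mat n n" "Q \<in> carrier_mat n n" "B \<in> carrier_mat n m"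
    and EQ: "psd n (transpose_mat E * Q)" and skew: "transpose_mat J = - J" and R: "psd n R"
    using pH by (auto simp: pH_system_def)
  have cA: "A \<in> carrier_mat n n" and cC: "C \<in> carrier_mat m n"
    using c by (auto simp: A_def C_def)
  define e a s w s2 w2 where "e = emr E" and "a = emr A" and "s = emr B * star (emr B)" and "w = star (emr C) * emr C"
    and "s2 = w" and "w2 = s + scal 2 (emr R)"
  note GC = GC_stabilizing_iff[OF c(1) cA c(5) cC, folded e_def a_def s_def w_def]
  note GF = GF_stabilizing_iff[OF c(1) cA c(5) cC c(3), folded e_def a_def s_def w_def, folded s2_def w2_def]
  have psdR: "psdf (scal 2 (emr R))" using psdf_scal[of 2, OF _ psdf_emr[OF R]] by simp
  have psds: "psdf s" "psdf w" using psdf_square[of "star (emr B)"] psdf_square[of "emr C"] by (simp_all add: s_def w_def)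
  have psd: "psdf s" "psdf w" "psdf s2" "psdf w2" using psds psdR by (auto simp: s2_def w2_def intro: psdf_add)
  have cr: "corner n e" "corner n a" "corner n s" "corner n w" "corner n s2" "corner n w2"
  proof -
    show ea: "corner n e" "corner n a" using c cA by (simp_all add: e_def a_def corner_emr)
    have "prj 0 n * emr B = emr B" "emr C * prj 0 n = emr C" using c cC emr_prj emr_prj' by blast+
    then have "prj 0 n * emr B = emr B" "star (emr B) * prj 0 n = star (emr B)"
      "emr C * prj 0 n = emr C" "prj 0 n * star (emr C) = star (emr C)"
      by (simp_all, metis star_prj star_times, metis star_prj star_times)
    then show sw: "corner n s" "corner n w" by (simp_all add: corner_def s_def w_def mult.assoc mult_assocD[of "prj 0 n"])
    then show "corner n s2" "corner n w2" using c by (auto simp: s2_def w2_def intro!: corner_intros corner_emr)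
  qed
  have real: "cconj e = e" "cconj a = a" "cconj s = s" "cconj w = w" "cconj s2 = s2" "cconj w2 = w2"
    by (simp_all add: e_def a_def s_def w_def s2_def w2_def)
  have adm1: "adm n e a s" unfolding e_def a_def s_def by (rule strongly_stabilizable_adm[OF c(1) cA c(5) stab])
  have adm2: "adm n (star e) (star a) w"
    using strongly_stabilizable_adm[of "transpose_mat E" n "transpose_mat A" "transpose_mat C" m]
      c(1) cA cC det by (simp add: strongly_detectable_def emr_transpose e_def a_def w_def)
  have adm3: "adm n (star e) (star a) s2" using adm2 by (simp add: s2_def)
  have adm4: "adm n e a w2" unfolding w2_def by (rule adm_add_psd[OF adm1 psds(1) psdR])
  obtain P G where P: "corner n P" "cconj P = P" "psdf (star e * P)" "gare a s w P"
    and G: "corner n G" "cconj G = G" "psdf (e * G)" "gare (star a) s2 w2 G"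
    and inj: "\<And>w. prj 0 n * w = w \<Longrightarrow> w + star G * (star P * w) = 0 \<Longrightarrow> w = 0"
    using gare_pair_exists[OF cr psd real adm1 adm2 adm3 adm4] by metis
  obtain Pc where Pc: "Pc \<in> carrier_mat n n" "emr Pc = P" using P by (auto simp: corner_def intro: emr_surj)
  obtain Gm where Gm: "Gm \<in> carrier_mat n n" "emr Gm = G" using G by (auto simp: corner_def intro: emr_surj)
  define Pf where "Pf = transpose_mat Gm"
  have Pf: "Pf \<in> carrier_mat n n" "star (emr Pf) = G" using Gm by (simp_all add: Pf_def emr_transpose)
  \<comment> \<open>Applied twice: to the constructed solution \<open>G\<close> and, for claim
    (iii), to the inverse of \<open>Q\<close>.\<close>
  have stG: "stable_f n (star e) (star a - s2 * H)"
    if "corner n H" "cconj H = H" "psdf (e * H)" "gare (star a) s2 w2 H" for H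
    by (rule stable_f_of_psd[where W = w2]) (use that cr real psd adm4 in \<open>simp_all add: corner_star\<close>)
  have ex1: "GC_stabilizing n E A B C Pc" unfolding GC[OF Pc(1)] Pc(2)
  proof (intro conjI)
    show "star e * P = star P * e" using psdf_star[OF P(3)] by simp
    show "stable_f n e (a - s * P)"
      by (rule stable_f_of_psd[OF cr(1-3) P(1) real(1-3) P(2) psds P(3,4) adm2])
  qed (rule P)
  have ex2: "GF_stabilizing n E A B C R Pf" unfolding GF[OF Pf(1)] Pf(2)
  proof (intro conjI)
    show "e * G = star G * star e" using psdf_star[OF G(3)] by simp
    show "stable_f n (star e) (star a - s2 * G)" by (rule stG[OF G])
  qed (rule G)
  have "invertible_mat (1\<^sub>m n + Pf * transpose_mat Pc)"
  proof -
    let ?M = "1\<^sub>m n + Pf * transpose_mat Pc"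
    have M: "?M \<in> carrier_mat n n" using Pf Pc by simp
    have eM: "emr ?M = prj 0 n + star G * star P"
      using Pf Pc by (simp add: emr_add[of _ n n] emr_mult[of _ n n _ n] mult_carrier_mat[of _ n n _ n] emr_one emr_transpose Pf(2)[symmetric])
    have "x = 0" if "prj 0 n * x = x" "emr ?M * x = 0" for x
      using inj[of x] that by (simp add: eM distrib_right mult.assoc)
    then obtain y where "prj 0 n * y = y" "y * prj 0 n = y" "emr ?M * y = prj 0 n" "y * emr ?M = prj 0 n"
      "cconj (emr ?M) = emr ?M \<Longrightarrow> cconj y = y"
      using inj_imp_inverse[OF emr_prj[OF M] emr_prj'[OF M]] by metis
    then have "inv_pair 0 n (emr ?M) y" using emr_prj[OF M] emr_prj'[OF M] by (simp add: inv_pair_def)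
    then show ?thesis using invertible_mat_inv_pair[OF M] by blast
  qed
  moreover have "transpose_mat E * P1 = transpose_mat E * P2"
    if "GC_stabilizing n E A B C P1" "GC_stabilizing n E A B C P2" for P1 P2
  proof -
    have p: "P1 \<in> carrier_mat n n" "P2 \<in> carrier_mat n n" using that by (auto simp: GC_stabilizing_def GC_sol_def)
    note 1 = that(1)[unfolded GC[OF p(1)]] and 2 = that(2)[unfolded GC[OF p(2)]]
    have "star e * emr P1 = star e * emr P2"
      by (rule stabilizing_unique[OF cr(1-3) corner_emr[OF p(1)] corner_emr[OF p(2)] psdf_star[OF psds(1)]])
        (use 1 2 in blast)+
    then show ?thesis using p c
      by (intro emr_inj[of _ n n]) (simp_all add: emr_mult[of _ n n _ n] emr_transpose e_def mult_carrier_mat[of _ n n _ n])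
  qed
  moreover have "E * transpose_mat P1 = E * transpose_mat P2"
    if "GF_stabilizing n E A B C R P1" "GF_stabilizing n E A B C R P2" for P1 P2
  proof -
    have p: "P1 \<in> carrier_mat n n" "P2 \<in> carrier_mat n n" using that by (auto simp: GF_stabilizing_def GF_sol_def)
    note 1 = that(1)[unfolded GF[OF p(1)]] and 2 = that(2)[unfolded GF[OF p(2)]]
    have "star (star e) * star (emr P1) = star (star e) * star (emr P2)"
      by (rule stabilizing_unique[OF corner_star[OF cr(1)] corner_star[OF cr(2)] cr(5) corner_star[OF corner_emr[OF p(1)]]
            corner_star[OF corner_emr[OF p(2)]] psdf_star[OF psd(3)]])
        (use 1 2 in \<open>auto simp: star_star\<close>)
    then show ?thesis using p c
      by (intro emr_inj[of _ n n]) (simp_all add: emr_mult[of _ n n _ n] emr_transpose e_def mult_carrier_mat[of _ n n _ n])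
  qed
  moreover have "GF_stabilizing n E A B C R (transpose_mat Qi)" if Qi: "Qi \<in> carrier_mat n n" "Q * Qi = 1\<^sub>m n" for Qi
  proof -
    define q h j r where "q = emr Q" and "h = emr Qi" and "j = emr J" and "r = emr R"
    have qh: "q * h = prj 0 n" using emr_mult[OF c(4) Qi(1)] unfolding Qi(2) by (simp add: emr_one q_def h_def)
    have hq: "star h * star q = prj 0 n" using arg_cong[OF qh, of star] by simp
    have cq: "corner n q" "corner n h" "corner n j" "corner n r" using c Qi by (simp_all add: q_def h_def j_def r_def corner_emr)
    have a: "a = (j - r) * q" using c
      by (simp add: a_def A_def j_def r_def q_def emr_mult[of _ n n _ n] emr_minus[of _ n n] minus_carrier_mat)
    have C: "emr C = star (emr B) * q" using c by (simp add: C_def q_def emr_mult[of _ m n _ n] emr_transpose)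
    have sj: "star j = - j" using arg_cong[OF skew, of emr] by (simp add: emr_transpose emr_uminus j_def)
    have sr: "star r = r" using psdf_star[OF psdf_emr[OF R]] by (simp add: r_def)
    have Bp: "prj 0 n * emr B = emr B" "star (emr B) * prj 0 n = star (emr B)"
      using emr_prj[OF c(5)] by (simp, metis star_prj star_times)
    \<comment> \<open>With \<open>h\<close> the inverse of \<open>Q\<close> the port-Hamiltonian
      structure solves (GF) explicitly: \<open>a * h = j - r\<close> and its adjoint add up to
      \<open>- 2 r\<close>, which cancels \<open>2 R\<close>, and \<open>C\<close> times
      \<open>h\<close> is \<open>B^T\<close>, so the quadratic term cancels
      \<open>B B^T\<close>.\<close>
    have ah: "a * h = j - r" unfolding a using cq qh by (simp add: mult.assoc left_diff_distrib corner_simps)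
    have ha: "star h * star a = - j - r" using arg_cong[OF ah, of star] sj sr by simp
    have hsh: "star h * s2 * h = s"
      using qh hq Bp by (simp add: s2_def w_def C s_def mult.assoc mult_assocD[OF hq] mult_assocD[OF Bp(1)])
    have g: "gare (star a) s2 w2 h"
      unfolding gare_def star_star ah ha hsh w2_def r_def[symmetric]
      using scal_add_left[of 1 1 r] by simp
    \<comment> \<open>Congruence with \<open>h\<close> turns the semidefinite
      \<open>star e * q\<close> into the adjoint of \<open>e * h\<close>, the sign condition that
      \<open>stG\<close> asks for.\<close>
    have "psdf (star e * q)" using psdf_emr[OF EQ] c by (simp add: emr_mult[of _ n n _ n] emr_transpose e_def q_def)
    then have "psdf (star h * (star e * q) * h)" by (rule psdf_conj)
    moreover have "star h * (star e * q) * h = star (e * h)"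
      using qh corner_right[OF corner_star[OF cr(1)]] by (simp add: mult.assoc)
    ultimately have eh: "psdf (e * h)" using psdf_star by (metis star_star)
    have "star (emr (transpose_mat Qi)) = h" by (simp add: emr_transpose h_def)
    then show ?thesis
      unfolding GF[OF transpose_carrier_mat[THEN iffD2, OF Qi(1)]]
      using g eh stG[OF cq(2) _ eh g] psdf_star[OF eh] by (simp add: h_def)
  qed
  ultimately show ?thesis using ex1 ex2 by blast
qed

end
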